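(* Let $\kappa, L, T \ge 1$ be integers such that $\kappa$ bounds the maximum number of live tryLock attempts on any single lock at any given time, $L$ bounds the number of locks in the lock set of any tryLock attempt, and $T$ bounds the number of steps taken by any critical section (thunk); these bounds are known to the algorithm. There exists an algorithm implementing wait-free fine-grained locks (i.e. an implementation of tryLock satisfying mutual exclusion with idempotence) against an oblivious scheduler adversary, with the following properties, where the constant hidden in $O(\cdot)$ is absolute. (Step bound.) Each tryLock attempt takes $O(\kappa^2 L^2 T)$ steps of the invoking process, whether it succeeds or fails. (Fairness bound.) Each tryLock attempt of a process $p$ succeeds with probability at least $\frac{1}{\kappa L}$, independently of $p$'s other attempts (that is, the lower bound holds irrespective of the outcomes of $p$'s other attempts), and this holds even when an adaptive player adversary decides when each tryLock attempt is made.
   Context: **Model.** Asynchronous processes communicate via shared memory with atomic operations Read, Write and CAS (compare-and-swap). Processes may use private randomness. A step is a memory operation or an invocation or response of a procedure. The history of an execution is the interleaved sequence of steps taken so far, annotated with arguments and return values. **Thunks.** A thunk is a procedure with no arguments and no return value that accesses shared memory via Read, Write and CAS; it plays the role of a critical section. Thunks do not contain calls to tryLock. A run of a thunk $\mathcal{T}$ is the sequence of steps taken by a single process to execute or help execute $\mathcal{T}$; it is finished if it reached the end of $\mathcal{T}$. Thunks are executed in an idempotent form: $\mathcal{T}$ is idempotent if in any valid execution $E$ consisting of runs of $\mathcal{T}$ interleaved with arbitrary other steps on shared memory, there is a subsequence $E'$ of the steps of $E$ belonging to runs of $\mathcal{T}$ such that (1) if there is a finished run of $\mathcal{T}$, the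 last step of the first such finished run is the end of $E'$, and (2) removing all of $\mathcal{T}$'s steps from $E$ other than those in $E'$ leaves a valid history consistent with a single run of $\mathcal{T}$ (the same steps, ignoring process ids). The interval of an idempotent thunk is from the first step of any of its runs until the last step of the first run that completes. **tryLock.** A tryLock takes as arguments a lock set (a set of locks) and a thunk, and returns a boolean: true means it succeeds, false means it fails. An execution of a tryLock is a tryLock attempt. It is live on lock $\ell$ from its invocation to its response (inclusive) if $\ell$ is in its lock set. **Mutual exclusion with idempotence.** If a tryLock attempt with thunk $\mathcal{T}$ and lock set $\mathcal{L}$ succeeds, then there is a run of $\mathcal{T}$ that executed to completion, and $\mathcal{T}$'s interval does not overlap the interval of any other thunk whose lock set intersects $\mathcal{L}$. If the attempt fails, there is no run of $\mathcal{T}$. **Wait-freedom.** An algorithm is (randomized) wait-free if each process takes a finite expected number of steps until its operation succeeds (retrying failed attempts). **Adversaries.** The scheduler adversary is oblivious: it is a function, fixed before the execution and unknown to the algorithm, from time steps to the process that executes an instruction at that time step. The player adversary is adaptive: it is a function from the history so far and a given process to a decision whether that process starts a new tryLock at its next step and, if so, with which lock set; it is constrained to respect the bounds $\kappa$ and $L$. **Convention on priorities.** When an algorithm draws uniformly random priorities, the priorities drawn by different attempts are assumed to be distinct (conflicts are ignored). *)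

theory Defs
  imports "HOL-Probability.Probability" "HOL-Library.FSet"
begin

section \<open>Shared memory, programs and histories\<close>

type_synonym proc = nat
type_synonym lock = nat
type_synonym addr = nat

text \<open>Every tryLock attempt is given its own thunk instance; instances are named by a
  \<open>thunk_id\<close>, and different instances may have the same code.\<close>
type_synonym thunk_id = nat

text \<open>The type parameter is the type of memory words. The model uses real words, so that a word can
  hold a (continuously distributed) priority as well as any countable data in encoded form.\<close>
datatype 'w op = Read addr | Write addr 'w | CAS addr 'w 'w
datatype 'w ret = Value 'w | Ack | Flag bool

fun result :: "'w op \<Rightarrow> (addr \<Rightarrow> 'w) \<Rightarrow> 'w ret" where
  "result (Read a) m = Value (m a)"
| "result (Write a w) m = Ack"
| "result (CAS a old new) m = Flag (m a = old)"

fun effect :: "'w op \<Rightarrow> (addr \<Rightarrow> 'w) \<Rightarrow> addr \<Rightarrow> 'w" where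
  "effect (Read a) m = m"
| "effect (Write a w) m = m(a := w)"
| "effect (CAS a old new) m = (if m a = old then m(a := new) else m)"

datatype thunk = Halt | Do "real op" "real ret \<Rightarrow> thunk"

text \<open>Code of a tryLock attempt. \<open>Run\<close> executes the thunk of the attempt itself or helps another one.\<close>
datatype code =
    Return bool
  | Perform "real op" "real ret \<Rightarrow> code"
  | Run thunk_id code

text \<open>A thunk is a procedure, so a run of it starts with an invocation step (\<open>Begin\<close>) and, when it
  is finished, ends with a response step (\<open>Finish\<close>).\<close>
datatype 'w thunk_step = Begin | Access "'w op" "'w ret" | is_Finish: Finish

text \<open>Memory is split into the data on which the thunks operate and the metadata of the lock
  algorithm: \<open>Meta\<close> steps act on the metadata, \<open>Access\<close> steps on the data.\<close>
datatype 'w step =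
    is_Invoke: Invoke "lock fset" thunk_id
  | Respond bool
  | Meta "'w op" "'w ret"
  | Thunk_Step thunk_id "'w thunk_step"

type_synonym 'w history = "(proc \<times> 'w step) list"


section \<open>Thunks: step bound and idempotence\<close>

text \<open>At most \<open>n\<close> memory operations, whatever the contents of memory (which other processes may
  change) at each of them.\<close>
primrec thunk_bound :: "thunk \<Rightarrow> nat \<Rightarrow> bool" where
  "thunk_bound Halt = (\<lambda>n. True)"
| "thunk_bound (Do a k) = (\<lambda>n. 0 < n \<and> (\<forall>m. thunk_bound (k (result a m)) (n - 1)))"

fun follows :: "thunk \<Rightarrow> real thunk_step list \<Rightarrow> bool" where
  "follows c [] = True"
| "follows Halt [Finish] = True"
| "follows (Do a k) (Access a' r # xs) = (a' = a \<and> follows (k r) xs)"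
| "follows _ _ = False"

definition is_run :: "thunk \<Rightarrow> real thunk_step list \<Rightarrow> bool" where
  "is_run c r \<longleftrightarrow> (\<exists>xs. r = Begin # xs \<and> follows c xs)"

definition finished :: "'w thunk_step list \<Rightarrow> bool" where
  "finished r \<longleftrightarrow> r \<noteq> [] \<and> is_Finish (last r)"

text \<open>An execution as seen by the data memory: steps of runs of thunks, tagged with the process
  taking the step and the thunk.\<close>
type_synonym data_execution = "(proc \<times> thunk_id \<times> real thunk_step) list"

fun valid_execution :: "(addr \<Rightarrow> real) \<Rightarrow> data_execution \<Rightarrow> bool" where
  "valid_execution m [] = True"
| "valid_execution m ((p, th, Access a r) # E) =
     (r = result a m \<and> valid_execution (effect a m) E)"
| "valid_execution m (_ # E) = valid_execution m E"

text \<open>Each process executes \<open>th\<close> as a sequence of runs, of which only the last may be unfinished.\<close>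
definition consists_of_runs :: "thunk \<Rightarrow> thunk_id \<Rightarrow> data_execution \<Rightarrow> bool" where
  "consists_of_runs c th E \<longleftrightarrow>
     (\<forall>p. \<exists>rs. concat rs = [s. (q, th', s) \<leftarrow> E, q = p \<and> th' = th] \<and>
       (\<forall>r\<in>set rs. is_run c r) \<and> (\<forall>r\<in>set (butlast rs). finished r))"

definition thunk_indices :: "data_execution \<Rightarrow> thunk_id \<Rightarrow> nat set" where
  "thunk_indices E th = {i. i < length E \<and> fst (snd (E ! i)) = th}"

definition finish_indices :: "data_execution \<Rightarrow> thunk_id \<Rightarrow> nat set" where
  "finish_indices E th = {i \<in> thunk_indices E th. is_Finish (snd (snd (E ! i)))}"

text \<open>Idempotence of \<open>th\<close>; \<open>I\<close> is the set of positions of the retained steps \<open>E'\<close>. The steps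
  interleaved with the runs of \<open>th\<close> are those that can occur on the data memory, namely steps of
  arbitrary, arbitrarily interleaved runs of the other thunks. (If one also allowed raw writes that
  obey no discipline at all, e.g. undoing the effect of a thunk behind its back, then no thunk that
  ever changes memory would be idempotent.)\<close>
definition idempotent :: "(addr \<Rightarrow> real) \<Rightarrow> (thunk_id \<Rightarrow> thunk) \<Rightarrow> thunk_id \<Rightarrow> bool" where
  "idempotent m code th \<longleftrightarrow>
     (\<forall>E. valid_execution m E \<and> (\<forall>th'. consists_of_runs (code th') th' E) \<longrightarrow>
       (\<exists>I \<subseteq> thunk_indices E th.
          (finish_indices E th \<noteq> {} \<longrightarrow>
             Min (finish_indices E th) \<in> I \<and> Max I = Min (finish_indices E th)) \<and>
          valid_execution m (nths E (- (thunk_indices E th - I))) \<and>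
          (I = {} \<or> is_run (code th) (map (\<lambda>(p, t, s). s) (nths E I)))))"


section \<open>Attempts\<close>

text \<open>A tryLock attempt is identified by the position \<open>i\<close> of its invocation in the history.\<close>

definition attempt :: "'w history \<Rightarrow> nat \<Rightarrow> proc \<Rightarrow> lock fset \<Rightarrow> thunk_id \<Rightarrow> bool" where
  "attempt h i p ls th \<longleftrightarrow> i < length h \<and> h ! i = (p, Invoke ls th)"

text \<open>The steps that the invoking process takes from the invocation on, up to its next invocation.
  (Between two of its attempts a process takes no steps.)\<close>
definition own_steps :: "'w history \<Rightarrow> nat \<Rightarrow> nat set" where
  "own_steps h i = {j. i \<le> j \<and> j < length h \<and> fst (h ! j) = fst (h ! i) \<and>
     (\<forall>j'. i < j' \<and> j' \<le> j \<and> fst (h ! j') = fst (h ! i) \<longrightarrow> \<not> is_Invoke (snd (h ! j')))}"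

definition returned :: "'w history \<Rightarrow> nat \<Rightarrow> bool \<Rightarrow> bool" where
  "returned h i b \<longleftrightarrow> (\<exists>j\<in>own_steps h i. snd (h ! j) = Respond b)"

definition live_attempts :: "'w history \<Rightarrow> lock \<Rightarrow> nat set" where
  "live_attempts h l =
     {i. (\<exists>p ls th. attempt h i p ls th \<and> l |\<in>| ls) \<and> (\<forall>b. \<not> returned h i b)}"

definition num_attempts :: "proc \<Rightarrow> 'w history \<Rightarrow> nat" where
  "num_attempts p h = length (filter (\<lambda>(q, s). q = p \<and> is_Invoke s) h)"

fun outcomes :: "proc \<Rightarrow> 'w history \<Rightarrow> bool list" where
  "outcomes p [] = []"
| "outcomes p ((q, Respond b) # h) = (if q = p then b # outcomes p h else outcomes p h)"
| "outcomes p (_ # h) = outcomes p h"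


section \<open>Algorithms, environments and executions\<close>

text \<open>Private randomness: every attempt receives its own seed, which is drawn uniformly from the unit
  interval and not visible in the history. (One such seed is as good as a sequence of coin flips or
  of uniform draws.) The seed is the last argument of \<open>try_lock\<close>.\<close>
record algorithm =
  init_meta :: "addr \<Rightarrow> real"
  try_lock :: "proc \<Rightarrow> lock fset \<Rightarrow> thunk_id \<Rightarrow> real \<Rightarrow> code"

text \<open>The scheduler maps time steps to processes. The player sees the history and decides whether the
  given process starts an attempt and, if so, with which lock set and thunk.\<close>
record environment =
  init_data :: "addr \<Rightarrow> real"
  thunk_code :: "thunk_id \<Rightarrow> thunk"
  scheduler :: "nat \<Rightarrow> proc"
  player :: "real history \<Rightarrow> proc \<Rightarrow> (lock fset \<times> thunk_id) option"

datatype local_state = Idle | Running code | In_Thunk thunk_id thunk code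

record config =
  meta :: "addr \<Rightarrow> real"
  data :: "addr \<Rightarrow> real"
  local :: "proc \<Rightarrow> local_state"
  hist :: "real history"

definition take_step :: "proc \<Rightarrow> real step \<Rightarrow> local_state \<Rightarrow> config \<Rightarrow> config" where
  "take_step p s l c = c\<lparr>local := (local c)(p := l), hist := hist c @ [(p, s)]\<rparr>"

text \<open>\<open>seed (p, k)\<close> is the seed of the \<open>k\<close>-th attempt (counting from 0) of process \<open>p\<close>.\<close>
type_synonym seeds = "proc \<times> nat \<Rightarrow> real"

definition schedule_proc ::
    "algorithm \<Rightarrow> environment \<Rightarrow> seeds \<Rightarrow> proc \<Rightarrow> config \<Rightarrow> config" where
  "schedule_proc A e seed p c = (case local c p of
     Idle \<Rightarrow> (case player e (hist c) p of
         None \<Rightarrow> c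
       | Some (ls, th) \<Rightarrow> take_step p (Invoke ls th)
           (Running (try_lock A p ls th (seed (p, num_attempts p (hist c))))) c)
   | Running (Return b) \<Rightarrow> take_step p (Respond b) Idle c
   | Running (Perform a k) \<Rightarrow>
       (let r = result a (meta c)
        in take_step p (Meta a r) (Running (k r)) (c\<lparr>meta := effect a (meta c)\<rparr>))
   | Running (Run th k) \<Rightarrow> take_step p (Thunk_Step th Begin) (In_Thunk th (thunk_code e th) k) c
   | In_Thunk th Halt k \<Rightarrow> take_step p (Thunk_Step th Finish) (Running k) c
   | In_Thunk th (Do a f) k \<Rightarrow>
       (let r = result a (data c)
        in take_step p (Thunk_Step th (Access a r)) (In_Thunk th (f r) k)
             (c\<lparr>data := effect a (data c)\<rparr>)))"

primrec exec :: "algorithm \<Rightarrow> environment \<Rightarrow> seeds \<Rightarrow> nat \<Rightarrow> config" where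
  "exec A e seed 0 =
     \<lparr>meta = init_meta A, data = init_data e, local = (\<lambda>_. Idle), hist = []\<rparr>"
| "exec A e seed (Suc t) = schedule_proc A e seed (scheduler e t) (exec A e seed t)"

definition history :: "algorithm \<Rightarrow> environment \<Rightarrow> seeds \<Rightarrow> nat \<Rightarrow> real history" where
  "history A e seed t = hist (exec A e seed t)"

text \<open>The decision of the player for a process matters only when that process has no pending attempt.
  \<open>num_attempts p h = length (outcomes p h)\<close> expresses the latter.\<close>
definition admissible :: "nat \<Rightarrow> nat \<Rightarrow> nat \<Rightarrow> environment \<Rightarrow> bool" where
  "admissible \<kappa> L T e \<longleftrightarrow>
     (\<forall>th. thunk_bound (thunk_code e th) T) \<and>
     (\<forall>th. idempotent (init_data e) (thunk_code e) th) \<and>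
     (\<forall>h p ls th. num_attempts p h = length (outcomes p h) \<and> player e h p = Some (ls, th) \<longrightarrow>
        fcard ls \<le> L \<and>
        (\<forall>l. l |\<in>| ls \<longrightarrow> card (live_attempts h l) + 1 \<le> \<kappa>) \<and>
        (\<forall>i q ls'. \<not> attempt h i q ls' th))"


section \<open>Mutual exclusion with idempotence and step bound\<close>

definition thunk_step_at :: "'w history \<Rightarrow> thunk_id \<Rightarrow> nat \<Rightarrow> bool" where
  "thunk_step_at h th j \<longleftrightarrow> j < length h \<and> (\<exists>s. snd (h ! j) = Thunk_Step th s)"

definition finishes_at :: "'w history \<Rightarrow> thunk_id \<Rightarrow> nat \<Rightarrow> bool" where
  "finishes_at h th j \<longleftrightarrow> j < length h \<and> snd (h ! j) = Thunk_Step th Finish"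

text \<open>From the first step of any run to the end of the run that completes first; up to the
  present if no run has completed yet.\<close>
definition interval :: "'w history \<Rightarrow> thunk_id \<Rightarrow> nat set" where
  "interval h th =
     {j. j < length h \<and> (\<exists>i\<le>j. thunk_step_at h th i) \<and> (\<forall>i<j. \<not> finishes_at h th i)}"

text \<open>The first conjunct makes explicit that a process runs a thunk only in order to execute or to
  help an attempt that has been invoked with this thunk.\<close>
definition mutual_exclusion :: "'w history \<Rightarrow> bool" where
  "mutual_exclusion h \<longleftrightarrow>
     (\<forall>j th. thunk_step_at h th j \<longrightarrow> (\<exists>i<j. \<exists>p ls. attempt h i p ls th)) \<and>
     (\<forall>i p ls th. attempt h i p ls th \<longrightarrow>
        (returned h i True \<longrightarrow>
           (\<exists>j. finishes_at h th j) \<and>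
           (\<forall>i' p' ls' th'. attempt h i' p' ls' th' \<and> i' \<noteq> i \<and> ls |\<inter>| ls' \<noteq> {||} \<longrightarrow>
              interval h th \<inter> interval h th' = {})) \<and>
        (returned h i False \<longrightarrow> (\<forall>j. \<not> thunk_step_at h th j)))"

definition step_bound :: "nat \<Rightarrow> 'w history \<Rightarrow> bool" where
  "step_bound B h \<longleftrightarrow> (\<forall>i p ls th. attempt h i p ls th \<longrightarrow> card (own_steps h i) \<le> B)"

text \<open>Priorities drawn by different attempts are assumed to be distinct. The set below has
  probability 1.\<close>
definition conflict_free :: "seeds set" where
  "conflict_free = {seed. inj seed \<and> range seed \<subseteq> {0..1}}"


section \<open>Fairness and wait-freedom\<close>

definition seed_space :: "seeds measure" where
  "seed_space = (\<Pi>\<^sub>M i\<in>UNIV. uniform_measure lborel {0..1})"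

text \<open>Histories of one shape, with words varying below given bounds, generate the Borel sets of
  histories.\<close>
definition history_space :: "real history measure" where
  "history_space =
     sigma UNIV (range (\<lambda>g. {h. list_all2 (rel_prod (=) (rel_step (\<le>))) h g}))"

definition measurable_player :: "environment \<Rightarrow> bool" where
  "measurable_player e \<longleftrightarrow>
     (\<forall>p. (\<lambda>h. player e h p) \<in> measurable history_space (count_space UNIV))"

text \<open>Process \<open>p\<close> makes an attempt after its previous attempts had exactly the outcomes \<open>bs\<close>.\<close>
definition attempt_made :: "algorithm \<Rightarrow> environment \<Rightarrow> proc \<Rightarrow> bool list \<Rightarrow> seeds set" where
  "attempt_made A e p bs = {seed \<in> space seed_space.
     \<exists>t. length bs < num_attempts p (history A e seed t) \<and>
         take (length bs) (outcomes p (history A e seed t)) = bs}"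

definition attempt_won :: "algorithm \<Rightarrow> environment \<Rightarrow> proc \<Rightarrow> bool list \<Rightarrow> seeds set" where
  "attempt_won A e p bs = {seed \<in> space seed_space.
     \<exists>t. take (Suc (length bs)) (outcomes p (history A e seed t)) = bs @ [True]}"

text \<open>The probability that an attempt succeeds, conditional on any outcomes of the previous attempts
  of the process, is at least \<open>\<rho>\<close>. The process must be scheduled often enough for its attempts
  to complete; nothing is assumed about the other processes.\<close>
definition fair :: "real \<Rightarrow> algorithm \<Rightarrow> environment \<Rightarrow> bool" where
  "fair \<rho> A e \<longleftrightarrow> (\<forall>p bs. infinite {t. scheduler e t = p} \<longrightarrow>
     attempt_made A e p bs \<in> sets seed_space \<and>
     attempt_won A e p bs \<in> sets seed_space \<and>
     measure seed_space (attempt_won A e p bs) \<ge> \<rho> * measure seed_space (attempt_made A e p bs))"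

text \<open>Steps of \<open>p\<close> in the operation that starts with its \<open>k\<close>-th attempt (counting from 0) and retries
  until success, i.e. steps up to the first success among the attempts \<open>k\<close>, \<open>k + 1\<close>, \<dots>\<close>
definition operation_steps :: "proc \<Rightarrow> nat \<Rightarrow> 'w history \<Rightarrow> nat" where
  "operation_steps p k h = card {j. j < length h \<and> fst (h ! j) = p \<and>
     k < num_attempts p (take (Suc j) h) \<and>
     True \<notin> set (drop k (outcomes p (take j h)))}"

definition wait_free :: "algorithm \<Rightarrow> environment \<Rightarrow> bool" where
  "wait_free A e \<longleftrightarrow> (\<forall>p k.
     (\<lambda>seed. SUP t. of_nat (operation_steps p k (history A e seed t)) :: ennreal)
        \<in> borel_measurable seed_space \<and>
     (\<integral>\<^sup>+ seed. (SUP t. of_nat (operation_steps p k (history A e seed t))) \<partial>seed_space) < \<infinity>)"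

end

(* The proof idea. Each lock has \<kappa> slots. An attempt claims one slot of each of its locks by climbing from
   the first one: at most \<kappa> - i live attempts can have reached position i, so it always finds a free
   slot. It then helps every attempt that it sees contending to the end. Next it waits for a window of
   3E steps, E = 500 \<kappa>^2 L^2 T, scanning its slots cyclically and pausing on an attempt that contends;
   at a random step of the grid 0, ..., 4E - 1 (in the window with probability 3/4) it becomes a
   contender by one atomic write to its status word. A contender that finds another contender in its
   slots loses, otherwise it wins and its thunk is run; as the outcome is decided by a CAS on the status
   word, any number of helpers can do this on its behalf. Of two contenders sharing a lock, the later one
   finds the earlier one, which gives mutual exclusion.

   For fairness, a loss needs a pair of nearby random events: the step at which the attempt contends (or
   would do so) and the start of another contention, which lies within a bounded number of steps before
   or after. For every step, the conditional probability that a random index strikes there, given the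
   past, is at most 1/E. The steps of the attempt and the nearby steps of competitors form at most E^2/4
   pairs, so an attempt loses with probability at most 1/4 + 1/4, the first summand accounting for
   indices outside the window. Hence it succeeds with probability at least 1/2, which is at least
   1/(\<kappa> L) if \<kappa> > 1; for \<kappa> = 1 there is no competitor. The paper's exact delays cannot be used here,
   because code in this model does not learn how many steps a thunk took; the statuses read while
   waiting and a padding of fixed length take their place. *)

theory Submission
  imports Defs
begin

section \<open>The algorithm\<close>

text \<open>A single random event is no rarity: the window has length of order \<open>E\<close>, so
  an attempt strikes somewhere in it with probability 3/4. A pair of events is rare. An attempt has
  at most \<open>4 * E\<close> steps, each with at most \<open>pairs\<close> nearby steps of
  competitors, and every such pair costs \<open>1 / E^2\<close>; the total is
  \<open>4 * pairs / E\<close>. So \<open>E\<close> need only be linear in \<open>pairs\<close>,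
  which is of order \<open>\<kappa> * L * (\<kappa> * L + T)\<close>. Nearness must be counted in
  steps of the competitor, since the scheduler can stretch a contention arbitrarily in global time.
  Three ingredients keep that count finite. Helping before waiting keeps newcomers out of a running
  contention. Pausing stops those who were already waiting, after a bounded scan. Padding keeps the
  slots of everybody who was waiting recently occupied, so that competitors can be counted by the
  slots at one fixed moment. Pausing still uses up the window, which keeps the number of steps
  bounded; the price is that an index falling into a pause is forfeited and has to be charged to a
  random event of its own.\<close>

type_synonym slot = "lock \<times> nat"
type_synonym desc = "thunk_id \<times> lock list"

text \<open>The successor keeps the word 0 free for empty slots.\<close>

definition enc :: "desc \<Rightarrow> real" where
  "enc d = real (Suc (to_nat d))"

definition dec :: "real \<Rightarrow> desc" where
  "dec w = from_nat (nat \<lfloor>w\<rfloor> - 1)"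

definition slot_addr :: "slot \<Rightarrow> addr" where
  "slot_addr s = 2 * prod_encode s"

definition stat_addr :: "thunk_id \<Rightarrow> addr" where
  "stat_addr th = 2 * th + 1"

lemma dec_enc [simp]: "dec (enc d) = d"
  by (simp add: dec_def enc_def flip: of_nat_Suc)

lemma enc_inject [simp]: "enc d = enc d' \<longleftrightarrow> d = d'"
  by (metis dec_enc)

lemma enc_neq_0 [simp]: "enc d \<noteq> 0" "0 \<noteq> enc d"
  by (simp_all add: enc_def)

lemma slot_addr_inject [simp]: "slot_addr s = slot_addr s' \<longleftrightarrow> s = s'"
  by (simp add: slot_addr_def)

lemma stat_addr_inject [simp]: "stat_addr a = stat_addr b \<longleftrightarrow> a = b"
  by (simp add: stat_addr_def)

lemma slot_stat_addr [simp]: "slot_addr s \<noteq> stat_addr a" "stat_addr a \<noteq> slot_addr s"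
  unfolding slot_addr_def stat_addr_def by presburger+

text \<open>The status word of an attempt is 0 (not yet contending), 1 (contending), 2 (won, thunk not yet
  known to be finished), 3 (lost) or 4 (won and finished).\<close>
definition hot :: "real \<Rightarrow> bool" where
  "hot w \<longleftrightarrow> w = 1 \<or> w = 2"

lemma hot_simps [simp]: "\<not> hot 0" "hot 1" "hot 2" "\<not> hot 3" "\<not> hot 4"
  by (simp_all add: hot_def)

text \<open>The descriptor before \<open>slot list option\<close> is that of the attempt being decided: \<open>None\<close> if a process
  contends for itself, \<open>Some rest\<close> if it helps another attempt and has still to look at the slots
  \<open>rest\<close>. The number in \<open>Wait\<close>, \<open>WaitAt\<close> and \<open>Stuck\<close> counts the steps of the window.\<close>
datatype pc =
    Enter "lock list" nat
  | Look "slot list"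
  | LookAt desc "slot list"
  | Check desc "slot list option" "slot list"
  | CheckAt desc "slot list option" desc "slot list"
  | Decide desc "slot list option" real
  | Inspect desc "slot list option"
  | Launch desc "slot list option"
  | Inside desc "slot list option" thunk
  | Close desc "slot list option"
  | Wait nat "slot list"
  | WaitAt nat desc "slot list"
  | Stuck nat desc "slot list"
  | Pad nat
  | Fetch
  | Leave bool "slot list"

lemma pc_cases:
  obtains j where "pc = Enter [] j" | l ls j where "pc = Enter (l # ls) j"
  | "pc = Look []" | s rest where "pc = Look (s # rest)"
  | y rest where "pc = LookAt y rest"
  | x b where "pc = Check x b []" | x b s rest where "pc = Check x b (s # rest)"
  | x b y rest where "pc = CheckAt x b y rest"
  | x b w where "pc = Decide x b w"
  | x b where "pc = Inspect x b"
  | x b where "pc = Launch x b"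
  | x b where "pc = Inside x b Halt" | x b a f where "pc = Inside x b (Do a f)"
  | x b where "pc = Close x b"
  | i where "pc = Wait i []" | i s rest where "pc = Wait i (s # rest)"
  | i y rest where "pc = WaitAt i y rest"
  | i y rest where "pc = Stuck i y rest"
  | "pc = Pad 0" | n where "pc = Pad (Suc n)"
  | "pc = Fetch"
  | b where "pc = Leave b []" | b s rest where "pc = Leave b (s # rest)"
  by (metis list.exhaust old.nat.exhaust pc.exhaust thunk.exhaust)

fun val :: "real ret \<Rightarrow> real" where
  "val (Value w) = w"
| "val _ = 0"

text \<open>Serves as the rank of a partly executed thunk. A thunk may branch infinitely, so the
  least bound over all memory contents takes the place of a length. The \<open>LEAST\<close> is
  meaningful only for bounded thunks, which is why \<open>pc_ok\<close> carries a bound for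
  \<open>Inside\<close>.\<close>

definition thunk_length :: "thunk \<Rightarrow> nat" where
  "thunk_length c = (LEAST n. thunk_bound c n)"

locale algo =
  fixes \<kappa> L T E :: nat
  assumes pos: "1 \<le> \<kappa>" "1 \<le> L" "1 \<le> T" "1 \<le> E"
begin

text \<open>The truncation makes \<open>length_slots\<close>, and with it the termination of
  \<open>code_of\<close>, hold for every descriptor. Descriptors that occur in an admissible
  execution are not shortened by it (\<open>known_props\<close>).\<close>

definition slots :: "desc \<Rightarrow> slot list" where
  "slots d = List.product (take L (snd d)) [0..<\<kappa>]"

text \<open>\<open>help_cost\<close> bounds the steps from the status write of a contender to its own decision. The padding
  exceeds it, so that a process which has contended or paused keeps its slots at least that long.\<close>
definition help_cost :: nat where "help_cost = 2 * (\<kappa> * L) + T + 8"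
definition pad_length :: nat where "pad_length = Suc help_cost"
definition window :: nat where "window = 3 * E"

fun resume :: "slot list option \<Rightarrow> pc" where
  "resume None = Pad pad_length"
| "resume (Some rest) = Look rest"

definition tick :: "nat \<Rightarrow> pc \<Rightarrow> pc" where
  "tick i s = (if Suc i < window then s else Pad pad_length)"

text \<open>\<open>u\<close> is the random index of the attempt. A \<open>Read 0\<close> whose result is ignored only spends a step.\<close>
fun next_op :: "desc \<Rightarrow> nat \<Rightarrow> pc \<Rightarrow> real op" where
  "next_op d u (Enter (l # ls) j) = CAS (slot_addr (l, j)) 0 (enc d)"
| "next_op d u (Look (s # rest)) = Read (slot_addr s)"
| "next_op d u (LookAt y rest) = Read (stat_addr (fst y))"
| "next_op d u (Check x r (s # rest)) = Read (slot_addr s)"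
| "next_op d u (CheckAt x r y rest) = Read (stat_addr (fst y))"
| "next_op d u (Decide x r w) = CAS (stat_addr (fst x)) 1 w"
| "next_op d u (Inspect x r) = Read (stat_addr (fst x))"
| "next_op d u (Close x r) = CAS (stat_addr (fst x)) 2 4"
| "next_op d u (Wait i []) = (if i = u then CAS (stat_addr (fst d)) 0 1 else Read 0)"
| "next_op d u (Wait i (s # rest)) =
     (if i = u then CAS (stat_addr (fst d)) 0 1 else Read (slot_addr s))"
| "next_op d u (WaitAt i y rest) =
     (if i = u then CAS (stat_addr (fst d)) 0 1 else Read (stat_addr (fst y)))"
| "next_op d u (Stuck i y rest) = Read (stat_addr (fst y))"
| "next_op d u Fetch = Read (stat_addr (fst d))"
| "next_op d u (Leave b (s # rest)) = CAS (slot_addr s) (enc d) 0"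
| "next_op d u _ = Read 0"

fun next_pc :: "desc \<Rightarrow> nat \<Rightarrow> pc \<Rightarrow> real ret \<Rightarrow> pc" where
  "next_pc d u (Enter [] j) r = Look (slots d)"
| "next_pc d u (Enter (l # ls) j) r =
     (if r = Flag True \<or> \<kappa> \<le> Suc j then Enter ls 0 else Enter (l # ls) (Suc j))"
| "next_pc d u (Look []) r = Wait 0 (slots d)"
| "next_pc d u (Look (s # rest)) r =
     (if val r = 0 \<or> val r = enc d then Look rest else LookAt (dec (val r)) rest)"
| "next_pc d u (LookAt y rest) r =
     (if hot (val r) then Check y (Some rest) (slots y) else Look rest)"
| "next_pc d u (Check x b []) r = Decide x b 2"
| "next_pc d u (Check x b (s # rest)) r =
     (if val r = 0 \<or> val r = enc x then Check x b rest else CheckAt x b (dec (val r)) rest)"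
| "next_pc d u (CheckAt x b y rest) r = (if hot (val r) then Decide x b 3 else Check x b rest)"
| "next_pc d u (Decide x b w) r = Inspect x b"
| "next_pc d u (Inspect x b) r = (if val r = 2 then Launch x b else resume b)"
| "next_pc d u (Launch x b) r = Close x b"
| "next_pc d u (Inside x b c) r = Close x b"
| "next_pc d u (Close x b) r = resume b"
| "next_pc d u (Wait i []) r =
     (if i = u then Check d None (slots d) else tick i (Wait (Suc i) (slots d)))"
| "next_pc d u (Wait i (s # rest)) r =
     (if i = u then Check d None (slots d)
      else if val r = 0 \<or> val r = enc d then tick i (Wait (Suc i) rest)
      else tick i (WaitAt (Suc i) (dec (val r)) rest))"
| "next_pc d u (WaitAt i y rest) r =
     (if i = u then Check d None (slots d)
      else if hot (val r) then tick i (Stuck (Suc i) y rest)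
      else tick i (Wait (Suc i) rest))"
| "next_pc d u (Stuck i y rest) r =
     (if i = u then Pad pad_length
      else if hot (val r) then tick i (Stuck (Suc i) y rest)
      else tick i (Wait (Suc i) rest))"
| "next_pc d u (Pad 0) r = Fetch"
| "next_pc d u (Pad (Suc n)) r = Pad n"
| "next_pc d u Fetch r = Leave (val r = 4) (slots d)"
| "next_pc d u (Leave b []) r = Leave b []"
| "next_pc d u (Leave b (s # rest)) r = Leave b rest"

section \<open>A potential that bounds the remaining steps\<close>

definition pad_rank :: nat where "pad_rank = pad_length + \<kappa> * L + 3"
definition wait_rank :: nat where "wait_rank = window + help_cost + pad_rank"
definition look_rank :: "slot list \<Rightarrow> nat" where
  "look_rank rest = length rest * (help_cost + 2) + wait_rank + 1"

fun resume_rank :: "slot list option \<Rightarrow> nat" where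
  "resume_rank None = pad_rank"
| "resume_rank (Some rest) = look_rank rest"

text \<open>Built from the last phase backwards, with the most expensive continuation in each state.
  A slot on the list of \<open>Look\<close> pays for two reads and one complete help; the
  \<open>help_cost\<close> of the waiting states pays for the contention that ends the wait. The
  same potential yields the termination of \<open>code_of\<close>, the step bound and the duration
  of a contention.\<close>

fun rank :: "pc \<Rightarrow> nat" where
  "rank (Enter [] j) = \<kappa> * L * (help_cost + 2) + wait_rank + 2"
| "rank (Enter (l # ls) j) =
     \<kappa> * L * (help_cost + 2) + wait_rank + 3 + length ls * (\<kappa> + 1) + (\<kappa> - j)"
| "rank (Look rest) = look_rank rest"
| "rank (LookAt y rest) = look_rank rest + help_cost + 1"
| "rank (Check x b rest) = resume_rank b + T + 7 + 2 * length rest"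
| "rank (CheckAt x b y rest) = resume_rank b + T + 8 + 2 * length rest"
| "rank (Decide x b w) = resume_rank b + T + 6"
| "rank (Inspect x b) = resume_rank b + T + 5"
| "rank (Launch x b) = resume_rank b + T + 4"
| "rank (Inside x b c) = resume_rank b + thunk_length c + 2"
| "rank (Close x b) = resume_rank b + 1"
| "rank (Wait i rest) = window - i + help_cost + pad_rank"
| "rank (WaitAt i y rest) = window - i + help_cost + pad_rank"
| "rank (Stuck i y rest) = window - i + help_cost + pad_rank"
| "rank (Pad n) = n + \<kappa> * L + 3"
| "rank Fetch = \<kappa> * L + 2"
| "rank (Leave b rest) = length rest + 1"

lemma length_slots: "length (slots d) \<le> \<kappa> * L"
  by (simp add: slots_def)

lemma rank_resume [simp]: "rank (resume b) = resume_rank b"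
  by (cases b) (simp_all add: pad_rank_def)

lemma rank_tick:
  assumes "rank s \<le> window - Suc i + help_cost + pad_rank"
  shows "rank (tick i s) < window - i + help_cost + pad_rank"
  using assms by (auto simp: tick_def pad_rank_def pad_length_def help_cost_def)

lemma rank_next_pc:
  assumes "\<And>b. pc \<noteq> Leave b []" "\<And>x b. pc \<noteq> Launch x b" "\<And>x b c. pc \<noteq> Inside x b c"
  shows "rank (next_pc d u pc r) < rank pc"
proof -
  have l: "length (slots x) \<le> \<kappa> * L" for x by (rule length_slots)
  have c: "6 + (T + 2 * length (slots x)) < help_cost" for x
    using l[of x] by (auto simp: help_cost_def)
  have c': "T + (7 + 2 * length (slots x)) < n + help_cost" for x n
    using l[of x] by (auto simp: help_cost_def)
  have re: "rank (Enter ls 0) \<le> \<kappa> * L * (help_cost + 2) + wait_rank + 2 + length ls * (\<kappa> + 1)" for ls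
    by (cases ls) auto
  have lr: "look_rank (slots x) \<le> \<kappa> * L * (help_cost + 2) + wait_rank + 1" for x
    using l[of x] mult_le_mono1[OF l, of x "help_cost+2"] by (simp add: look_rank_def)
  have pr: "rank (Pad pad_length) = pad_rank" by (simp add: pad_rank_def)
  show ?thesis
    using assms lr[of d]
    apply (cases "(d, u, pc, r)" rule: next_pc.cases)
    apply (simp_all add: rank_tick pr le_imp_less_Suc[OF l] le_imp_less_Suc[OF re] del: rank.simps(15))
    using c by (auto simp: c' rank_tick look_rank_def wait_rank_def pad_rank_def pad_length_def
        le_less_trans[OF re] le_imp_less_Suc[OF l] trans_less_add2)
qed

text \<open>While a thunk runs, the model stores it next to its continuation in
  \<open>In_Thunk\<close>, and \<open>conc_local\<close> renders \<open>Inside\<close> in that way;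
  the equation for \<open>Inside\<close> here is a default value. The recursion passes under the
  function in \<open>Perform\<close>, so \<open>rank\<close> has to decrease for every result of the
  operation.\<close>

function code_of :: "desc \<Rightarrow> nat \<Rightarrow> pc \<Rightarrow> code" where
  "code_of d u (Leave b []) = Return b"
| "code_of d u (Launch x b) = Run (fst x) (code_of d u (Close x b))"
| "code_of d u (Inside x b c) = Return False"
| "(\<And>b. pc \<noteq> Leave b []) \<Longrightarrow> (\<And>x b. pc \<noteq> Launch x b) \<Longrightarrow> (\<And>x b c. pc \<noteq> Inside x b c) \<Longrightarrow>
   code_of d u pc = Perform (next_op d u pc) (\<lambda>r. code_of d u (next_pc d u pc r))"
proof goal_cases
  case (1 P x)
  then show ?case by (metis prod_cases3)
qed (auto, metis)
termination
  by (relation "Wellfounded.measure (\<lambda>(d, u, pc). rank pc)") (use rank_next_pc in auto)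

declare code_of.simps(4) [simp del]

end


section \<open>The explicit state machine\<close>

datatype proc_state = Idl | Act nat desc pc

record state =
  mem :: "addr \<Rightarrow> real"
  dat :: "addr \<Rightarrow> real"
  loc :: "proc \<Rightarrow> proc_state"
  tr :: "real history"

definition move :: "proc \<Rightarrow> real step \<Rightarrow> proc_state \<Rightarrow> state \<Rightarrow> state" where
  "move q s l g = g\<lparr>loc := (loc g)(q := l), tr := tr g @ [(q, s)]\<rparr>"

context algo
begin

fun pc_step :: "environment \<Rightarrow> nat \<Rightarrow> proc \<Rightarrow> nat \<Rightarrow> desc \<Rightarrow> pc \<Rightarrow> state \<Rightarrow> state" where
  "pc_step e u q k d (Leave b []) g = move q (Respond b) Idl g"
| "pc_step e u q k d (Launch x b) g =
     move q (Thunk_Step (fst x) Begin) (Act k d (Inside x b (thunk_code e (fst x)))) g"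
| "pc_step e u q k d (Inside x b Halt) g =
     move q (Thunk_Step (fst x) Finish) (Act k d (Close x b)) g"
| "pc_step e u q k d (Inside x b (Do a f)) g =
     move q (Thunk_Step (fst x) (Access a (result a (dat g))))
       (Act k d (Inside x b (f (result a (dat g))))) (g\<lparr>dat := effect a (dat g)\<rparr>)"
| "pc_step e u q k d pc g =
     move q (Meta (next_op d u pc) (result (next_op d u pc) (mem g)))
       (Act k d (next_pc d u pc (result (next_op d u pc) (mem g)))) (g\<lparr>mem := effect (next_op d u pc) (mem g)\<rparr>)"

definition gstep :: "environment \<Rightarrow> (proc \<times> nat \<Rightarrow> nat) \<Rightarrow> proc \<Rightarrow> state \<Rightarrow> state" where
  "gstep e u q g = (case loc g q of
     Idl \<Rightarrow> (case player e (tr g) q of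
         None \<Rightarrow> g
       | Some (ls, th) \<Rightarrow> move q (Invoke ls th)
           (Act (num_attempts q (tr g)) (th, sorted_list_of_fset ls)
              (Enter (take L (sorted_list_of_fset ls)) 0)) g)
   | Act k d pc \<Rightarrow> pc_step e (u (q, k)) q k d pc g)"

primrec run :: "environment \<Rightarrow> (proc \<times> nat \<Rightarrow> nat) \<Rightarrow> nat \<Rightarrow> state" where
  "run e u 0 = \<lparr>mem = (\<lambda>_. 0), dat = init_data e, loc = (\<lambda>_. Idl), tr = []\<rparr>"
| "run e u (Suc t) = gstep e u (scheduler e t) (run e u t)"

definition alg :: "(real \<Rightarrow> nat) \<Rightarrow> algorithm" where
  "alg pick = \<lparr>init_meta = (\<lambda>_. 0),
     try_lock = (\<lambda>q ls th s. code_of (th, sorted_list_of_fset ls) (pick s)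
       (Enter (take L (sorted_list_of_fset ls)) 0))\<rparr>"

fun conc_local :: "nat \<Rightarrow> desc \<Rightarrow> pc \<Rightarrow> local_state" where
  "conc_local u d (Inside x b c) = In_Thunk (fst x) c (code_of d u (Close x b))"
| "conc_local u d pc = Running (code_of d u pc)"

text \<open>The machine keeps program counters where the model keeps code; \<open>conc\<close> is the refinement map.\<close>
definition conc :: "(proc \<times> nat \<Rightarrow> nat) \<Rightarrow> state \<Rightarrow> config" where
  "conc u g = \<lparr>meta = mem g, data = dat g,
     local = (\<lambda>q. case loc g q of Idl \<Rightarrow> Idle | Act k d pc \<Rightarrow> conc_local (u (q, k)) d pc), hist = tr g\<rparr>"

lemma conc_local_next_pc:
  assumes "\<And>b. pc \<noteq> Leave b []" "\<And>x b. pc \<noteq> Launch x b" "\<And>x b c. pc \<noteq> Inside x b c"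
  shows "conc_local u d (next_pc d u pc r) = Running (code_of d u (next_pc d u pc r))"
proof -
  have r: "resume b \<noteq> Inside x b' c" for b x b' c by (cases b) auto
  have "next_pc d u pc r \<noteq> Inside x b c" for x b c
    using assms by (cases "(d, u, pc, r)" rule: next_pc.cases) (auto simp: tick_def r)
  then show ?thesis by (cases "next_pc d u pc r") auto
qed

lemma sim_step:
  assumes l: "loc g q = Act k d pc"
  shows "schedule_proc (alg pick) e seed q (conc (pick \<circ> seed) g) = conc (pick \<circ> seed) (gstep e (pick \<circ> seed) q g)"
proof -
  let ?u = "pick (seed (q, k))"
  consider b where "pc = Leave b []" | x b where "pc = Launch x b" | x b where "pc = Inside x b Halt"
    | x b a f where "pc = Inside x b (Do a f)"
    | "\<And>b. pc \<noteq> Leave b []" "\<And>x b. pc \<noteq> Launch x b" "\<And>x b c. pc \<noteq> Inside x b c"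
    by (metis thunk.exhaust)
  then show ?thesis
  proof cases
    case 5
    let ?a = "next_op d ?u pc"
    have s: "pc_step e ?u q k d pc g =
       move q (Meta ?a (result ?a (mem g))) (Act k d (next_pc d ?u pc (result ?a (mem g)))) (g\<lparr>mem := effect ?a (mem g)\<rparr>)"
      using 5 by (cases "(e, ?u, q, k, d, pc, g)" rule: pc_step.cases) auto
    have c: "conc_local ?u d pc = Running (Perform ?a (\<lambda>r. code_of d ?u (next_pc d ?u pc r)))"
      using 5 by (cases pc) (auto simp: code_of.simps(4))
    show ?thesis
      by (auto simp: schedule_proc_def gstep_def l s conc_def take_step_def move_def c Let_def
          conc_local_next_pc[OF 5] fun_eq_iff split: proc_state.splits)
  qed (auto simp: schedule_proc_def gstep_def l conc_def take_step_def move_def Let_def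
        fun_eq_iff code_of.simps(4) split: proc_state.splits)
qed

lemma sim_idle:
  assumes l: "loc g q = Idl"
  shows "schedule_proc (alg pick) e seed q (conc (pick \<circ> seed) g) = conc (pick \<circ> seed) (gstep e (pick \<circ> seed) q g)"
  by (auto simp: l schedule_proc_def gstep_def conc_def take_step_def move_def alg_def
      fun_eq_iff split: option.splits proc_state.splits)

lemma exec_eq_run: "exec (alg pick) e seed t = conc (pick \<circ> seed) (run e (pick \<circ> seed) t)"
proof (induction t)
  case 0
  show ?case by (simp add: conc_def alg_def)
next
  case (Suc t)
  let ?q = "scheduler e t" and ?g = "run e (pick \<circ> seed) t"
  show ?case
  proof (cases "loc ?g ?q")
    case Idl
    show ?thesis by (simp only: exec.simps Suc.IH run.simps sim_idle[OF Idl])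
  next
    case (Act k d pc)
    show ?thesis by (simp only: exec.simps Suc.IH run.simps sim_step[OF Act])
  qed
qed

lemma history_eq_tr: "history (alg pick) e seed t = tr (run e (pick \<circ> seed) t)"
  by (simp add: history_def exec_eq_run conc_def)

end

section \<open>Status words, slots and descriptors\<close>

definition stat :: "state \<Rightarrow> thunk_id \<Rightarrow> real" where
  "stat g th = mem g (stat_addr th)"

definition slot :: "state \<Rightarrow> slot \<Rightarrow> real" where
  "slot g s = mem g (slot_addr s)"

definition known :: "state \<Rightarrow> desc set" where
  "known g = {d. \<exists>q ls. (q, Invoke ls (fst d)) \<in> set (tr g) \<and> snd d = sorted_list_of_fset ls}"

definition share :: "desc \<Rightarrow> desc \<Rightarrow> bool" where
  "share x y \<longleftrightarrow> x \<noteq> y \<and> set (snd x) \<inter> set (snd y) \<noteq> {}"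

lemma length_sorted_list_of_fset [simp]: "length (sorted_list_of_fset ls) = fcard ls"
  by (simp add: sorted_list_of_fset.rep_eq fcard.rep_eq)

lemma attempt_append:
  "attempt (h @ [x]) i p ls th \<longleftrightarrow> attempt h i p ls th \<or> (i = length h \<and> x = (p, Invoke ls th))"
  by (auto simp: attempt_def nth_append less_Suc_eq)

lemma attempt_iff_mem: "(\<exists>i. attempt h i p ls th) \<longleftrightarrow> (p, Invoke ls th) \<in> set h"
  by (auto simp: attempt_def in_set_conv_nth)

lemma num_attempts_append:
  "num_attempts p (h @ [(q, s)]) = num_attempts p h + (if q = p \<and> is_Invoke s then 1 else 0)"
  by (simp add: num_attempts_def)

lemma num_attempts_Nil [simp]: "num_attempts p [] = 0"
  by (simp add: num_attempts_def)

lemma outcomes_append: "outcomes p (h @ h') = outcomes p h @ outcomes p h'"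
  by (induction p h rule: outcomes.induct) auto

lemma outcomes_snoc:
  "outcomes p (h @ [(q, s)]) = outcomes p h @ (case s of Respond b \<Rightarrow> if q = p then [b] else [] | _ \<Rightarrow> [])"
  by (cases s) (auto simp: outcomes_append)

context algo
begin

lemma set_slots: "set (slots d) = set (take L (snd d)) \<times> {..<\<kappa>}"
  by (auto simp: slots_def)

fun after :: "environment \<Rightarrow> nat \<Rightarrow> nat \<Rightarrow> desc \<Rightarrow> pc \<Rightarrow> state \<Rightarrow> proc_state" where
  "after e u k d (Leave b []) g = Idl"
| "after e u k d (Launch x b) g = Act k d (Inside x b (thunk_code e (fst x)))"
| "after e u k d (Inside x b Halt) g = Act k d (Close x b)"
| "after e u k d (Inside x b (Do a f)) g = Act k d (Inside x b (f (result a (dat g))))"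
| "after e u k d pc g = Act k d (next_pc d u pc (result (next_op d u pc) (mem g)))"

fun label :: "environment \<Rightarrow> nat \<Rightarrow> desc \<Rightarrow> pc \<Rightarrow> state \<Rightarrow> real step" where
  "label e u d (Leave b []) g = Respond b"
| "label e u d (Launch x b) g = Thunk_Step (fst x) Begin"
| "label e u d (Inside x b Halt) g = Thunk_Step (fst x) Finish"
| "label e u d (Inside x b (Do a f)) g = Thunk_Step (fst x) (Access a (result a (dat g)))"
| "label e u d pc g = Meta (next_op d u pc) (result (next_op d u pc) (mem g))"

text \<open>\<open>Stuck\<close> is absent on purpose: an index that is reached while pausing leads
  to the padding and not to a contention. In contrast, \<open>window_index\<close> and
  \<open>hit\<close> below include the pausing states.\<close>

definition trig :: "nat \<Rightarrow> pc \<Rightarrow> bool" where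
  "trig u pc \<longleftrightarrow> (\<exists>rest. pc = Wait u rest) \<or> (\<exists>y rest. pc = WaitAt u y rest)"

lemma trig_simps [simp]:
  "trig u (Wait i rest) \<longleftrightarrow> i = u" "trig u (WaitAt i y rest) \<longleftrightarrow> i = u"
  "\<not> trig u (Enter ls j)" "\<not> trig u (Look rest)" "\<not> trig u (LookAt y rest)"
  "\<not> trig u (Check x b rest)" "\<not> trig u (CheckAt x b y rest)" "\<not> trig u (Decide x b w)"
  "\<not> trig u (Inspect x b)" "\<not> trig u (Launch x b)" "\<not> trig u (Inside x b c)" "\<not> trig u (Close x b)"
  "\<not> trig u (Stuck i y rest)" "\<not> trig u (Pad n)" "\<not> trig u Fetch" "\<not> trig u (Leave r rest)"
  by (auto simp: trig_def)

lemma loc_pc_step [simp]: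
  "loc (pc_step e u q k d pc g) = (loc g)(q := after e u k d pc g)"
  by (cases "(e, u, q, k, d, pc, g)" rule: pc_step.cases) (auto simp: move_def)

lemma tr_pc_step [simp]:
  "tr (pc_step e u q k d pc g) = tr g @ [(q, label e u d pc g)]"
  by (cases "(e, u, q, k, d, pc, g)" rule: pc_step.cases) (auto simp: move_def)

lemma stat_pc_step:
  "stat (pc_step e u q k d pc g) th =
     (if trig u pc \<and> fst d = th \<and> stat g th = 0 then 1
      else case pc of
        Decide x b w \<Rightarrow> if fst x = th \<and> stat g th = 1 then w else stat g th
      | Close x b \<Rightarrow> if fst x = th \<and> stat g th = 2 then 4 else stat g th
      | _ \<Rightarrow> stat g th)"
  unfolding stat_def by (cases pc rule: pc_cases) (auto simp: move_def)

lemma slot_pc_step: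
  "slot (pc_step e u q k d pc g) s =
     (case pc of
        Enter (l # ls) j \<Rightarrow> if s = (l, j) \<and> slot g s = 0 then enc d else slot g s
      | Leave b (s' # rest) \<Rightarrow> if s = s' \<and> slot g s = enc d then 0 else slot g s
      | _ \<Rightarrow> slot g s)"
  unfolding slot_def by (cases pc rule: pc_cases) (auto simp: move_def)

lemma mem_slot_stat [simp]: "mem g (slot_addr s) = slot g s" "mem g (stat_addr th) = stat g th"
  by (simp_all add: slot_def stat_def)

declare pc_step.simps [simp del]

lemma label_not_Invoke [simp]: "\<not> is_Invoke (label e u d pc g)" "label e u d pc g \<noteq> Invoke ls th"
  by (cases "(e, u, d, pc, g)" rule: label.cases; simp)+

lemma label_Respond: "label e u d pc g = Respond b \<longleftrightarrow> pc = Leave b []"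
  by (cases "(e, u, d, pc, g)" rule: label.cases) auto

lemma after_Idl: "after e u k d pc g = Idl \<longleftrightarrow> (\<exists>b. pc = Leave b [])"
  by (cases "(e, u, k, d, pc, g)" rule: after.cases) auto

lemma after_Act: "after e u k d pc g = Act k' d' pc' \<Longrightarrow> k' = k \<and> d' = d"
  by (cases "(e, u, k, d, pc, g)" rule: after.cases) auto

end

section \<open>Executions in a fixed environment\<close>

locale algo_env = algo +
  fixes e :: environment and u :: "proc \<times> nat \<Rightarrow> nat"
  assumes adm: "admissible \<kappa> L T e"
begin

abbreviation G :: "nat \<Rightarrow> state" where "G t \<equiv> run e u t"
abbreviation sch :: "nat \<Rightarrow> proc" where "sch t \<equiv> scheduler e t"

lemma step_cases [case_names skip invoke act]:
  obtains "loc (G t) (sch t) = Idl" "G (Suc t) = G t"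
  | ls th where "loc (G t) (sch t) = Idl" "player e (tr (G t)) (sch t) = Some (ls, th)"
      "G (Suc t) = move (sch t) (Invoke ls th) (Act (num_attempts (sch t) (tr (G t)))
         (th, sorted_list_of_fset ls) (Enter (take L (sorted_list_of_fset ls)) 0)) (G t)"
  | k d pc where "loc (G t) (sch t) = Act k d pc"
      "G (Suc t) = pc_step e (u (sch t, k)) (sch t) k d pc (G t)"
proof (cases "loc (G t) (sch t)")
  case Idl
  then show ?thesis
    using that(1,2) by (cases "player e (tr (G t)) (sch t)") (auto simp: gstep_def)
next
  case (Act k d pc)
  then show ?thesis using that(3) by (simp add: gstep_def)
qed

lemma loc_other: "q \<noteq> sch t \<Longrightarrow> loc (G (Suc t)) q = loc (G t) q"
  by (cases t rule: step_cases) (auto simp: move_def simp del: run.simps)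

declare run.simps(2) [simp del]

lemma run0 [simp]: "loc (G 0) q = Idl" "tr (G 0) = []" "stat (G 0) th = 0" "slot (G 0) s = 0"
  by (auto simp: stat_def slot_def simp del: mem_slot_stat)

declare run.simps(1) [simp del]

lemma move_simps [simp]:
  "loc (move q s l g) = (loc g)(q := l)" "tr (move q s l g) = tr g @ [(q, s)]"
  "stat (move q s l g) th = stat g th" "slot (move q s l g) s' = slot g s'"
  by (auto simp: move_def stat_def slot_def simp del: mem_slot_stat)

definition open_at :: "proc \<Rightarrow> desc \<Rightarrow> real history \<Rightarrow> nat \<Rightarrow> bool" where
  "open_at q d h i \<longleftrightarrow> (\<exists>ls. attempt h i q ls (fst d) \<and> snd d = sorted_list_of_fset ls) \<and>
     (\<forall>j. i < j \<and> j < length h \<and> fst (h ! j) = q \<longrightarrow>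
        \<not> is_Invoke (snd (h ! j)) \<and> (\<forall>b. snd (h ! j) \<noteq> Respond b))"

lemma open_at_append:
  assumes "open_at q d h i" "q' = q \<Longrightarrow> \<not> is_Invoke s \<and> (\<forall>b. s \<noteq> Respond b)"
  shows "open_at q d (h @ [(q', s)]) i"
  using assms unfolding open_at_def by (auto simp: attempt_append nth_append less_Suc_eq split: if_splits)

text \<open>Ties the local state to the history. The idle case is what makes
  \<open>admissible\<close> applicable, which constrains the player only at histories without a
  pending attempt of the process.\<close>

lemma hist_loc:
  "case loc (G t) q of
     Idl \<Rightarrow> num_attempts q (tr (G t)) = length (outcomes q (tr (G t)))
   | Act k d pc \<Rightarrow> k = length (outcomes q (tr (G t))) \<and> num_attempts q (tr (G t)) = Suc k \<and>
       (\<exists>i. open_at q d (tr (G t)) i)"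
proof (induction t)
  case (Suc t)
  show ?case
  proof (cases t rule: step_cases)
    case skip
    then show ?thesis using Suc by (auto split: proc_state.splits)
  next
    case (invoke ls th)
    have "open_at (sch t) (th, sorted_list_of_fset ls) (tr (G t) @ [(sch t, Invoke ls th)]) (length (tr (G t)))"
      by (auto simp: open_at_def attempt_def)
    then show ?thesis using Suc invoke
      by (auto simp: num_attempts_append outcomes_snoc intro!: open_at_append split: proc_state.splits)
  next
    case (act k d pc)
    have l: "label e (u (sch t, k)) d pc (G t) = Respond b \<longleftrightarrow> pc = Leave b []" for b
      by (rule label_Respond)
    show ?thesis
    proof (cases "q = sch t")
      case False
      then show ?thesis using Suc act
        by (cases "loc (G t) q") (auto simp: num_attempts_append outcomes_snoc split: step.splits intro!: open_at_append)
    next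
      case True
      show ?thesis
      proof (cases "\<exists>b. pc = Leave b []")
        case True
        then show ?thesis using Suc act \<open>q = sch t\<close> by (auto simp: num_attempts_append outcomes_snoc)
      next
        case False
        then obtain pc' where a: "after e (u (sch t, k)) k d pc (G t) = Act k d pc'"
          by (metis after_Act after_Idl proc_state.exhaust)
        have nr: "label e (u (sch t, k)) d pc (G t) \<noteq> Respond b" for b using False l by blast
        moreover obtain i where "open_at q d (tr (G t)) i"
          using Suc act \<open>q = sch t\<close> by auto
        ultimately have "open_at q d (tr (G (Suc t))) i"
          using act(2) by (auto intro!: open_at_append)
        then show ?thesis using Suc act \<open>q = sch t\<close> a nr
          by (auto simp: num_attempts_append outcomes_snoc split: step.splits)
      qed
    qed
  qed
qed simp

lemma hist_Idl: "loc (G t) q = Idl \<Longrightarrow> num_attempts q (tr (G t)) = length (outcomes q (tr (G t)))"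
  using hist_loc[where t = t and q = q] by simp

lemma hist_Act:
  assumes "loc (G t) q = Act k d pc"
  shows "k = length (outcomes q (tr (G t)))" "num_attempts q (tr (G t)) = Suc k"
    "\<exists>i. open_at q d (tr (G t)) i"
  using hist_loc[where t = t and q = q] assms by auto

lemma invoke_adm:
  assumes "loc (G t) q = Idl" "player e (tr (G t)) q = Some (ls, th)"
  shows "fcard ls \<le> L" "\<And>l. l |\<in>| ls \<Longrightarrow> card (live_attempts (tr (G t)) l) + 1 \<le> \<kappa>"
    "\<And>i q' ls'. \<not> attempt (tr (G t)) i q' ls' th"
  using adm hist_Idl[OF assms(1)] assms(2) unfolding admissible_def by blast+

text \<open>An admissible player never reuses a thunk name, so a thunk, and hence a status word,
  belongs to a single attempt.\<close>

lemma attempt_unique: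
  assumes "attempt (tr (G t)) i q ls th" "attempt (tr (G t)) j q' ls' th"
  shows "i = j \<and> q = q' \<and> ls = ls'"
proof -
  have "\<forall>i j q q' ls ls' th. attempt (tr (G t)) i q ls th \<longrightarrow> attempt (tr (G t)) j q' ls' th \<longrightarrow> i = j"
  proof (induction t)
    case 0
    show ?case by (simp add: attempt_def)
  next
    case (Suc t)
    show ?case
    proof (cases t rule: step_cases)
      case (invoke ls th)
      then show ?thesis using Suc invoke_adm(3)[OF invoke(1,2)] by (auto simp: attempt_append)
    qed (use Suc in \<open>auto simp: attempt_append\<close>)
  qed
  with assms have "i = j" by blast
  with assms show ?thesis by (simp add: attempt_def)
qed

lemma attempt_fcard: "attempt (tr (G t)) i q ls th \<Longrightarrow> fcard ls \<le> L"
proof (induction t)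
  case 0
  then show ?case by (simp add: attempt_def)
next
  case (Suc t)
  show ?case
  proof (cases t rule: step_cases)
    case (invoke ls th)
    then show ?thesis using Suc invoke_adm(1)[OF invoke(1,2)] by (auto simp: attempt_append)
  qed (use Suc in \<open>auto simp: attempt_append\<close>)
qed

lemma known_attempt: "d \<in> known (G t) \<longleftrightarrow>
    (\<exists>i q ls. attempt (tr (G t)) i q ls (fst d) \<and> snd d = sorted_list_of_fset ls)"
  unfolding known_def mem_Collect_eq attempt_iff_mem[symmetric] by blast

lemma known_unique: "d \<in> known (G t) \<Longrightarrow> d' \<in> known (G t) \<Longrightarrow> fst d = fst d' \<Longrightarrow> d = d'"
  by (metis attempt_unique known_attempt prod_eqI)

lemma known_props:
  assumes "d \<in> known (G t)"
  shows "length (snd d) \<le> L" "take L (snd d) = snd d" "distinct (snd d)"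
proof -
  show "length (snd d) \<le> L" "distinct (snd d)"
    using assms attempt_fcard by (auto simp: known_attempt sorted_list_of_fset.rep_eq fcard.rep_eq)
  then show "take L (snd d) = snd d" by simp
qed

lemma known_slots: "d \<in> known (G t) \<Longrightarrow> set (slots d) = set (snd d) \<times> {..<\<kappa>}"
  by (simp add: set_slots known_props)

lemma Act_known: "loc (G t) q = Act k d pc \<Longrightarrow> d \<in> known (G t)"
  using hist_Act(3) unfolding open_at_def known_attempt by blast

lemma Act_unique:
  assumes "loc (G t) q = Act k d pc" "loc (G t) q' = Act k' d' pc'" "fst d = fst d'"
  shows "q = q' \<and> d = d' \<and> k = k' \<and> pc = pc'"
proof -
  have "q = q'" using assms hist_Act(3)[OF assms(1)] hist_Act(3)[OF assms(2)]
    unfolding open_at_def by (metis attempt_unique)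
  then show ?thesis using assms by simp
qed

lemma tr_Suc: "tr (G (Suc t)) = tr (G t) \<or> (\<exists>s. tr (G (Suc t)) = tr (G t) @ [(sch t, s)])"
  by (cases t rule: step_cases) auto

lemma known_Suc: "known (G t) \<subseteq> known (G (Suc t))"
  using tr_Suc[of t] unfolding known_def by (elim disjE exE) (simp, fastforce)

lemma known_mono: "t \<le> t' \<Longrightarrow> known (G t) \<subseteq> known (G t')"
  by (induction t' rule: dec_induct) (use known_Suc in blast)+

end

section \<open>Invariants of the program counters\<close>

lemma thunk_length_bound: "thunk_bound c n \<Longrightarrow> thunk_bound c (thunk_length c)"
  unfolding thunk_length_def by (rule LeastI)

lemma thunk_length_le: "thunk_bound c n \<Longrightarrow> thunk_length c \<le> n"
  unfolding thunk_length_def by (rule Least_le)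

lemma thunk_length_Do:
  assumes "thunk_bound (Do a f) n"
  shows "\<exists>n. thunk_bound (f (result a m)) n" "thunk_length (f (result a m)) < thunk_length (Do a f)"
proof -
  have "thunk_bound (Do a f) (thunk_length (Do a f))" using assms by (rule thunk_length_bound)
  then have "0 < thunk_length (Do a f)" "thunk_bound (f (result a m)) (thunk_length (Do a f) - 1)" by auto
  then show "\<exists>n. thunk_bound (f (result a m)) n" "thunk_length (f (result a m)) < thunk_length (Do a f)"
    using thunk_length_le[of "f (result a m)" "thunk_length (Do a f) - 1"] by auto
qed

context algo
begin

definition help_ok :: "desc set \<Rightarrow> desc \<Rightarrow> desc \<Rightarrow> slot list option \<Rightarrow> bool" where
  "help_ok K d x b \<longleftrightarrow> x \<in> K \<and> d \<in> K \<and>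
     (case b of None \<Rightarrow> x = d | Some rest \<Rightarrow> set rest \<subseteq> set (slots d) \<and> share d x)"

fun pc_ok :: "desc set \<Rightarrow> desc \<Rightarrow> pc \<Rightarrow> bool" where
  "pc_ok K d (Enter ls j) \<longleftrightarrow> d \<in> K \<and> set ls \<subseteq> set (snd d) \<and> distinct ls \<and> j < \<kappa>"
| "pc_ok K d (Look rest) \<longleftrightarrow> d \<in> K \<and> set rest \<subseteq> set (slots d)"
| "pc_ok K d (LookAt y rest) \<longleftrightarrow> d \<in> K \<and> set rest \<subseteq> set (slots d) \<and> y \<in> K \<and> share d y"
| "pc_ok K d (Check x b rest) \<longleftrightarrow> help_ok K d x b \<and> set rest \<subseteq> set (slots x)"
| "pc_ok K d (CheckAt x b y rest) \<longleftrightarrow>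
     help_ok K d x b \<and> set rest \<subseteq> set (slots x) \<and> y \<in> K \<and> share x y"
| "pc_ok K d (Decide x b w) \<longleftrightarrow> help_ok K d x b \<and> (w = 2 \<or> w = 3)"
| "pc_ok K d (Inspect x b) \<longleftrightarrow> help_ok K d x b"
| "pc_ok K d (Launch x b) \<longleftrightarrow> help_ok K d x b"
| "pc_ok K d (Inside x b c) \<longleftrightarrow> help_ok K d x b \<and> (\<exists>n. thunk_bound c n)"
| "pc_ok K d (Close x b) \<longleftrightarrow> help_ok K d x b"
| "pc_ok K d (Wait i rest) \<longleftrightarrow>
     d \<in> K \<and> i < window \<and> set rest \<subseteq> set (slots d) \<and> length rest \<le> length (slots d)"
| "pc_ok K d (WaitAt i y rest) \<longleftrightarrow>
     d \<in> K \<and> i < window \<and> set rest \<subseteq> set (slots d) \<and> length rest \<le> length (slots d) \<and>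
     y \<in> K \<and> share d y"
| "pc_ok K d (Stuck i y rest) \<longleftrightarrow>
     d \<in> K \<and> i < window \<and> set rest \<subseteq> set (slots d) \<and> length rest \<le> length (slots d) \<and>
     y \<in> K \<and> share d y"
| "pc_ok K d (Pad n) \<longleftrightarrow> d \<in> K"
| "pc_ok K d Fetch \<longleftrightarrow> d \<in> K"
| "pc_ok K d (Leave b rest) \<longleftrightarrow> d \<in> K \<and> set rest \<subseteq> set (slots d)"

lemma resume_neq [simp]: "resume b \<noteq> Leave c rest" "Leave c rest \<noteq> resume b"
  by (cases b; simp)+

lemma after_Leave:
  assumes "after e v k d pc g = Act k' d' (Leave b rest)"
  shows "(pc = Fetch \<and> rest = slots d \<and> b = (stat g (fst d) = 4)) \<or> (\<exists>s. pc = Leave b (s # rest))"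
  using assms by (cases pc rule: pc_cases) (auto simp: tick_def split: if_splits)

lemma help_ok_mono: "help_ok K d x b \<Longrightarrow> K \<subseteq> K' \<Longrightarrow> help_ok K' d x b"
  by (auto simp: help_ok_def)

lemma pc_ok_mono: "pc_ok K d pc \<Longrightarrow> K \<subseteq> K' \<Longrightarrow> pc_ok K' d pc"
  by (cases pc) (auto simp: help_ok_mono)

lemma pc_ok_resume: "help_ok K d x b \<Longrightarrow> pc_ok K d (resume b)"
  by (cases b) (auto simp: help_ok_def)

lemma pc_ok_tick: "(Suc i < window \<Longrightarrow> pc_ok K d s) \<Longrightarrow> d \<in> K \<Longrightarrow> pc_ok K d (tick i s)"
  by (auto simp: tick_def)

text \<open>The clause on \<open>Leave\<close> says that a slot still occupied is on the list of
  those to be released. For the empty list this means that an attempt leaves no slot behind when it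
  responds.\<close>

definition slot_ok :: "state \<Rightarrow> bool" where
  "slot_ok g \<longleftrightarrow> (\<forall>s. slot g s \<noteq> 0 \<longrightarrow>
     (\<exists>q k d pc. loc g q = Act k d pc \<and> slot g s = enc d \<and> s \<in> set (slots d) \<and>
        (\<forall>b rest. pc = Leave b rest \<longrightarrow> s \<in> set rest)))"

lemma slot_okD:
  assumes "slot_ok g" "slot g s \<noteq> 0"
  obtains q k d pc where "loc g q = Act k d pc" "slot g s = enc d" "s \<in> set (slots d)"
    "\<And>b rest. pc = Leave b rest \<Longrightarrow> s \<in> set rest"
  using assms unfolding slot_ok_def by blast

lemma after_ok:
  assumes ok: "pc_ok K d pc" and a: "after e v k d pc g = Act k' d' pc'"
    and window: "0 < window" and tb: "\<And>th. Ex (thunk_bound (thunk_code e th))"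
    and sl: "\<And>x s. x \<in> K \<Longrightarrow> slot g s \<noteq> 0 \<Longrightarrow> slot g s \<noteq> enc x \<Longrightarrow> s \<in> set (slots x) \<Longrightarrow>
      dec (slot g s) \<in> K \<and> share x (dec (slot g s))"
  shows "pc_ok K d pc'"
proof -
  have k: "0 < \<kappa>" using pos by simp
  have dK: "d \<in> K" using ok by (cases pc) (auto simp: help_ok_def)
  show ?thesis
  proof (cases pc rule: pc_cases)
    case (4 s rest)
    then show ?thesis using a ok window sl[OF dK, of s] by (auto simp: mem_slot_stat split: if_splits)
  next
    case (7 x b s rest)
    then have "x \<in> K" using ok by (auto simp: help_ok_def)
    then show ?thesis using 7 a ok sl[of x s] by (auto simp: mem_slot_stat split: if_splits)
  next
    case (13 x b c f)
    then show ?thesis using a ok thunk_length_Do(1) by fastforce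
  next
    case (16 i s rest)
    then show ?thesis using a ok sl[OF dK, of s]
      by (auto simp: mem_slot_stat help_ok_def intro!: pc_ok_tick split: if_splits)
  next
    case (17 i y rest)
    then show ?thesis using a ok by (auto simp: help_ok_def intro!: pc_ok_tick split: if_splits)
  next
    case (18 i y rest)
    then show ?thesis using a ok by (auto simp: help_ok_def intro!: pc_ok_tick split: if_splits)
  next
    case (5 y rest)
    then show ?thesis using a ok by (auto simp: help_ok_def split: if_splits)
  next
    case (15 i)
    then show ?thesis using a ok by (auto simp: help_ok_def intro!: pc_ok_tick split: if_splits)
  qed (use a ok tb k window in \<open>auto simp: pc_ok_resume split: if_splits\<close>)
qed

end

context algo_env
begin

lemma thunk_code_bound: "thunk_bound (thunk_code e th) T"
  using adm by (simp add: admissible_def)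

lemma ex_thunk_bound: "Ex (thunk_bound (thunk_code e th))"
  using thunk_code_bound by blast

lemma window_pos: "0 < window"
  using pos by (simp add: window_def)

text \<open>The two invariants depend on each other: that a descriptor decoded from a slot is known
  and shares a lock comes from \<open>slot_ok\<close>, and that an attempt fills only slots of its
  own locks comes from \<open>pc_ok\<close>.\<close>

lemma pc_ok_slot_ok:
  "(\<forall>q k d pc. loc (G t) q = Act k d pc \<longrightarrow> pc_ok (known (G t)) d pc) \<and> slot_ok (G t)"
proof (induction t)
  case 0
  show ?case by (simp add: slot_ok_def)
next
  case (Suc t)
  then have ok: "loc (G t) q = Act k d pc \<Longrightarrow> pc_ok (known (G t)) d pc"
    and sok: "slot_ok (G t)" for q k d pc by blast+
  have ok': "loc (G t) q = Act k d pc \<Longrightarrow> pc_ok (known (G (Suc t))) d pc" for q k d pc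
    by (rule pc_ok_mono[OF ok known_Suc])
  show ?case
  proof (cases t rule: step_cases)
    case skip
    then show ?thesis using Suc by simp
  next
    case (invoke ls th)
    have "(th, sorted_list_of_fset ls) \<in> known (G (Suc t))"
      using invoke by (auto simp: known_def)
    then have n: "pc_ok (known (G (Suc t))) (th, sorted_list_of_fset ls)
        (Enter (take L (sorted_list_of_fset ls)) 0)"
      using known_props(3) pos by (auto simp: dest: in_set_takeD)
    have "slot_ok (G (Suc t))" unfolding slot_ok_def
    proof (intro allI impI)
      fix s assume "slot (G (Suc t)) s \<noteq> 0"
      then have "slot (G t) s \<noteq> 0" using invoke by simp
      from slot_okD[OF sok this] obtain q k d pc where
        s: "loc (G t) q = Act k d pc" "slot (G t) s = enc d" "s \<in> set (slots d)"
        "\<And>b rest. pc = Leave b rest \<Longrightarrow> s \<in> set rest" by metis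
      moreover have "q \<noteq> sch t" using s invoke by auto
      ultimately show "\<exists>q k d pc. loc (G (Suc t)) q = Act k d pc \<and>
          slot (G (Suc t)) s = enc d \<and> s \<in> set (slots d) \<and> (\<forall>b rest. pc = Leave b rest \<longrightarrow> s \<in> set rest)"
        using invoke by - (rule exI[of _ q], rule exI[of _ k], rule exI[of _ d], rule exI[of _ pc], auto)
    qed
    moreover have "pc_ok (known (G (Suc t))) d pc" if "loc (G (Suc t)) q = Act k d pc" for q k d pc
      using that n ok'[of q k d pc] invoke(3) by (cases "q = sch t") auto
    ultimately show ?thesis by blast
  next
    case (act k d pc)
    let ?v = "u (sch t, k)"
    have K: "d \<in> known (G t)" using act Act_known by blast
    have sl: "dec (slot (G t) s) \<in> known (G t) \<and> share x (dec (slot (G t) s))"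
      if "x \<in> known (G t)" "slot (G t) s \<noteq> 0" "slot (G t) s \<noteq> enc x" "s \<in> set (slots x)" for x s
    proof -
      from slot_okD[OF sok that(2)] obtain q k d' pc where
        s: "loc (G t) q = Act k d' pc" "slot (G t) s = enc d'" "s \<in> set (slots d')" by metis
      moreover have "d' \<in> known (G t)" using s Act_known by blast
      ultimately show ?thesis using that known_slots[of d'] known_slots[of x]
        by (auto simp: share_def)
    qed
    have new: "pc_ok (known (G t)) d pc'" if "after e ?v k d pc (G t) = Act k' d' pc'" for k' d' pc'
      by (rule after_ok[OF ok[OF act(1)] that window_pos ex_thunk_bound sl])
    have "slot_ok (G (Suc t))" unfolding slot_ok_def
    proof (intro allI impI)
      fix s assume ne: "slot (G (Suc t)) s \<noteq> 0"
      show "\<exists>q k d pc. loc (G (Suc t)) q = Act k d pc \<and>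
          slot (G (Suc t)) s = enc d \<and> s \<in> set (slots d) \<and> (\<forall>b rest. pc = Leave b rest \<longrightarrow> s \<in> set rest)"
      proof (cases "slot (G (Suc t)) s = slot (G t) s")
        case False
        then obtain l ls j where *: "pc = Enter (l # ls) j" "s = (l, j)" "slot (G (Suc t)) s = enc d" "slot (G t) s = 0"
          using ne act(2) by (auto simp: slot_pc_step split: pc.splits list.splits if_splits)
        have "s \<in> set (slots d)" using * ok[OF act(1)] K by (auto simp: known_slots)
        then show ?thesis using act * by - (rule exI[of _ "sch t"], rule exI[of _ k], rule exI[of _ d], rule exI[of _ "Enter ls 0"], auto)
      next
        case True
        then have "slot (G t) s \<noteq> 0" using ne by simp
        from slot_okD[OF sok this] obtain q k' d' pc' where
          s: "loc (G t) q = Act k' d' pc'" "slot (G t) s = enc d'" "s \<in> set (slots d')"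
          "\<And>b rest. pc' = Leave b rest \<Longrightarrow> s \<in> set rest" by metis
        show ?thesis
        proof (cases "q = sch t")
          case False
          then show ?thesis using s True act
            by - (rule exI[of _ q], rule exI[of _ k'], rule exI[of _ d'], rule exI[of _ pc'], auto)
        next
          case qs: True
          then have eq: "k' = k" "d' = d" "pc' = pc" using s act by auto
          have nl: "pc \<noteq> Leave b []" for b using s(4) eq by auto
          then obtain pc'' where a: "after e ?v k d pc (G t) = Act k d pc''"
            by (metis after_Act after_Idl proc_state.exhaust)
          have "s \<in> set rest" if "pc'' = Leave b rest" for b rest
            using after_Leave[of e ?v k d pc "G t" k d b rest] a that s(2-4) eq True act(2)
            by (auto simp: slot_pc_step)
          then show ?thesis using s True act qs eq a
            by - (rule exI[of _ q], rule exI[of _ k], rule exI[of _ d], rule exI[of _ pc''], auto)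
        qed
      qed
    qed
    moreover have "pc_ok (known (G (Suc t))) d' pc'" if "loc (G (Suc t)) q = Act k' d' pc'" for q k' d' pc'
    proof (cases "q = sch t")
      case True
      then have a: "after e ?v k d pc (G t) = Act k' d' pc'" using that act by simp
      then have "d' = d" using after_Act by blast
      then show ?thesis using new[OF a] pc_ok_mono known_Suc by blast
    next
      case False
      then show ?thesis using that act(2) ok' by simp
    qed
    ultimately show ?thesis by blast
  qed
qed

lemma pc_okD: "loc (G t) q = Act k d pc \<Longrightarrow> pc_ok (known (G t)) d pc"
  and slot_ok: "slot_ok (G t)"
  using pc_ok_slot_ok by blast+

end

section \<open>The life cycle of a status word\<close>

fun contending :: "pc \<Rightarrow> bool" where
  "contending (Check x b rest) \<longleftrightarrow> b = None"
| "contending (CheckAt x b y rest) \<longleftrightarrow> b = None"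
| "contending (Decide x b w) \<longleftrightarrow> b = None"
| "contending (Inspect x b) \<longleftrightarrow> b = None"
| "contending (Launch x b) \<longleftrightarrow> b = None"
| "contending (Inside x b c) \<longleftrightarrow> b = None"
| "contending (Close x b) \<longleftrightarrow> b = None"
| "contending _ \<longleftrightarrow> False"

text \<open>A process helps others only before it starts to wait, hence while its own status is
  still 0.\<close>

definition helping :: "state \<Rightarrow> desc \<Rightarrow> desc \<Rightarrow> slot list option \<Rightarrow> bool" where
  "helping g d x b \<longleftrightarrow> stat g (fst x) \<noteq> 0 \<and> (b \<noteq> None \<longrightarrow> stat g (fst d) = 0)"

definition won :: "real \<Rightarrow> bool" where
  "won w \<longleftrightarrow> w = 2 \<or> w = 4"

lemma won_simps [simp]: "\<not> won 0" "\<not> won 1" "won 2" "\<not> won 3" "won 4"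
  by (simp_all add: won_def)

text \<open>Another helper may turn 2 into 4 at any moment, so the states around the thunk can
  guarantee only \<open>won\<close>, and \<open>Inspect\<close> only that some decision has been
  made.\<close>

fun st_ok :: "state \<Rightarrow> desc \<Rightarrow> pc \<Rightarrow> bool" where
  "st_ok g d (Check x b rest) \<longleftrightarrow> helping g d x b"
| "st_ok g d (CheckAt x b y rest) \<longleftrightarrow> helping g d x b"
| "st_ok g d (Decide x b w) \<longleftrightarrow> helping g d x b"
| "st_ok g d (Inspect x b) \<longleftrightarrow> helping g d x b \<and> stat g (fst x) \<noteq> 1"
| "st_ok g d (Launch x b) \<longleftrightarrow> helping g d x b \<and> won (stat g (fst x))"
| "st_ok g d (Inside x b c) \<longleftrightarrow> helping g d x b \<and> won (stat g (fst x))"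
| "st_ok g d (Close x b) \<longleftrightarrow> helping g d x b \<and> won (stat g (fst x))"
| "st_ok g d (Pad n) \<longleftrightarrow> \<not> hot (stat g (fst d))"
| "st_ok g d Fetch \<longleftrightarrow> \<not> hot (stat g (fst d))"
| "st_ok g d (Leave b rest) \<longleftrightarrow> \<not> hot (stat g (fst d)) \<and> (b \<longleftrightarrow> stat g (fst d) = 4)"
| "st_ok g d _ \<longleftrightarrow> stat g (fst d) = 0"

definition legal :: "real \<Rightarrow> bool" where
  "legal w \<longleftrightarrow> w \<in> {0, 1, 2, 3, 4}"

lemma legal_cases: "legal w \<Longrightarrow> w = 0 \<or> w = 1 \<or> w = 2 \<or> w = 3 \<or> w = 4"
  by (simp add: legal_def)

context algo
begin

lemma st_ok_resume:
  assumes "helping g d x b" "help_ok K d x b" "\<not> hot (stat g (fst x))"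
  shows "st_ok g d (resume b)"
  using assms by (cases b) (auto simp: helping_def help_ok_def)

lemma stat_change:
  assumes "pc_ok K d pc"
  obtains (same) "stat (pc_step e v q k d pc g) th = stat g th"
  | (acq) "stat (pc_step e v q k d pc g) th = 1" "stat g th = 0" "fst d = th" "trig v pc"
  | (decide) x b w where "stat (pc_step e v q k d pc g) th = w" "stat g th = 1" "fst x = th"
      "pc = Decide x b w" "w = 2 \<or> w = 3"
  | (close) x b where "stat (pc_step e v q k d pc g) th = 4" "stat g th = 2" "fst x = th"
      "pc = Close x b"
proof (cases "stat (pc_step e v q k d pc g) th = stat g th")
  case True
  then show ?thesis by (rule that(1))
next
  case False
  show ?thesis
  proof (cases "trig v pc")
    case True
    then have "stat (pc_step e v q k d pc g) th = 1" "stat g th = 0" "fst d = th"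
      using False by (auto simp: stat_pc_step trig_def split: if_splits)
    with True show ?thesis using that(2) by blast
  next
    case nt: False
    then show ?thesis using that(3,4) False assms
      by (cases pc) (auto simp: stat_pc_step split: if_splits)
  qed
qed

lemma after_st_ok:
  assumes ok: "pc_ok K d pc" and st: "st_ok g d pc"
    and a: "after e v k d pc g = Act k' d' pc'"
  shows "st_ok (pc_step e v q k d pc g) d pc'"
proof (cases pc rule: pc_cases)
  case (10 x b)
  then have "\<not> hot (stat g (fst x))" if "stat g (fst x) \<noteq> 2" using st that by (simp add: hot_def)
  then show ?thesis using a st ok 10
    by (auto simp: stat_pc_step helping_def intro!: st_ok_resume split: if_splits)
next
  case (14 x b)
  then show ?thesis using a st ok
    by (auto simp: stat_pc_step helping_def won_def intro!: st_ok_resume split: if_splits)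
qed (use a st ok in \<open>auto simp: stat_pc_step helping_def tick_def help_ok_def share_def split: if_splits\<close>)

lemma st_ok_other:
  assumes ok: "pc_ok K d pc" and st: "st_ok g d' pc'" and ne: "fst d \<noteq> fst d'"
    and g': "g' = pc_step e v q k d pc g"
  shows "st_ok g' d' pc'"
proof -
  have own: "stat g' (fst d') = stat g (fst d')" if "\<not> hot (stat g (fst d'))"
    by (cases rule: stat_change[OF ok, of e v q k g "fst d'"]) (use that ne g' in auto)
  have nz: "stat g' th \<noteq> 0" if "stat g th \<noteq> 0" for th
    by (cases rule: stat_change[OF ok, of e v q k g th]) (use that g' in auto)
  have n1: "stat g' th \<noteq> 1" if "stat g th \<noteq> 0" "stat g th \<noteq> 1" for th
    by (cases rule: stat_change[OF ok, of e v q k g th]) (use that g' in auto)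
  have wn: "won (stat g' th)" if "won (stat g th)" for th
    by (cases rule: stat_change[OF ok, of e v q k g th]) (use that g' in auto)
  show ?thesis
    using st by (cases pc') (auto simp: helping_def own nz n1 wn)
qed

text \<open>The only exits from the contending states lead to the padding, where
  \<open>st_ok\<close> forbids a hot status.\<close>

lemma contending_after:
  assumes ok: "pc_ok K d pc" and st: "st_ok (pc_step e v q k d pc g) d pc'"
    and a: "after e v k d pc g = Act k' d' pc'" and s: "contending pc"
    and h: "hot (stat (pc_step e v q k d pc g) (fst d))"
  shows "contending pc'"
proof (rule ccontr)
  assume n: "\<not> contending pc'"
  show False
    by (cases pc rule: pc_cases) (use a s n st h in \<open>auto split: if_splits\<close>)
qed

end

context algo_env
begin

text \<open>The last conjunct is the reason why slots can be trusted: as long as a status is hot,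
  its owner is still busy deciding and so has not begun to release its slots.\<close>

definition stat_inv :: "nat \<Rightarrow> bool" where
  "stat_inv t \<longleftrightarrow> (\<forall>q k d pc. loc (G t) q = Act k d pc \<longrightarrow> st_ok (G t) d pc) \<and>
     (\<forall>th. legal (stat (G t) th)) \<and>
     (\<forall>th. stat (G t) th \<noteq> 0 \<longrightarrow> th \<in> fst ` known (G t)) \<and>
     (\<forall>th. hot (stat (G t) th) \<longrightarrow> (\<exists>q k d pc. loc (G t) q = Act k d pc \<and> fst d = th \<and> contending pc))"

lemma fresh_not_known:
  assumes "loc (G t) q = Idl" "player e (tr (G t)) q = Some (ls, th)"
  shows "th \<notin> fst ` known (G t)"
  using invoke_adm(3)[OF assms] by (auto simp: known_attempt)

lemma stat_inv: "stat_inv t"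
proof (induction t)
  case 0
  show ?case by (simp add: stat_inv_def legal_def)
next
  case (Suc t)
  then have st: "\<And>q k d pc. loc (G t) q = Act k d pc \<Longrightarrow> st_ok (G t) d pc"
    and leg: "\<And>th. legal (stat (G t) th)"
    and nz: "\<And>th. stat (G t) th \<noteq> 0 \<Longrightarrow> th \<in> fst ` known (G t)"
    and ht: "\<And>th. hot (stat (G t) th) \<Longrightarrow> \<exists>q k d pc. loc (G t) q = Act k d pc \<and> fst d = th \<and> contending pc"
    unfolding stat_inv_def by blast+
  have nz': "th \<in> fst ` known (G (Suc t))" if "stat (G t) th \<noteq> 0" for th
    using nz[OF that] known_Suc[of t] by blast
  show ?case
  proof (cases t rule: step_cases)
    case skip
    then show ?thesis using Suc by (simp add: stat_inv_def)
  next
    case (invoke ls th)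
    have "stat (G t) th = 0" using nz fresh_not_known[OF invoke(1,2)] by blast
    moreover have "st_ok (G (Suc t)) d pc = st_ok (G t) d pc" for d pc
      using invoke by (cases pc) (auto simp: helping_def)
    moreover have "\<exists>q k d pc. loc (G (Suc t)) q = Act k d pc \<and> fst d = th \<and> contending pc" if h: "hot (stat (G t) th)" for th
    proof -
      obtain q k d pc where *: "loc (G t) q = Act k d pc \<and> fst d = th \<and> contending pc"
        using ht[OF h] by blast
      then have "q \<noteq> sch t" using invoke by auto
      then have "loc (G (Suc t)) q = Act k d pc" using * loc_other by simp
      with * show ?thesis by blast
    qed
    ultimately show ?thesis using invoke st leg nz' unfolding stat_inv_def
      by (auto split: if_splits)
  next
    case (act k d pc)
    let ?v = "u (sch t, k)"
    note ok = pc_okD[OF act(1)]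
    have st': "st_ok (G (Suc t)) d' pc'" if l: "loc (G (Suc t)) q = Act k' d' pc'" for q k' d' pc'
    proof (cases "q = sch t")
      case True
      then have a: "after e ?v k d pc (G t) = Act k' d' pc'" using l act by simp
      then show ?thesis using after_st_ok[OF ok st[OF act(1)] a] after_Act[OF a] act(2) by simp
    next
      case False
      then have l': "loc (G t) q = Act k' d' pc'" using l loc_other by simp
      then have "fst d \<noteq> fst d'" using Act_unique[OF act(1) l'] False by auto
      then show ?thesis using st_ok_other[OF ok st[OF l'] _ act(2)] by simp
    qed
    have "legal (stat (G (Suc t)) th)" for th
      unfolding act(2)
      by (cases rule: stat_change[OF ok, of e ?v "sch t" k "G t" th]) (use leg in \<open>auto simp: legal_def\<close>)
    moreover have "th \<in> fst ` known (G (Suc t))" if "stat (G (Suc t)) th \<noteq> 0" for th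
    proof (cases "stat (G t) th = 0")
      case True
      then have "fst d = th" using that unfolding act(2)
        by (cases rule: stat_change[OF ok, of e ?v "sch t" k "G t" th]) auto
      then show ?thesis using Act_known[OF act(1)] known_Suc[of t] by blast
    qed (rule nz')
    moreover have "\<exists>q k d pc. loc (G (Suc t)) q = Act k d pc \<and> fst d = th \<and> contending pc"
      if h: "hot (stat (G (Suc t)) th)" for th
    proof (cases "hot (stat (G t) th)")
      case False
      then have *: "fst d = th" "trig ?v pc" using h unfolding act(2)
        by (cases rule: stat_change[OF ok, of e ?v "sch t" k "G t" th]; auto)+
      then have "after e ?v k d pc (G t) = Act k d (Check d None (slots d))"
        unfolding trig_def by (auto simp: neq_Nil_conv) (metis (no_types, lifting) after.simps(13,14) list.exhaust next_pc.simps(14,15))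
      then show ?thesis using * act by fastforce
    next
      case True
      then obtain q k' d' pc' where *: "loc (G t) q = Act k' d' pc'" "fst d' = th" "contending pc'"
        using ht by blast
      show ?thesis
      proof (cases "q = sch t")
        case False
        then show ?thesis using * loc_other by metis
      next
        case qs: True
        then have eq: "k' = k" "d' = d" "pc' = pc" using * act by auto
        then obtain pc'' where a: "after e ?v k d pc (G t) = Act k d pc''"
          using *(3) by (metis after_Act after_Idl proc_state.exhaust contending.simps(16))
        have l: "loc (G (Suc t)) q = Act k d pc''" using a act qs by simp
        have "contending pc''"
          using contending_after[OF ok _ a] st'[OF l] *(2,3) h eq act(2) by simp
        with l * eq show ?thesis by blast
      qed
    qed
    ultimately show ?thesis using st' unfolding stat_inv_def by blast
  qed
qed

lemma st_okD: "loc (G t) q = Act k d pc \<Longrightarrow> st_ok (G t) d pc"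
  and stat_legal: "legal (stat (G t) th)"
  and stat_known: "stat (G t) th \<noteq> 0 \<Longrightarrow> th \<in> fst ` known (G t)"
  and hot_contending: "hot (stat (G t) th) \<Longrightarrow> \<exists>q k d pc. loc (G t) q = Act k d pc \<and> fst d = th \<and> contending pc"
  using stat_inv[of t] unfolding stat_inv_def by blast+

lemma stat_step:
  obtains (same) "stat (G (Suc t)) th = stat (G t) th"
  | (acq) k d pc where "loc (G t) (sch t) = Act k d pc" "trig (u (sch t, k)) pc" "fst d = th"
     "stat (G t) th = 0" "stat (G (Suc t)) th = 1"
  | (decide) k d x b w where "loc (G t) (sch t) = Act k d (Decide x b w)" "fst x = th" "w = 2 \<or> w = 3"
     "stat (G t) th = 1" "stat (G (Suc t)) th = w"
  | (close) k d x b where "loc (G t) (sch t) = Act k d (Close x b)" "fst x = th"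
     "stat (G t) th = 2" "stat (G (Suc t)) th = 4"
proof (cases t rule: step_cases)
  case skip
  then show ?thesis using same by simp
next
  case (invoke ls th)
  then show ?thesis using same by simp
next
  case (act k d pc)
  show ?thesis
    using pc_okD[OF act(1)]
    by (cases rule: stat_change[OF pc_okD[OF act(1)], of e "u (sch t, k)" "sch t" k "G t" th])
      (use that act in auto)
qed

text \<open>The order in which a status word advances, with the two final values 3 and 4 on the same
  level. Monotonicity makes the times at which a status is hot an interval
  (\<open>hot_between\<close>).\<close>

definition level :: "real \<Rightarrow> nat" where
  "level w = (if w = 0 then 0 else if w = 1 then 1 else if w = 2 then 2 else 3)"

lemma level_step: "level (stat (G t) th) \<le> level (stat (G (Suc t)) th)"
  by (cases rule: stat_step[of t th]) (auto simp: level_def)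

lemma level_mono: "t \<le> t' \<Longrightarrow> level (stat (G t) th) \<le> level (stat (G t') th)"
  by (induction t' rule: dec_induct) (use level_step le_trans in blast)+

lemma hot_level: "hot (stat (G t) th) \<longleftrightarrow> level (stat (G t) th) = 1 \<or> level (stat (G t) th) = 2"
  by (auto simp: hot_def level_def)

lemma hot_between: "t \<le> t' \<Longrightarrow> t' \<le> t'' \<Longrightarrow> hot (stat (G t) th) \<Longrightarrow> hot (stat (G t'') th) \<Longrightarrow> hot (stat (G t') th)"
  using level_mono[of t t' th] level_mono[of t' t'' th] unfolding hot_level by linarith

end

section \<open>Every attempt obtains its slots\<close>

declare split_paired_All [simp del] split_paired_Ex [simp del]

lemma card_le_live_attempts:
  assumes "\<And>q. q \<in> Q \<Longrightarrow> \<exists>i\<in>live_attempts h l. fst (h ! i) = q"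
  shows "finite Q \<and> card Q \<le> card (live_attempts h l)"
proof -
  have fin: "finite (live_attempts h l)"
    by (rule finite_subset[of _ "{..<length h}"]) (auto simp: live_attempts_def attempt_def)
  have "Q \<subseteq> (\<lambda>i. fst (h ! i)) ` live_attempts h l" using assms by force
  then show ?thesis using fin by (meson card_image_le card_mono finite_imageI le_trans finite_subset)
qed

definition entering :: "pc \<Rightarrow> lock set" where
  "entering pc = (case pc of Enter ls j \<Rightarrow> set ls | _ \<Rightarrow> {})"

definition leaving :: "pc \<Rightarrow> bool" where
  "leaving pc \<longleftrightarrow> (\<exists>b rest. pc = Leave b rest)"

lemma entering_simps [simp]: "entering (Enter ls j) = set ls"
  by (simp add: entering_def)

lemma entering_empty: "(\<And>ls j. pc \<noteq> Enter ls j) \<Longrightarrow> entering pc = {}"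
  by (auto simp: entering_def split: pc.splits)

context algo
begin

lemma resume_neq_Enter [simp]: "resume b \<noteq> Enter ls j" "Enter ls j \<noteq> resume b"
  by (cases b; simp)+

lemma after_Enter:
  assumes "after e v k d pc g = Act k' d' (Enter ls j)"
  shows "(\<exists>l j'. pc = Enter (l # ls) j' \<and> j = 0 \<and> (slot g (l, j') = 0 \<or> \<kappa> \<le> Suc j')) \<or>
    (\<exists>l ls' j'. pc = Enter (l # ls') j' \<and> ls = l # ls' \<and> j = Suc j' \<and> Suc j' < \<kappa> \<and> slot g (l, j') \<noteq> 0)"
  using assms by (cases "(e, v, k, d, pc, g)" rule: after.cases) (auto simp: tick_def neq_Nil_conv split: if_splits list.splits elim!: next_pc.elims)

lemma slot_other:
  "d \<noteq> d' \<Longrightarrow> slot (pc_step e v q k d pc g) s = enc d' \<longleftrightarrow> slot g s = enc d'"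
  by (auto simp: slot_pc_step split: pc.splits list.splits)

end

context algo_env
begin

text \<open>Attempts that occupy or still climb to a position \<open>\<ge> i\<close> of the lock. By induction on time there are
  at most \<open>\<kappa> - i\<close> of them: an attempt moves past position \<open>i\<close> only because somebody occupies it.\<close>
definition climbers :: "nat \<Rightarrow> lock \<Rightarrow> nat \<Rightarrow> proc set" where
  "climbers t l i = {q. \<exists>k d pc. loc (G t) q = Act k d pc \<and> l \<in> set (snd d) \<and>
     (i = 0 \<or> (\<exists>ls j. pc = Enter (l # ls) j \<and> i \<le> j) \<or> (\<exists>j\<ge>i. slot (G t) (l, j) = enc d))}"

definition hold_ok :: "nat \<Rightarrow> desc \<Rightarrow> pc \<Rightarrow> bool" where
  "hold_ok t d pc \<longleftrightarrow>
     (\<forall>l j j'. slot (G t) (l, j) = enc d \<longrightarrow> slot (G t) (l, j') = enc d \<longrightarrow> j = j') \<and>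
     (\<forall>l\<in>entering pc. \<forall>j. slot (G t) (l, j) \<noteq> enc d) \<and>
     (\<not> leaving pc \<longrightarrow> (\<forall>l\<in>set (snd d) - entering pc. \<exists>j. slot (G t) (l, j) = enc d))"

lemma live_active:
  assumes "loc (G t) q = Act k d pc" "l \<in> set (snd d)"
  shows "\<exists>i\<in>live_attempts (tr (G t)) l. fst (tr (G t) ! i) = q"
proof -
  obtain i where i: "open_at q d (tr (G t)) i" using hist_Act(3)[OF assms(1)] by blast
  then obtain ls where ls: "attempt (tr (G t)) i q ls (fst d)" "snd d = sorted_list_of_fset ls"
    unfolding open_at_def by blast
  then have f: "fst (tr (G t) ! i) = q" "i < length (tr (G t))" "snd (tr (G t) ! i) = Invoke ls (fst d)"
    by (auto simp: attempt_def)
  have "\<not> returned (tr (G t)) i b" for b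
  proof
    assume "returned (tr (G t)) i b"
    then obtain j where j: "j \<in> own_steps (tr (G t)) i" "snd (tr (G t) ! j) = Respond b"
      by (auto simp: returned_def)
    then have "i \<le> j" "j \<noteq> i" "j < length (tr (G t))" "fst (tr (G t) ! j) = q" using f
      by (auto simp: own_steps_def)
    then show False using i j(2) unfolding open_at_def by (metis le_neq_implies_less)
  qed
  moreover have "l |\<in>| ls" using assms(2) ls(2) by simp
  ultimately have "i \<in> live_attempts (tr (G t)) l" using ls(1) unfolding live_attempts_def by blast
  with f show ?thesis by blast
qed

lemma climb:
  "(\<forall>q k d pc. loc (G t) q = Act k d pc \<longrightarrow> hold_ok t d pc) \<and>
   (\<forall>l i. i < \<kappa> \<longrightarrow> finite (climbers t l i) \<and> card (climbers t l i) + i \<le> \<kappa>)"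
proof (induction t)
  case 0
  have "climbers 0 l i = {}" for l i by (auto simp: climbers_def)
  then show ?case by simp
next
  case (Suc t)
  then have ho: "loc (G t) q = Act k d pc \<Longrightarrow> hold_ok t d pc" 
    and cl: "i < \<kappa> \<Longrightarrow> finite (climbers t l i)" "i < \<kappa> \<Longrightarrow> card (climbers t l i) + i \<le> \<kappa>"
    for q k d pc l i by blast+
  show ?case
  proof (cases t rule: step_cases)
    case skip
    then have "hold_ok (Suc t) = hold_ok t" "climbers (Suc t) = climbers t"
      by (auto simp: hold_ok_def climbers_def fun_eq_iff)
    with Suc skip show ?thesis by simp
  next
    case (invoke ls th)
    let ?d = "(th, sorted_list_of_fset ls)"
    have nk: "?d \<notin> known (G t)" using fresh_not_known[OF invoke(1,2)] by force
    have ns: "slot (G t) s \<noteq> enc ?d" for s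
    proof
      assume "slot (G t) s = enc ?d"
      then show False using slot_okD[OF slot_ok, of t s] nk Act_known by (metis enc_inject enc_neq_0(1))
    qed
    have "fcard ls \<le> L" using invoke_adm[OF invoke(1,2)] by simp
    then have tk: "take L (sorted_list_of_fset ls) = sorted_list_of_fset ls" by simp
    have h: "hold_ok (Suc t) d pc" if "loc (G (Suc t)) q = Act k d pc" for q k d pc
    proof (cases "q = sch t")
      case True
      then show ?thesis using that ns invoke by (auto simp: hold_ok_def tk)
    next
      case False
      then have "loc (G t) q = Act k d pc" using that invoke by simp
      then show ?thesis using ho[of q k d pc] invoke by (auto simp: hold_ok_def)
    qed
    have c: "finite (climbers (Suc t) l i) \<and> card (climbers (Suc t) l i) + i \<le> \<kappa>" if "i < \<kappa>" for l i
    proof (cases "i = 0 \<and> l |\<in>| ls")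
      case False
      then have "climbers (Suc t) l i \<subseteq> climbers t l i"
        using invoke ns by (auto simp: climbers_def split: if_splits)
      then show ?thesis using cl[OF that] by (meson add_le_mono1 card_mono finite_subset le_trans)
    next
      case True
      \<comment> \<open>Only level 0 can grow at an invocation, and there the bound on live attempts
        leaves room for one more.\<close>
      let ?Q = "{q. \<exists>k d pc. loc (G t) q = Act k d pc \<and> l \<in> set (snd d)}"
      have Q: "finite ?Q \<and> card ?Q \<le> card (live_attempts (tr (G t)) l)"
        by (rule card_le_live_attempts) (use live_active in blast)
      have "climbers (Suc t) l i = insert (sch t) ?Q"
        using invoke True by (auto simp: climbers_def split: if_splits)
      then have "card (climbers (Suc t) l i) \<le> Suc (card ?Q)" "finite (climbers (Suc t) l i)"
        using Q by (auto simp: card_insert_if)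
      then show ?thesis using Q True invoke_adm(2)[OF invoke(1,2), of l] by auto
    qed
    show ?thesis using h c by blast
  next
    case (act k d pc)
    let ?v = "u (sch t, k)"
    note ok = pc_okD[OF act(1)]
    note hd = ho[OF act(1)]
    have K: "d \<in> known (G t)" using Act_known[OF act(1)] .
    \<comment> \<open>The occupant of position \<open>j\<close> is a climber at level
      \<open>j\<close> but not at level \<open>Suc j\<close>, since an attempt holds at most one
      slot of a lock and none of a lock that it is still entering. It makes up for the process that
      moves past \<open>j\<close>.\<close>
    have collide: "\<exists>q'. q' \<noteq> sch t \<and> q' \<in> climbers t l j \<and> q' \<notin> climbers t l (Suc j)"
      if pc: "pc = Enter (l # ls) j" and s: "slot (G t) (l, j) \<noteq> 0" for l ls j
    proof -
      from slot_okD[OF slot_ok s] obtain q' k' d' pc' where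
        q': "loc (G t) q' = Act k' d' pc'" "slot (G t) (l, j) = enc d'" "(l, j) \<in> set (slots d')" by metis
      have lk: "l \<in> set (snd d')" using q'(3) known_slots[OF Act_known[OF q'(1)]] by auto
      have "d' \<noteq> d" using hd q'(2) pc by (auto simp: hold_ok_def)
      then have "q' \<noteq> sch t" using q' act by auto
      moreover have "q' \<in> climbers t l j" using q' lk unfolding climbers_def by blast
      moreover have "q' \<notin> climbers t l (Suc j)"
      proof
        assume "q' \<in> climbers t l (Suc j)"
        then consider ls j' where "pc' = Enter (l # ls) j'" | j' where "j' \<ge> Suc j" "slot (G t) (l, j') = enc d'"
          using q'(1) by (auto simp: climbers_def)
        then show False
        proof cases
          case 1
          then show ?thesis using ho[OF q'(1)] q'(2) by (auto simp: hold_ok_def)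
        next
          case 2
          then have "j' = j" using ho[OF q'(1)] q'(2) unfolding hold_ok_def by blast
          then show ?thesis using 2 by simp
        qed
      qed
      ultimately show ?thesis by blast
    qed
    have entm: "sch t \<in> climbers t l j" if "pc = Enter (l # ls) j" for l ls j
      using that act(1) ok by (auto simp: climbers_def)
    \<comment> \<open>At the last position the occupant and the process itself would be two climbers
      at a level that admits only one. So no climb ends without a slot.\<close>
    have nofail: "slot (G t) (l, j) = 0" if pc: "pc = Enter (l # ls) j" and j: "\<kappa> \<le> Suc j" for l ls j
    proof (rule ccontr)
      assume "slot (G t) (l, j) \<noteq> 0"
      from collide[OF pc this] obtain q' where "q' \<noteq> sch t" "q' \<in> climbers t l j" by blast
      then have "{q', sch t} \<subseteq> climbers t l j" "card {q', sch t} = 2" using entm[OF pc] by auto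
      moreover have "j < \<kappa>" using ok pc by simp
      ultimately have "2 + j \<le> \<kappa>" using cl by (metis add_le_mono1 card_mono le_trans)
      then show False using j by simp
    qed
    have h: "hold_ok (Suc t) d' pc'" if l': "loc (G (Suc t)) q = Act k' d' pc'" for q k' d' pc'
    proof (cases "q = sch t")
      case False
      then have l0: "loc (G t) q = Act k' d' pc'" using l' act by simp
      then have "d \<noteq> d'" using Act_unique[OF act(1) l0] False by auto
      then show ?thesis using ho[OF l0] act(2) by (auto simp: hold_ok_def slot_other)
    next
      case True
      then have a: "after e ?v k d pc (G t) = Act k' d' pc'" using l' act by simp
      have eq: "k' = k" "d' = d" using after_Act[OF a] by auto
      show ?thesis
      proof (cases "\<exists>l ls j. pc = Enter (l # ls) j")
        case T: True
        then obtain l ls j where pc: "pc = Enter (l # ls) j" by blast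
        have dis: "l \<notin> set ls" using ok pc by simp
        show ?thesis
        proof (cases "slot (G t) (l, j) = 0")
          case True
          then have "pc' = Enter ls 0" using a pc by simp
          then show ?thesis using hd True dis act(2) unfolding hold_ok_def eq pc
            by (auto simp: slot_pc_step leaving_def)
        next
          case False
          then have "pc' = Enter (l # ls) (Suc j)" using a pc nofail[OF pc] by auto
          then show ?thesis using hd False act(2) unfolding hold_ok_def eq pc
            by (auto simp: slot_pc_step leaving_def)
        qed
      next
        case F: False
        then have "pc' \<noteq> Enter ls j" for ls j using a after_Enter by metis
        then have e': "entering pc' = {}" by (rule entering_empty)
        have e: "entering pc = {}"
        proof (cases pc)
          case (Enter ls j)
          then show ?thesis using F by (cases ls) auto
        qed (auto simp: entering_def)
        show ?thesis
        proof (cases "leaving pc")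
          case True
          then have "leaving pc'" using a by (cases "(e, ?v, k, d, pc, G t)" rule: after.cases) (auto simp: leaving_def)
          then show ?thesis using hd e' act(2) unfolding hold_ok_def eq
            by (auto simp: slot_pc_step split: pc.splits list.splits if_splits)
        next
          case False
          then have "slot (G (Suc t)) s = slot (G t) s" for s
            using F act(2) by (auto simp: slot_pc_step leaving_def split: pc.splits list.splits)
          then show ?thesis using hd e e' False unfolding hold_ok_def eq by auto
        qed
      qed
    qed
    have c: "finite (climbers (Suc t) l i) \<and> card (climbers (Suc t) l i) + i \<le> \<kappa>" if i: "i < \<kappa>" for l i
    proof (cases "climbers (Suc t) l i \<subseteq> climbers t l i")
      case True
      then show ?thesis using cl[OF i] by (meson add_le_mono1 card_mono finite_subset le_trans)
    next
      case False
      then obtain q where q: "q \<in> climbers (Suc t) l i" "q \<notin> climbers t l i" by blast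
      have others: "q' \<in> climbers t l i" if q'1: "q' \<in> climbers (Suc t) l i" and q'2: "q' \<noteq> sch t" for q'
      proof -
        obtain k' d' pc' where l0: "loc (G (Suc t)) q' = Act k' d' pc'"
          using q'1 unfolding climbers_def by blast
        then have l1: "loc (G t) q' = Act k' d' pc'" using q'2 act by simp
        then have "d \<noteq> d'" using Act_unique[OF act(1) l1] q'2 by auto
        then show ?thesis using q'1 l0 l1 act(2) by (auto simp: climbers_def slot_other)
      qed
      then have qs: "q = sch t" using q by blast
      obtain pc' where l0: "loc (G (Suc t)) q = Act k d pc'" and lk: "l \<in> set (snd d)"
        and or: "i = 0 \<or> (\<exists>ls j. pc' = Enter (l # ls) j \<and> i \<le> j) \<or> (\<exists>j\<ge>i. slot (G (Suc t)) (l, j) = enc d)"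
      proof -
        obtain k2 d2 pc2 where *: "loc (G (Suc t)) q = Act k2 d2 pc2" "l \<in> set (snd d2)"
          "i = 0 \<or> (\<exists>ls j. pc2 = Enter (l # ls) j \<and> i \<le> j) \<or> (\<exists>j\<ge>i. slot (G (Suc t)) (l, j) = enc d2)"
          using q(1) unfolding climbers_def by blast
        then have "after e ?v k d pc (G t) = Act k2 d2 pc2" using qs act by simp
        then have "k2 = k" "d2 = d" using after_Act by blast+
        then show thesis using * that by blast
      qed
      have i0: "i \<noteq> 0" using q(2) qs act lk by (auto simp: climbers_def)
      have nslot: "slot (G (Suc t)) (l, j) \<noteq> enc d" if "j \<ge> i" for j
      proof
        assume "slot (G (Suc t)) (l, j) = enc d"
        then have "slot (G t) (l, j) = enc d \<or> (\<exists>ls. pc = Enter (l # ls) j)"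
          using act(2) by (auto simp: slot_pc_step split: pc.splits list.splits if_splits)
        then show False using that q(2) qs act lk by (auto simp: climbers_def)
      qed
      with or i0 obtain ls j where pc': "pc' = Enter (l # ls) j" "i \<le> j" by blast
      have "after e ?v k d pc (G t) = Act k d (Enter (l # ls) j)" using l0 qs act pc' by simp
      from after_Enter[OF this] pc' i0 obtain j' where
        j': "pc = Enter (l # ls) j'" "j = Suc j'" "Suc j' < \<kappa>" "slot (G t) (l, j') \<noteq> 0" by auto
      have "\<not> i \<le> j'" using q(2) qs act lk j' by (auto simp: climbers_def)
      then have ij: "i = Suc j'" using pc' j' by simp
      obtain q' where q': "q' \<noteq> sch t" "q' \<in> climbers t l j'" "q' \<notin> climbers t l (Suc j')"
        using collide[OF j'(1,4)] by blast
      have "climbers t l (Suc j') \<subseteq> climbers t l j'"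
        unfolding climbers_def by (auto intro: Suc_leD)
      then have sub: "climbers (Suc t) l i \<subseteq> climbers t l j' - {q'}"
        using others q' ij entm[OF j'(1)] by auto
      have j'k: "j' < \<kappa>" using j'(3) by simp
      have "card (climbers (Suc t) l i) \<le> card (climbers t l j') - 1"
        using card_mono[OF _ sub] cl(1)[OF j'k, of l] q'(2) by simp
      moreover have "card (climbers t l j') > 0"
        using cl(1)[OF j'k, of l] q'(2) card_gt_0_iff by blast
      ultimately show ?thesis using cl[OF j'k, of l] finite_subset[OF sub] ij by auto
    qed
    show ?thesis using h c by blast
  qed
qed

lemma holds:
  assumes "loc (G t) q = Act k d pc" "\<not> leaving pc" "l \<in> set (snd d)" "l \<notin> entering pc"
  obtains j where "slot (G t) (l, j) = enc d" "j < \<kappa>"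
proof -
  obtain j where j: "slot (G t) (l, j) = enc d"
    using climb[of t] assms unfolding hold_ok_def by blast
  from slot_okD[OF slot_ok, of t "(l, j)"] j obtain q' k' d' pc' where
    "loc (G t) q' = Act k' d' pc'" "enc d = enc d'" "(l, j) \<in> set (slots d')"
    by (metis enc_neq_0(1))
  then have "j < \<kappa>" by (auto simp: set_slots)
  with j that show thesis by blast
qed

lemma card_active:
  "finite {q. \<exists>k d pc. loc (G t) q = Act k d pc \<and> l \<in> set (snd d)}"
  "card {q. \<exists>k d pc. loc (G t) q = Act k d pc \<and> l \<in> set (snd d)} \<le> \<kappa>"
proof -
  have "{q. \<exists>k d pc. loc (G t) q = Act k d pc \<and> l \<in> set (snd d)} = climbers t l 0"
    by (auto simp: climbers_def)
  moreover have "finite (climbers t l 0) \<and> card (climbers t l 0) + 0 \<le> \<kappa>"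
    using climb[of t] pos by (metis less_le_trans zero_less_one)
  ultimately show "finite {q. \<exists>k d pc. loc (G t) q = Act k d pc \<and> l \<in> set (snd d)}"
    "card {q. \<exists>k d pc. loc (G t) q = Act k d pc \<and> l \<in> set (snd d)} \<le> \<kappa>"
    by auto
qed

lemma slot_keep:
  assumes "slot (G t) s = enc d" "loc (G t) q = Act k d pc" "\<not> leaving pc"
  shows "slot (G (Suc t)) s = enc d"
proof (cases t rule: step_cases)
  case (act k' d' pc')
  show ?thesis
  proof (cases "d' = d")
    case True
    then have "pc' = pc" using Act_unique[OF act(1) assms(2)] by simp
    then show ?thesis using assms act True
      by (auto simp: slot_pc_step leaving_def split: pc.splits list.splits)
  next
    case False
    then show ?thesis using assms act by (auto simp: slot_other)
  qed
qed (use assms in auto)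

lemma hot_owner:
  assumes "hot (stat (G t) (fst d))" "d \<in> known (G t)"
  obtains q k pc where "loc (G t) q = Act k d pc" "contending pc"
proof -
  obtain q k d' pc where "loc (G t) q = Act k d' pc" "fst d' = fst d" "contending pc"
    using hot_contending[OF assms(1)] by blast
  moreover have "d' = d" using known_unique[OF Act_known assms(2)] calculation by blast
  ultimately show thesis using that by blast
qed

lemma contending_not_leaving: "contending pc \<Longrightarrow> \<not> leaving pc \<and> entering pc = {}"
  by (cases pc) (auto simp: leaving_def entering_def)

lemma hot_slot:
  assumes "hot (stat (G t) (fst d))" "d \<in> known (G t)" "l \<in> set (snd d)"
  obtains j where "slot (G t) (l, j) = enc d" "j < \<kappa>"
proof -
  obtain q k pc where "loc (G t) q = Act k d pc" "contending pc" using hot_owner[OF assms(1,2)] .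
  then show thesis using holds[of t q k d pc l] contending_not_leaving assms(3) that by auto
qed

end

section \<open>Mutual exclusion\<close>

lemma own_steps_snoc:
  assumes "i < length h"
  shows "own_steps (h @ [(q, s)]) i = own_steps h i \<union>
    (if q = fst (h ! i) \<and> \<not> is_Invoke s \<and>
        (\<forall>j. i < j \<and> j < length h \<and> fst (h ! j) = q \<longrightarrow> \<not> is_Invoke (snd (h ! j)))
     then {length h} else {})"
  using assms by (auto simp: own_steps_def nth_append less_Suc_eq split: if_splits)

lemma own_steps_less: "j \<in> own_steps h i \<Longrightarrow> j < length h"
  by (simp add: own_steps_def)

lemma finite_own_steps: "finite (own_steps h i)"
  by (rule finite_subset[of _ "{..<length h}"]) (auto dest: own_steps_less)

lemma own_steps_last: "own_steps (h @ [(q, s)]) (length h) = {length h}"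
  by (auto simp: own_steps_def nth_append)

lemma returned_snoc:
  assumes "i < length h"
  shows "returned (h @ [(q, s)]) i b \<longleftrightarrow> returned h i b \<or> (s = Respond b \<and> q = fst (h ! i) \<and>
        (\<forall>j. i < j \<and> j < length h \<and> fst (h ! j) = q \<longrightarrow> \<not> is_Invoke (snd (h ! j))))"
proof -
  have "h ! j = (h @ [(q, s)]) ! j" if "j \<in> own_steps h i" for j
    using own_steps_less[OF that] by (simp add: nth_append)
  then show ?thesis
    unfolding returned_def own_steps_snoc[OF assms] by (auto simp: bex_Un)
qed

lemma returned_length: "returned h i b \<Longrightarrow> i < length h"
  by (auto simp: returned_def own_steps_def)

lemma thunk_step_at_snoc:
  "thunk_step_at (h @ [(q, s)]) th j \<longleftrightarrow>
     thunk_step_at h th j \<or> (j = length h \<and> (\<exists>s'. s = Thunk_Step th s'))"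
  by (auto simp: thunk_step_at_def nth_append less_Suc_eq)

lemma finishes_at_snoc:
  "finishes_at (h @ [(q, s)]) th j \<longleftrightarrow>
     finishes_at h th j \<or> (j = length h \<and> s = Thunk_Step th Finish)"
  by (auto simp: finishes_at_def nth_append less_Suc_eq)

lemma finishes_at_iff_mem: "(\<exists>j. finishes_at h th j) \<longleftrightarrow> (\<exists>q. (q, Thunk_Step th Finish) \<in> set h)"
  by (auto simp: finishes_at_def in_set_conv_nth) (metis prod.collapse)

lemma thunk_step_at_mem: "thunk_step_at h th j \<Longrightarrow> \<exists>q s. (q, Thunk_Step th s) \<in> set h"
  by (metis nth_mem prod.collapse thunk_step_at_def)

lemma finishes_at_less: "finishes_at h th j \<Longrightarrow> j < length h"
  by (simp add: finishes_at_def)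

lemma interval_snoc:
  "interval (h @ [(q, s)]) th \<subseteq> interval h th \<union>
     {j. j = length h \<and> (\<exists>i. thunk_step_at (h @ [(q, s)]) th i) \<and> (\<forall>i. \<not> finishes_at h th i)}"
proof
  fix j assume j: "j \<in> interval (h @ [(q, s)]) th"
  then consider "j < length h" | "j = length h" by (fastforce simp: interval_def)
  then show "j \<in> interval h th \<union>
     {j. j = length h \<and> (\<exists>i. thunk_step_at (h @ [(q, s)]) th i) \<and> (\<forall>i. \<not> finishes_at h th i)}"
  proof cases
    case 1
    then show ?thesis using j by (auto simp: interval_def thunk_step_at_snoc finishes_at_snoc)
  next
    case 2
    then show ?thesis using j finishes_at_less[of h th]
      by (auto simp: interval_def finishes_at_snoc)
  qed
qed

lemma share_sym: "share x y \<Longrightarrow> share y x"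
  by (auto simp: share_def)

section \<open>Contenders that share a lock\<close>

context algo
begin

text \<open>The state of a helper of \<open>x\<close> does not forget an earlier contender \<open>y\<close>: either it has still to
  inspect a slot of \<open>y\<close>, or it is about to inspect \<open>y\<close>, or it has already decided against \<open>x\<close>.\<close>
fun aware :: "state \<Rightarrow> desc \<Rightarrow> desc \<Rightarrow> pc \<Rightarrow> bool" where
  "aware g y x (Check x' b rest) \<longleftrightarrow> (x' = x \<longrightarrow> (\<exists>s\<in>set rest. slot g s = enc y))"
| "aware g y x (CheckAt x' b y' rest) \<longleftrightarrow> (x' = x \<longrightarrow> y' = y \<or> (\<exists>s\<in>set rest. slot g s = enc y))"
| "aware g y x (Decide x' b w) \<longleftrightarrow> (x' = x \<longrightarrow> w = 3)"
| "aware g y x _ \<longleftrightarrow> True"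

lemma aware_resume [simp]: "aware g y x (resume b)"
  by (cases b) auto

lemma aware_tick [simp]: "aware g y x s \<Longrightarrow> aware g y x (tick i s)"
  by (simp add: tick_def)

lemma aware_after:
  assumes aw: "aware g y x pc" and hy: "hot (stat g (fst y))" and ne: "x \<noteq> y"
    and sl: "\<exists>s\<in>set (slots x). slot g s = enc y"
    and a: "after e v k d pc g = Act k' d' pc'"
  shows "aware g y x pc'"
  using a aw ne sl hy by (cases pc rule: pc_cases) (auto split: if_splits)

end

context algo_env
begin

lemma slot_keep_hot:
  assumes "hot (stat (G t) (fst y))" "y \<in> known (G t)" "slot (G t) s = enc y"
  shows "slot (G (Suc t)) s = enc y"
  by (rule hot_owner[OF assms(1,2)]) (use slot_keep[OF assms(3)] contending_not_leaving in blast)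

lemma aware_mono:
  assumes "\<And>s. slot g s = enc y \<Longrightarrow> slot g' s = enc y" "aware g y x pc"
  shows "aware g' y x pc"
  using assms by (cases pc) auto

lemma known_unique2:
  assumes "d \<in> known (G t)" "d' \<in> known (G t')" "fst d = fst d'"
  shows "d = d'"
  using known_unique[of d "max t t'" d'] known_mono[of t "max t t'"] known_mono[of t' "max t t'"] assms
  by auto

text \<open>At time \<open>X\<close> nobody helps \<open>x\<close>, because helping presupposes a
  nonzero status, so \<open>aware\<close> holds vacuously. From then on \<open>y\<close> stays in
  its slots while it is hot. Hence every scan on behalf of \<open>x\<close> starts with a slot of
  \<open>y\<close> ahead, and can only end in a vote for 3 as long as \<open>y\<close> is
  hot.\<close>

lemma later_not_won:
  assumes y: "y \<in> known (G X)" "hot (stat (G X) (fst y))" and x: "stat (G X) (fst x) = 0"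
    and kx: "x \<in> known (G t')" and sh: "share x y"
    and t: "X \<le> t" "hot (stat (G t) (fst y))"
  shows "\<not> won (stat (G t) (fst x)) \<and>
    (\<forall>q k d pc. loc (G t) q = Act k d pc \<longrightarrow> aware (G t) y x pc)"
  using t
proof (induction t rule: dec_induct)
  case base
  have "aware (G X) y x pc" if "loc (G X) q = Act k d pc" for q k d pc
    using st_okD[OF that] x by (cases pc) (auto simp: helping_def)
  with x show ?case by auto
next
  case (step t)
  have hy: "hot (stat (G t) (fst y))"
    using hot_between[OF step(1) _ y(2) step.prems] by simp
  note IH = step.IH[OF hy]
  have ky: "y \<in> known (G t)" using y(1) known_mono[OF step(1)] by blast
  have keep: "slot (G t) s = enc y \<Longrightarrow> slot (G (Suc t)) s = enc y" for s
    by (rule slot_keep_hot[OF hy ky])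
  have mono: "aware (G t) y x pc \<Longrightarrow> aware (G (Suc t)) y x pc" for pc
    using aware_mono keep by blast
  have ne: "x \<noteq> y" using sh by (simp add: share_def)
  obtain l where l: "l \<in> set (snd x)" "l \<in> set (snd y)" using sh by (auto simp: share_def)
  obtain j where "slot (G t) (l, j) = enc y" "j < \<kappa>" using hot_slot[OF hy ky l(2)] .
  then have sl: "\<exists>s\<in>set (slots x). slot (G t) s = enc y" using known_slots[OF kx] l(1) by blast
  have nw: "\<not> won (stat (G (Suc t)) (fst x))"
  proof (cases rule: stat_step[of t "fst x"])
    case (decide k d x' b w)
    have "x' \<in> known (G t)" using pc_okD[OF decide(1)] by (simp add: help_ok_def)
    then have "x' = x" using known_unique2[OF _ kx] decide(2) by blast
    then have "aware (G t) y x (Decide x b w)" using IH decide(1) by blast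
    then have "w = 3" by simp
    then show ?thesis using decide by simp
  next
    case close
    then show ?thesis using IH by simp
  qed (use IH in auto)
  have "aware (G (Suc t)) y x pc" if l': "loc (G (Suc t)) q = Act k d pc" for q k d pc
  proof (cases t rule: step_cases)
    case skip
    then show ?thesis using l' IH by auto
  next
    case (invoke ls th)
    show ?thesis
    proof (cases "q = sch t")
      case True
      then show ?thesis using l' invoke by auto
    next
      case False
      then show ?thesis using l' invoke IH mono by auto
    qed
  next
    case (act k0 d0 pc0)
    show ?thesis
    proof (cases "q = sch t")
      case True
      then have a: "after e (u (sch t, k0)) k0 d0 pc0 (G t) = Act k d pc" using l' act by simp
      have "aware (G t) y x pc0" using IH act(1) by blast
      then have "aware (G t) y x pc" by (rule aware_after[OF _ hy ne sl a])
      then show ?thesis by (rule mono)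
    next
      case False
      then have "loc (G t) q = Act k d pc" using l' act by simp
      then show ?thesis using IH mono by blast
    qed
  qed
  with nw show ?case by blast
qed

lemma first_hot:
  assumes "hot (stat (G t) th)"
  obtains s k d pc where "s < t" "loc (G s) (sch s) = Act k d pc" "trig (u (sch s, k)) pc" "fst d = th"
    "stat (G s) th = 0" "stat (G (Suc s)) th = 1"
proof -
  define s where "s = (LEAST s. hot (stat (G s) th))"
  have helping: "hot (stat (G s) th)" unfolding s_def using assms by (rule LeastI)
  have "s \<noteq> 0" using helping by (intro notI) simp
  then obtain r where r: "s = Suc r" by (cases s) auto
  have nh: "\<not> hot (stat (G r) th)" using not_less_Least[of r "\<lambda>s. hot (stat (G s) th)"] r s_def by simp
  have "s \<le> t" unfolding s_def using assms by (rule Least_le)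
  then have "r < t" using r by simp
  show thesis
  proof (cases rule: stat_step[of r th])
    case (acq k d pc)
    then show thesis using that[OF \<open>r < t\<close>] by blast
  qed (use nh helping r in auto)
qed

text \<open>This concerns status 2 and not \<open>won\<close>: the later contender may well win once
  the earlier one has been closed. The two contentions start at different steps, as a step starts at
  most one; the one that starts later cannot win while the other is hot.\<close>

lemma not_both_won:
  assumes "x \<in> known (G t)" "y \<in> known (G t)" "share x y"
  shows "\<not> (stat (G t) (fst x) = 2 \<and> stat (G t) (fst y) = 2)"
proof
  assume w: "stat (G t) (fst x) = 2 \<and> stat (G t) (fst y) = 2"
  obtain a k d pc where a: "a < t" "loc (G a) (sch a) = Act k d pc" "fst d = fst x"
    "stat (G a) (fst x) = 0" "stat (G (Suc a)) (fst x) = 1" by (rule first_hot[of t "fst x"]) (use w in auto)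
  obtain b k' d' pc' where b: "b < t" "loc (G b) (sch b) = Act k' d' pc'" "fst d' = fst y"
    "stat (G b) (fst y) = 0" "stat (G (Suc b)) (fst y) = 1" by (rule first_hot[of t "fst y"]) (use w in auto)
  have dx: "d = x" using known_unique2[OF Act_known[OF a(2)] assms(1) a(3)] .
  have dy: "d' = y" using known_unique2[OF Act_known[OF b(2)] assms(2) b(3)] .
  have "a \<noteq> b" using a b dx dy assms(3) by (auto simp: share_def)
  then consider "a < b" | "b < a" by linarith
  then show False
  proof cases
    case 1
    have "x \<in> known (G (Suc a))" using Act_known[OF a(2)] dx known_Suc by blast
    moreover have "stat (G (Suc a)) (fst y) = 0"
      using level_mono[of "Suc a" b "fst y"] 1 b(4) by (auto simp: level_def split: if_splits)
    ultimately show False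
      using later_not_won[of x "Suc a" y t t] a assms(2) share_sym[OF assms(3)] w by auto
  next
    case 2
    have "y \<in> known (G (Suc b))" using Act_known[OF b(2)] dy known_Suc by blast
    moreover have "stat (G (Suc b)) (fst x) = 0"
      using level_mono[of "Suc b" a "fst x"] 2 a(4) by (auto simp: level_def split: if_splits)
    ultimately show False
      using later_not_won[of y "Suc b" x t t] b assms(1) assms(3) w by auto
  qed
qed

lemma won_step: "won (stat (G t) th) \<Longrightarrow> won (stat (G (Suc t)) th)"
  by (cases rule: stat_step[of t th]) auto

lemma thunk_label:
  assumes "label e v d pc g = Thunk_Step th s"
  shows "(\<exists>x b. pc = Launch x b \<and> fst x = th) \<or> (\<exists>x b c. pc = Inside x b c \<and> fst x = th)"
  using assms by (cases "(e, v, d, pc, g)" rule: label.cases) auto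

lemma after_Close:
  assumes "after e v k d pc g = Act k' d' (Close x b)"
  shows "pc = Inside x b Halt"
proof -
  have "resume c \<noteq> Close x b" for c by (cases c) auto
  then show ?thesis
    using assms by (cases "(e, v, k, d, pc, g)" rule: after.cases)
      (auto simp: tick_def split: if_splits list.splits elim!: next_pc.elims)
qed

text \<open>\<open>Close\<close> is reached only by completing a run, and only \<open>Close\<close>
  writes 4. So a status 4 certifies that the history contains a finished run.\<close>

lemma thunk_hist:
  "(\<forall>q th s. (q, Thunk_Step th s) \<in> set (tr (G t)) \<longrightarrow> won (stat (G t) th)) \<and>
   (\<forall>q k d x b. loc (G t) q = Act k d (Close x b) \<longrightarrow> (\<exists>q. (q, Thunk_Step (fst x) Finish) \<in> set (tr (G t)))) \<and>
   (\<forall>th. stat (G t) th = 4 \<longrightarrow> (\<exists>q. (q, Thunk_Step th Finish) \<in> set (tr (G t))))"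
proof (induction t)
  case 0
  show ?case by simp
next
  case (Suc t)
  have tm: "x \<in> set (tr (G t)) \<Longrightarrow> x \<in> set (tr (G (Suc t)))" for x
    using tr_Suc[of t] by auto
  have 1: "won (stat (G (Suc t)) th)" if "(q, Thunk_Step th s) \<in> set (tr (G (Suc t)))" for q th s
  proof (cases "(q, Thunk_Step th s) \<in> set (tr (G t))")
    case True
    then show ?thesis using Suc won_step by blast
  next
    case new: False
    show ?thesis
    proof (cases t rule: step_cases)
      case (act k d pc)
      then have "label e (u (sch t, k)) d pc (G t) = Thunk_Step th s" using new that by auto
      then have "won (stat (G t) th)" using thunk_label st_okD[OF act(1)] by fastforce
      then show ?thesis by (rule won_step)
    qed (use new that in auto)
  qed
  have 2: "\<exists>q. (q, Thunk_Step (fst x) Finish) \<in> set (tr (G (Suc t)))"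
    if l: "loc (G (Suc t)) q = Act k d (Close x b)" for q k d x b
  proof (cases "loc (G (Suc t)) q = loc (G t) q")
    case True
    then show ?thesis using Suc l tm by metis
  next
    case False
    then have q: "q = sch t" using loc_other by blast
    show ?thesis
    proof (cases t rule: step_cases)
      case (act k0 d0 pc0)
      then have "after e (u (sch t, k0)) k0 d0 pc0 (G t) = Act k d (Close x b)" using l q by simp
      from after_Close[OF this] show ?thesis using act by auto
    qed (use l q False in auto)
  qed
  have 3: "\<exists>q. (q, Thunk_Step th Finish) \<in> set (tr (G (Suc t)))" if "stat (G (Suc t)) th = 4" for th
  proof (cases rule: stat_step[of t th])
    case same
    then show ?thesis using Suc that tm by metis
  next
    case close
    then show ?thesis using Suc tm by metis
  qed (use that in auto)
  show ?case using 1 2 3 by blast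
qed

lemma thunk_step_at_won:
  assumes "thunk_step_at (tr (G t)) th j"
  shows "won (stat (G t) th)"
  using thunk_step_at_mem[OF assms] thunk_hist[of t] by blast

text \<open>At the response the status is 0, 3 or 4. The last two are final, and a 0 can be changed
  only by a step of the owner, which is no longer on this attempt. In particular the thunk of a
  failed attempt is never run later on.\<close>

lemma returned_stat:
  "returned (tr (G t)) i b \<Longrightarrow> attempt (tr (G t)) i q ls th \<Longrightarrow>
     \<not> hot (stat (G t) th) \<and> (b \<longleftrightarrow> stat (G t) th = 4) \<and>
     (\<forall>q k d pc. loc (G t) q = Act k d pc \<longrightarrow> fst d \<noteq> th)"
proof (induction t)
  case 0
  then show ?case by (simp add: attempt_def)
next
  case (Suc t)
  show ?case
  proof (cases "returned (tr (G t)) i b")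
    case True
    then have "attempt (tr (G t)) i q ls th"
      using returned_length[OF True] Suc.prems(2) tr_Suc[of t] by (auto simp: attempt_append)
    from Suc.IH[OF True this] have IH: "\<not> hot (stat (G t) th)" "b \<longleftrightarrow> stat (G t) th = 4"
      "\<And>q k d pc. loc (G t) q = Act k d pc \<Longrightarrow> fst d \<noteq> th" by blast+
    have "stat (G (Suc t)) th = stat (G t) th"
      by (cases rule: stat_step[of t th]) (use IH in auto)
    moreover have "fst d \<noteq> th" if l: "loc (G (Suc t)) q' = Act k d pc" for q' k d pc
    proof (cases t rule: step_cases)
      case skip
      then show ?thesis using IH(3) l by simp
    next
      case (invoke ls' th')
      have "th' \<noteq> th" using invoke_adm(3)[OF invoke(1,2)] \<open>attempt (tr (G t)) i q ls th\<close> by blast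
      then show ?thesis using IH(3) l invoke by (auto split: if_splits)
    next
      case (act k0 d0 pc0)
      then show ?thesis using IH(3)[of q' k d pc] IH(3)[OF act(1)] l after_Act
        by (fastforce split: if_splits)
    qed
    ultimately show ?thesis using IH by simp
  next
    case False
    show ?thesis
    proof (cases t rule: step_cases)
      case (invoke ls' th')
      have "i \<noteq> length (tr (G t))"
        using Suc.prems invoke by (auto simp: returned_def own_steps_last)
      then have "i < length (tr (G t))" using returned_length[OF Suc.prems(1)] invoke by simp
      from returned_snoc[OF this] show ?thesis using Suc.prems(1) False invoke by simp
    next
      case (act k d pc)
      have at: "attempt (tr (G t)) i q ls th"
        using Suc.prems(2) act label_not_Invoke(2) by (auto simp: attempt_append)
      then have i: "i < length (tr (G t))" by (simp add: attempt_def)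
      from returned_snoc[OF i] Suc.prems(1) False act have
        r: "label e (u (sch t, k)) d pc (G t) = Respond b" "sch t = fst (tr (G t) ! i)"
        "\<forall>j. i < j \<and> j < length (tr (G t)) \<and> fst (tr (G t) ! j) = sch t \<longrightarrow> \<not> is_Invoke (snd (tr (G t) ! j))"
        by auto
      then have pc: "pc = Leave b []" by (simp add: label_Respond)
      have q: "sch t = q" using r(2) at by (simp add: attempt_def)
      obtain i' where "open_at q d (tr (G t)) i'" using hist_Act(3)[OF act(1)] q by blast
      then obtain ls' where at': "attempt (tr (G t)) i' q ls' (fst d)"
        and no: "\<And>j. i' < j \<Longrightarrow> j < length (tr (G t)) \<Longrightarrow> fst (tr (G t) ! j) = q \<Longrightarrow> \<not> is_Invoke (snd (tr (G t) ! j))"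
        unfolding open_at_def by blast
      have "i' = i"
      proof (rule ccontr)
        assume "i' \<noteq> i"
        then consider "i < i'" | "i' < i" by linarith
        then show False
        proof cases
          case 1
          then show ?thesis using r(3) q at' by (auto simp: attempt_def)
        next
          case 2
          then show ?thesis using no[of i] at by (auto simp: attempt_def)
        qed
      qed
      then have th: "fst d = th" using at at' by (simp add: attempt_def)
      have st: "\<not> hot (stat (G t) th)" "b \<longleftrightarrow> stat (G t) th = 4"
        using st_okD[OF act(1)] pc th by auto
      have "fst d' \<noteq> th" if "loc (G (Suc t)) q' = Act k' d' pc'" for q' k' d' pc'
      proof -
        have "q' \<noteq> sch t" using that act pc by auto
        then have "loc (G t) q' = Act k' d' pc'" using that act by simp
        then show ?thesis using Act_unique[OF act(1)] \<open>q' \<noteq> sch t\<close> th by metis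
      qed
      then show ?thesis using st act pc by (simp add: stat_pc_step)
    qed (use Suc.prems False in auto)
  qed
qed

text \<open>A step can lengthen only intervals of thunks that have been started and not finished
  before it (\<open>N\<close>). Their status is 2, so \<open>not_both_won\<close> excludes that two
  of them share a lock; for the old positions the induction hypothesis applies.\<close>

lemma interval_disjoint:
  "x \<in> known (G t) \<Longrightarrow> y \<in> known (G t) \<Longrightarrow> share x y \<Longrightarrow>
     interval (tr (G t)) (fst x) \<inter> interval (tr (G t)) (fst y) = {}"
proof (induction t)
  case 0
  then show ?case by (simp add: known_def)
next
  case (Suc t)
  have noth: "interval (tr (G t)) (fst d) = {}" if "d \<in> known (G (Suc t))" "d \<notin> known (G t)" for d
  proof (rule ccontr)
    assume "interval (tr (G t)) (fst d) \<noteq> {}"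
    then obtain i where "thunk_step_at (tr (G t)) (fst d) i" by (auto simp: interval_def)
    then have "won (stat (G t) (fst d))" by (rule thunk_step_at_won)
    then have "fst d \<in> fst ` known (G t)" by (intro stat_known) auto
    then obtain d' where "d' \<in> known (G t)" "fst d' = fst d" by (metis imageE)
    then show False using that known_unique2[of d' t d "Suc t"] by auto
  qed
  have old: "interval (tr (G t)) (fst x) \<inter> interval (tr (G t)) (fst y) = {}"
    using Suc.IH[OF _ _ Suc.prems(3)] noth[OF Suc.prems(1)] noth[OF Suc.prems(2)]
    by (cases "x \<in> known (G t)"; cases "y \<in> known (G t)") simp_all
  consider "tr (G (Suc t)) = tr (G t)" | q s where "tr (G (Suc t)) = tr (G t) @ [(q, s)]"
    using tr_Suc[of t] by auto
  then show ?case
  proof cases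
    case 1
    then show ?thesis using old by simp
  next
    case (2 q s)
    define N where "N th \<longleftrightarrow> (\<exists>i. thunk_step_at (tr (G (Suc t))) th i) \<and> (\<forall>i. \<not> finishes_at (tr (G t)) th i)" for th
    have N2: "stat (G (Suc t)) th = 2" if "N th" for th
    proof -
      have "won (stat (G (Suc t)) th)"
        using that thunk_step_at_won unfolding N_def by blast
      moreover have "stat (G (Suc t)) th \<noteq> 4"
      proof
        assume f: "stat (G (Suc t)) th = 4"
        have "\<exists>q. (q, Thunk_Step th Finish) \<in> set (tr (G t))"
        proof (cases rule: stat_step[of t th])
          case same
          then show ?thesis using f thunk_hist[of t] by metis
        next
          case close
          then show ?thesis using thunk_hist[of t] by metis
        qed (use f in auto)
        then show False using that finishes_at_iff_mem unfolding N_def by metis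
      qed
      ultimately show ?thesis by (auto simp: won_def)
    qed
    have sub: "interval (tr (G (Suc t))) th \<subseteq> interval (tr (G t)) th \<union> {j. j = length (tr (G t)) \<and> N th}" for th
      using interval_snoc[of "tr (G t)" q s th] 2 unfolding N_def by simp
    have lt: "j < length (tr (G t))" if "j \<in> interval (tr (G t)) th" for j th
      using that by (simp add: interval_def)
    have "\<not> (N (fst x) \<and> N (fst y))"
      using N2 not_both_won[OF Suc.prems] by blast
    then show ?thesis using sub[of "fst x"] sub[of "fst y"] old lt by fast
  qed
qed

theorem mutual_exclusion_tr: "mutual_exclusion (tr (G t))"
  unfolding mutual_exclusion_def
proof (intro conjI allI impI)
  fix j th assume "thunk_step_at (tr (G t)) th j"
  then show "\<exists>i<j. \<exists>p ls. attempt (tr (G t)) i p ls th"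
  proof (induction t)
    case 0
    then show ?case by (simp add: thunk_step_at_def)
  next
    case (Suc t)
    consider "tr (G (Suc t)) = tr (G t)" | q s where "tr (G (Suc t)) = tr (G t) @ [(q, s)]"
      using tr_Suc[of t] by auto
    then show ?case
    proof cases
      case 1
      then show ?thesis using Suc by simp
    next
      case (2 q s)
      show ?thesis
      proof (cases "thunk_step_at (tr (G t)) th j")
        case True
        then show ?thesis using Suc.IH 2 by (auto simp: attempt_append)
      next
        case False
        then have j: "j = length (tr (G t))" and s: "\<exists>s'. s = Thunk_Step th s'"
          using Suc.prems 2 by (auto simp: thunk_step_at_snoc)
        have "won (stat (G (Suc t)) th)" using Suc.prems by (rule thunk_step_at_won)
        then have "th \<in> fst ` known (G (Suc t))" by (intro stat_known) auto
        then obtain i q' ls where "attempt (tr (G (Suc t))) i q' ls th"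
          by (auto simp: known_attempt)
        then have "attempt (tr (G t)) i q' ls th" using 2 s by (auto simp: attempt_append)
        then show ?thesis using j 2 by (auto simp: attempt_append attempt_def nth_append)
      qed
    qed
  qed
next
  fix i p ls th
  assume at: "attempt (tr (G t)) i p ls th" and r: "returned (tr (G t)) i True"
  have "stat (G t) th = 4" using returned_stat[OF r at] by simp
  then show "\<exists>j. finishes_at (tr (G t)) th j" using thunk_hist[of t] unfolding finishes_at_iff_mem by blast
next
  fix i p ls th i' p' ls' th'
  assume at: "attempt (tr (G t)) i p ls th"
    and a': "attempt (tr (G t)) i' p' ls' th' \<and> i' \<noteq> i \<and> ls |\<inter>| ls' \<noteq> {||}"
  have "th \<noteq> th'" using attempt_unique[OF at] a' by blast
  then have sh: "share (th, sorted_list_of_fset ls) (th', sorted_list_of_fset ls')"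
    using a' by (auto simp: share_def)
  have "(th, sorted_list_of_fset ls) \<in> known (G t)" "(th', sorted_list_of_fset ls') \<in> known (G t)"
    using at a' by (auto simp: known_attempt)
  from interval_disjoint[OF this sh] show "interval (tr (G t)) th \<inter> interval (tr (G t)) th' = {}" by simp
next
  fix i p ls th j
  assume at: "attempt (tr (G t)) i p ls th" and r: "returned (tr (G t)) i False"
  have "\<not> won (stat (G t) th)" using returned_stat[OF r at] by (auto simp: won_def hot_def)
  then show "\<not> thunk_step_at (tr (G t)) th j" using thunk_step_at_won by blast
qed

end

lemma num_attempts_open:
  assumes "i < length h" "h ! i = (q, Invoke ls th)"
    "\<And>j. i < j \<Longrightarrow> j < length h \<Longrightarrow> fst (h ! j) = q \<Longrightarrow> \<not> is_Invoke (snd (h ! j))"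
  shows "num_attempts q h = Suc (num_attempts q (take i h))"
proof -
  have "filter (\<lambda>(q', s). q' = q \<and> is_Invoke s) (drop (Suc i) h) = []"
    unfolding filter_empty_conv
  proof
    fix x assume "x \<in> set (drop (Suc i) h)"
    then obtain j where "x = h ! j" "i < j" "j < length h"
      by (auto simp: in_set_conv_nth)
    then show "\<not> (case x of (q', s) \<Rightarrow> q' = q \<and> is_Invoke s)"
      using assms(3)[of j] by (cases "h ! j") auto
  qed
  moreover have "filter P h = filter P (take i h) @ filter P [h ! i] @ filter P (drop (Suc i) h)" for P
    using id_take_nth_drop[OF assms(1)] by (metis filter_append append_Cons append_Nil)
  ultimately show ?thesis using assms(2) by (simp add: num_attempts_def)
qed

section \<open>Counting steps\<close>

definition nsteps :: "(nat \<Rightarrow> bool) \<Rightarrow> nat \<Rightarrow> nat \<Rightarrow> nat" where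
  "nsteps P a b = card {r. a \<le> r \<and> r < b \<and> P r}"

lemma finite_nsteps: "finite {r. a \<le> r \<and> r < (b::nat) \<and> P r}"
  by (rule finite_subset[of _ "{..<b}"]) auto

lemma nsteps_empty [simp]: "b \<le> a \<Longrightarrow> nsteps P a b = 0"
  by (auto simp: nsteps_def)

lemma nsteps_Suc: "a \<le> b \<Longrightarrow> nsteps P a (Suc b) = nsteps P a b + (if P b then 1 else 0)"
proof -
  assume "a \<le> b"
  then have "{r. a \<le> r \<and> r < Suc b \<and> P r} = (if P b then {b} else {}) \<union> {r. a \<le> r \<and> r < b \<and> P r}"
    by (auto simp: less_Suc_eq)
  then show ?thesis using finite_nsteps[of a b P] by (auto simp: nsteps_def)
qed

lemma nsteps_Suc_left: "a < b \<Longrightarrow> nsteps P a b = (if P a then 1 else 0) + nsteps P (Suc a) b"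
proof -
  assume "a < b"
  then have "{r. a \<le> r \<and> r < b \<and> P r} = (if P a then {a} else {}) \<union> {r. Suc a \<le> r \<and> r < b \<and> P r}"
    by (auto simp: Suc_le_eq order_le_less)
  then show ?thesis using finite_nsteps[of "Suc a" b P] by (auto simp: nsteps_def)
qed

lemma nsteps_mono: "a' \<le> a \<Longrightarrow> b \<le> b' \<Longrightarrow> nsteps P a b \<le> nsteps P a' b'"
  unfolding nsteps_def by (rule card_mono[OF finite_nsteps]) auto

lemma nsteps_less: "a \<le> b \<Longrightarrow> b < c \<Longrightarrow> P b \<Longrightarrow> nsteps P a b < nsteps P a c"
  using nsteps_mono[of a a "Suc b" c P] nsteps_Suc[of a b P] by auto

lemma nsteps_less_left: "a < b \<Longrightarrow> a < c \<Longrightarrow> P a \<Longrightarrow> nsteps P b c < nsteps P a c"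
  using nsteps_mono[of "Suc a" b c c P] nsteps_Suc_left[of a c P] by auto

lemma card_first_steps:
  "finite {s. a \<le> s \<and> P s \<and> nsteps P a s \<le> n} \<and> card {s. a \<le> s \<and> P s \<and> nsteps P a s \<le> n} \<le> Suc n"
proof -
  let ?S = "{s. a \<le> s \<and> P s \<and> nsteps P a s \<le> n}"
  have inj: "inj_on (nsteps P a) ?S"
    by (rule inj_onI) (metis (mono_tags, lifting) mem_Collect_eq nsteps_less linorder_neqE_nat less_irrefl)
  have im: "nsteps P a ` ?S \<subseteq> {..n}" by auto
  have "finite ?S" using inj_on_finite[OF inj im] by simp
  moreover have "card ?S \<le> card {..n}" by (rule card_inj_on_le[OF inj im]) simp
  ultimately show ?thesis by simp
qed

text \<open>Counting towards \<open>b\<close> is injective on these steps. A step counts itself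
  here, so the values range from 1 to \<open>n\<close>; counting from \<open>a\<close> on, as in
  \<open>card_first_steps\<close>, begins with 0 and gives \<open>Suc n\<close>.\<close>

lemma card_last_steps:
  "finite {s. s < b \<and> P s \<and> nsteps P s b \<le> n} \<and> card {s. s < b \<and> P s \<and> nsteps P s b \<le> n} \<le> n"
proof -
  let ?S = "{s. s < b \<and> P s \<and> nsteps P s b \<le> n}"
  have inj: "inj_on (\<lambda>s. nsteps P s b) ?S"
    by (rule inj_onI) (metis (mono_tags, lifting) mem_Collect_eq nsteps_less_left linorder_neqE_nat less_irrefl)
  have im: "(\<lambda>s. nsteps P s b) ` ?S \<subseteq> {1..n}" by (auto simp: nsteps_Suc_left)
  have "finite ?S" using inj_on_finite[OF inj im] by simp
  moreover have "card ?S \<le> card {1..n}" by (rule card_inj_on_le[OF inj im]) simp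
  ultimately show ?thesis by simp
qed

text \<open>The states after the wait. No state of the wait can follow them in the same attempt
  (\<open>after_post\<close>).\<close>

fun post :: "pc \<Rightarrow> bool" where
  "post (Pad n) = True"
| "post Fetch = True"
| "post (Leave b rest) = True"
| "post pc = contending pc"

fun window_index :: "pc \<Rightarrow> nat option" where
  "window_index (Wait i rest) = Some i"
| "window_index (WaitAt i y rest) = Some i"
| "window_index (Stuck i y rest) = Some i"
| "window_index _ = None"

definition steady :: "pc \<Rightarrow> bool" where
  "steady pc \<longleftrightarrow> (\<exists>i rest. pc = Wait i rest) \<or> (\<exists>i y rest. pc = WaitAt i y rest)"

lemma steady_simps [simp]:
  "steady (Wait i rest)" "steady (WaitAt i y rest)"
  "\<not> steady (Stuck i y rest)" "\<not> steady (Look rest)" "\<not> steady (Pad n)"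
  by (auto simp: steady_def)

section \<open>Progress of a single attempt\<close>

context algo
begin

definition bound :: nat where
  "bound = \<kappa> * L * (help_cost + 2) + wait_rank + 4 + L * (\<kappa> + 1) + \<kappa>"

lemma rank_start: "rank (Enter (take L ls) 0) < bound"
proof (cases "take L ls")
  case (Cons l ls')
  then have "Suc (length ls') \<le> L" by (metis length_Cons length_take min.cobounded2)
  then have "length ls' * (\<kappa> + 1) \<le> L * (\<kappa> + 1)" by (intro mult_le_mono1) simp
  then show ?thesis using Cons by (simp add: bound_def)
next
  case Nil
  show ?thesis unfolding Nil by (simp add: bound_def)
qed

lemma after_rank:
  assumes ok: "pc_ok K d pc" and a: "after e v k d pc g = Act k' d' pc'"
    and tb: "\<And>th. thunk_bound (thunk_code e th) T"
  shows "rank pc' < rank pc"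
proof -
  consider b where "pc = Leave b []" | x b where "pc = Launch x b" | x b where "pc = Inside x b Halt"
    | x b a f where "pc = Inside x b (Do a f)"
    | "\<And>b. pc \<noteq> Leave b []" "\<And>x b. pc \<noteq> Launch x b" "\<And>x b c. pc \<noteq> Inside x b c"
    by (metis thunk.exhaust)
  then show ?thesis
  proof cases
    case (2 x b)
    then show ?thesis using a thunk_length_le[OF tb[of "fst x"]] by auto
  next
    case (4 x b c f)
    then obtain n where "thunk_bound (Do c f) n" using ok by auto
    from thunk_length_Do(2)[OF this] show ?thesis using 4 a by auto
  next
    case 5
    then have "pc' = next_pc d v pc (result (next_op d v pc) (mem g))"
      using a by (cases "(e, v, k, d, pc, g)" rule: after.cases) auto
    then show ?thesis using rank_next_pc[OF 5] by simp
  qed (use a in auto)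
qed

text \<open>A lower bound on the steps that remain until the attempt starts to release its slots.\<close>
fun low :: "pc \<Rightarrow> nat" where
  "low (Pad n) = n"
| "low Fetch = 0"
| "low (Leave b rest) = 0"
| "low pc = pad_length"

lemma low_resume [simp]: "low (resume b) = pad_length"
  by (cases b) auto

lemma low_tick: "low s = pad_length \<Longrightarrow> low (tick i s) = pad_length"
  by (simp add: tick_def)

lemma low_leaving: "0 < low pc \<Longrightarrow> \<not> leaving pc"
  by (cases pc) (auto simp: leaving_def)

lemma after_low:
  assumes "0 < low pc"
  obtains pc' where "after e v k d pc g = Act k d pc'" "low pc \<le> Suc (low pc')"
proof -
  have "\<exists>pc'. after e v k d pc g = Act k d pc' \<and> low pc \<le> Suc (low pc')"
    by (cases pc rule: pc_cases) (use assms in \<open>auto simp: low_tick\<close>)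
  then show thesis using that by blast
qed

lemma post_resume [simp]: "post (resume b) \<longleftrightarrow> b = None"
  by (cases b) auto

lemma window_index_resume [simp]: "window_index (resume b) = None"
  by (cases b) auto

lemma after_post:
  assumes "post pc" "after e v k d pc g = Act k' d' pc'"
  shows "post pc'"
  by (cases pc rule: pc_cases) (use assms in \<open>auto split: if_splits\<close>)

end

context algo_env
begin

lemma after_eq:
  assumes "loc (G t) (sch t) = Act k d pc"
  shows "loc (G (Suc t)) (sch t) = after e (u (sch t, k)) k d pc (G t)"
  by (cases t rule: step_cases) (use assms in auto)

lemma tr_prefix: "a \<le> b \<Longrightarrow> \<exists>h. tr (G b) = tr (G a) @ h"
proof (induction b rule: dec_induct)
  case (step b)
  then show ?case using tr_Suc[of b] by auto
qed simp

lemma outcomes_prefix: "a \<le> b \<Longrightarrow> \<exists>os. outcomes q (tr (G b)) = outcomes q (tr (G a)) @ os"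
  using tr_prefix[of a b] by (auto simp: outcomes_append)

lemma Act_attempt:
  assumes "loc (G t) q = Act k d pc"
  obtains i ls where "attempt (tr (G t)) i q ls (fst d)" "num_attempts q (take i (tr (G t))) = k"
proof -
  obtain i where "open_at q d (tr (G t)) i" using hist_Act(3)[OF assms] by blast
  then obtain ls where at: "attempt (tr (G t)) i q ls (fst d)"
    and no: "\<And>j. i < j \<Longrightarrow> j < length (tr (G t)) \<Longrightarrow> fst (tr (G t) ! j) = q \<Longrightarrow> \<not> is_Invoke (snd (tr (G t) ! j))"
    unfolding open_at_def by blast
  have "num_attempts q (tr (G t)) = Suc (num_attempts q (take i (tr (G t))))"
    using at no by (intro num_attempts_open) (auto simp: attempt_def)
  then show thesis using that[OF at] hist_Act(2)[OF assms] by simp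
qed

lemma Act_unique2:
  assumes "loc (G t) q = Act k d pc" "loc (G t') q' = Act k' d' pc'" "fst d = fst d'"
  shows "q = q'" "k = k'" "d = d'"
proof -
  obtain i ls where i: "attempt (tr (G t)) i q ls (fst d)" "num_attempts q (take i (tr (G t))) = k"
    using Act_attempt[OF assms(1)] .
  obtain j ls' where j: "attempt (tr (G t')) j q' ls' (fst d')" "num_attempts q' (take j (tr (G t'))) = k'"
    using Act_attempt[OF assms(2)] .
  let ?m = "max t t'"
  obtain h h' where h: "tr (G ?m) = tr (G t) @ h" "tr (G ?m) = tr (G t') @ h'"
    using tr_prefix[of t ?m] tr_prefix[of t' ?m] by auto
  have "i < length (tr (G t))" "j < length (tr (G t'))" using i j by (auto simp: attempt_def)
  then have t: "take i (tr (G ?m)) = take i (tr (G t))" "take j (tr (G ?m)) = take j (tr (G t'))"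
    by (simp add: h(1), simp add: h(2))
  have "attempt (tr (G ?m)) i q ls (fst d)" using i(1) by (auto simp: h(1) attempt_def nth_append)
  moreover have "attempt (tr (G ?m)) j q' ls' (fst d)"
    using j(1) assms(3) by (auto simp: h(2) attempt_def nth_append)
  ultimately have "i = j \<and> q = q' \<and> ls = ls'" by (rule attempt_unique)
  then show "q = q'" "k = k'" using i(2) j(2) t by auto
  show "d = d'" using known_unique2[OF Act_known[OF assms(1)] Act_known[OF assms(2)] assms(3)] .
qed

text \<open>Every own step lowers \<open>rank\<close>, and steps of others do not affect it. This is
  used in both directions: enough own steps force the response, and a state of high rank shows that
  few own steps have been taken.\<close>

lemma run_rank:
  assumes "loc (G a) q = Act k d pc" "a \<le> b"
  shows "(\<exists>pc'. loc (G b) q = Act k d pc' \<and> nsteps (\<lambda>r. sch r = q) a b + rank pc' \<le> rank pc) \<or>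
    k < length (outcomes q (tr (G b)))"
  using assms(2)
proof (induction b rule: dec_induct)
  case base
  then show ?case using assms by simp
next
  case (step b)
  show ?case
  proof (cases "k < length (outcomes q (tr (G b)))")
    case True
    then show ?thesis using outcomes_prefix[of b "Suc b" q] by auto
  next
    case False
    then obtain pc' where pc': "loc (G b) q = Act k d pc'" "nsteps (\<lambda>r. sch r = q) a b + rank pc' \<le> rank pc"
      using step by blast
    show ?thesis
    proof (cases "sch b = q")
      case False
      then show ?thesis using pc' loc_other[of q b] step by (simp add: nsteps_Suc)
    next
      case True
      note aq = after_eq[of b k d pc', unfolded True, OF pc'(1)]
      show ?thesis
      proof (cases "after e (u (q, k)) k d pc' (G b)")
        case Idl
        then have "loc (G (Suc b)) q = Idl" using aq by simp
        from hist_Idl[OF this] have "num_attempts q (tr (G (Suc b))) = length (outcomes q (tr (G (Suc b))))" .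
        moreover have "num_attempts q (tr (G (Suc b))) \<ge> Suc k"
          using hist_Act(2)[OF pc'(1)] tr_Suc[of b] by (auto simp: num_attempts_append)
        ultimately show ?thesis by simp
      next
        case (Act k2 d2 pc2)
        then have "k2 = k" "d2 = d" using after_Act by blast+
        then have "rank pc2 < rank pc'"
          using after_rank[OF pc_okD[OF pc'(1)] Act] thunk_code_bound by blast
        then show ?thesis using aq Act \<open>k2 = k\<close> \<open>d2 = d\<close> pc'(2) True step by (simp add: nsteps_Suc)
      qed
    qed
  qed
qed

text \<open>An own step lowers \<open>low\<close> by at most one, and slots are released only when
  it has reached 0. So the slots of a waiting process outlive its next \<open>help_cost\<close> own
  steps, however these are scheduled.\<close>

lemma run_low:
  assumes "loc (G a) q = Act k d pc" "a \<le> b" "nsteps (\<lambda>r. sch r = q) a b < low pc"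
  shows "\<exists>pc'. loc (G b) q = Act k d pc' \<and> low pc \<le> nsteps (\<lambda>r. sch r = q) a b + low pc' \<and>
    (\<forall>s. slot (G a) s = enc d \<longrightarrow> slot (G b) s = enc d)"
  using assms(2,3)
proof (induction b rule: dec_induct)
  case base
  then show ?case using assms by simp
next
  case (step b)
  then have "nsteps (\<lambda>r. sch r = q) a b < low pc"
    using nsteps_mono[of a a b "Suc b" "\<lambda>r. sch r = q"] by simp
  then obtain pc' where pc': "loc (G b) q = Act k d pc'" "low pc \<le> nsteps (\<lambda>r. sch r = q) a b + low pc'"
    "\<And>s. slot (G a) s = enc d \<Longrightarrow> slot (G b) s = enc d"
    using step by blast
  then have pos': "0 < low pc'" using \<open>nsteps _ a b < low pc\<close> by linarith
  have keep: "slot (G a) s = enc d \<Longrightarrow> slot (G (Suc b)) s = enc d" for s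
    using slot_keep[OF pc'(3) pc'(1) low_leaving[OF pos']] .
  show ?case
  proof (cases "sch b = q")
    case False
    then show ?thesis using pc' keep loc_other[of q b] step by (simp add: nsteps_Suc)
  next
    case True
    obtain pc2 where "after e (u (q, k)) k d pc' (G b) = Act k d pc2" "low pc' \<le> Suc (low pc2)"
      using after_low[OF pos'] .
    then show ?thesis using pc' keep after_eq[of b k d pc', unfolded True, OF pc'(1)] True step
      by (simp add: nsteps_Suc)
  qed
qed

lemma contending_rank:
  assumes "contending pc"
  shows "pad_rank < rank pc"
  using assms by (cases pc) auto

text \<open>A contention starts with a rank below \<open>pad_rank + help_cost\<close>, and every
  contending state has a rank above \<open>pad_rank\<close>; the difference bounds the steps that
  the contender takes in between. There is no such bound in global time.\<close>

lemma contender_duration: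
  assumes tr: "loc (G s) (sch s) = Act k d pc" "trig (u (sch s, k)) pc"
    and h: "s < R" "hot (stat (G R) (fst d))"
  shows "nsteps (\<lambda>r. sch r = sch s) s R \<le> help_cost"
proof -
  have "after e (u (sch s, k)) k d pc (G s) = Act k d (Check d None (slots d))"
    using tr(2) by (cases pc rule: pc_cases) auto
  then have l: "loc (G (Suc s)) (sch s) = Act k d (Check d None (slots d))"
    using after_eq[OF tr(1)] by simp
  have rk: "rank (Check d None (slots d)) < pad_rank + help_cost"
    using length_slots[of d] by (simp add: help_cost_def)
  have kR: "d \<in> known (G R)" using Act_known[OF tr(1)] known_mono[of s R] h(1) by auto
  obtain q' k' pc' where o: "loc (G R) q' = Act k' d pc'" "contending pc'" using hot_owner[OF h(2) kR] .
  have eq: "q' = sch s" "k' = k" using Act_unique2[OF o(1) l] by auto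
  have "\<not> k < length (outcomes (sch s) (tr (G R)))"
    using hist_Act(1)[OF o(1)] eq by simp
  with run_rank[OF l, of R] h(1) o eq have "nsteps (\<lambda>r. sch r = sch s) (Suc s) R + rank pc' < pad_rank + help_cost"
    using rk by auto
  then have "nsteps (\<lambda>r. sch r = sch s) (Suc s) R < help_cost" using contending_rank[OF o(2)] by linarith
  then show ?thesis using h(1) by (simp add: nsteps_Suc_left)
qed

lemma window_index_le: "loc (G t) q = Act k d pc \<Longrightarrow> window_index pc = Some j \<Longrightarrow> j \<le> u (q, k)"
proof (induction t arbitrary: pc j)
  case (Suc t)
  show ?case
  proof (cases "loc (G (Suc t)) q = loc (G t) q")
    case True
    then show ?thesis using Suc.IH[of pc j] Suc.prems by metis
  next
    case False
    then have q: "q = sch t" using loc_other by blast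
    show ?thesis
    proof (cases t rule: step_cases)
      case (act k0 d0 pc0)
      then have a: "after e (u (q, k0)) k0 d0 pc0 (G t) = Act k d pc" using Suc.prems q by simp
      then have "k = k0" "d = d0" using after_Act by blast+
      then show ?thesis using Suc.IH[of pc0] act(1) a Suc.prems(2) q
        by (cases pc0 rule: pc_cases) (auto simp: tick_def le_neq_implies_less Suc_leI split: if_splits)
    qed (use Suc.prems q False in auto)
  qed
qed simp

text \<open>Includes an index reached while pausing: it loses the attempt, and its conditional
  probability obeys the same bound as that of a contention.\<close>

definition hit :: "nat \<Rightarrow> proc \<Rightarrow> nat \<Rightarrow> bool" where
  "hit t q k \<longleftrightarrow> sch t = q \<and> (\<exists>d pc. loc (G t) q = Act k d pc \<and> window_index pc = Some (u (q, k)))"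

text \<open>The wait can end without a hit only by exhausting the window, and then the index lies
  outside.\<close>

lemma post_hit: "loc (G t) q = Act k d pc \<Longrightarrow> post pc \<Longrightarrow> u (q, k) < window \<Longrightarrow> \<exists>s<t. hit s q k"
proof (induction t arbitrary: pc)
  case (Suc t)
  show ?case
  proof (cases "loc (G (Suc t)) q = loc (G t) q")
    case True
    then show ?thesis using Suc by (metis less_SucI)
  next
    case False
    then have q: "q = sch t" using loc_other by blast
    show ?thesis
    proof (cases t rule: step_cases)
      case (act k0 d0 pc0)
      then have a: "after e (u (q, k0)) k0 d0 pc0 (G t) = Act k d pc" using Suc.prems q by simp
      then have eq: "k = k0" "d = d0" using after_Act by blast+
      show ?thesis
      proof (cases "window_index pc0 = Some (u (q, k))")
        case True
        then have "hit t q k" using act(1) eq q unfolding hit_def by blast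
        then show ?thesis by blast
      next
        case nw: False
        have "window_index pc0 = Some i \<Longrightarrow> Suc i < window" for i
          using window_index_le[of t q k d pc0] act(1) eq q nw Suc.prems(3) by fastforce
        then have "post pc0" using a Suc.prems(2) nw q eq
          by (cases pc0 rule: pc_cases) (auto simp: tick_def split: if_splits)
        then show ?thesis using Suc.IH[of pc0] act(1) eq q Suc.prems(3) by (metis less_SucI)
      qed
    qed (use Suc.prems q False in auto)
  qed
qed simp

end

section \<open>Meeting a contender before and during the wait\<close>

context algo
begin

text \<open>A process that is idle or in these states will meet the contender \<open>z\<close> before it starts to wait.\<close>
fun facing :: "state \<Rightarrow> desc \<Rightarrow> pc \<Rightarrow> bool" where
  "facing g z (Enter ls j) \<longleftrightarrow> True"
| "facing g z (Look rest) \<longleftrightarrow> (\<exists>s\<in>set rest. slot g s = enc z)"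
| "facing g z (LookAt y rest) \<longleftrightarrow> y = z \<or> (\<exists>s\<in>set rest. slot g s = enc z)"
| "facing g z (Check x (Some rest) ls) \<longleftrightarrow> x = z \<or> (\<exists>s\<in>set rest. slot g s = enc z)"
| "facing g z (CheckAt x (Some rest) y ls) \<longleftrightarrow> x = z \<or> (\<exists>s\<in>set rest. slot g s = enc z)"
| "facing g z (Decide x (Some rest) w) \<longleftrightarrow> x = z \<or> (\<exists>s\<in>set rest. slot g s = enc z)"
| "facing g z (Inspect x (Some rest)) \<longleftrightarrow> x = z \<or> (\<exists>s\<in>set rest. slot g s = enc z)"
| "facing g z (Launch x (Some rest)) \<longleftrightarrow> x = z \<or> (\<exists>s\<in>set rest. slot g s = enc z)"
| "facing g z (Inside x (Some rest) c) \<longleftrightarrow> x = z \<or> (\<exists>s\<in>set rest. slot g s = enc z)"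
| "facing g z (Close x (Some rest)) \<longleftrightarrow> x = z \<or> (\<exists>s\<in>set rest. slot g s = enc z)"
| "facing g z _ \<longleftrightarrow> False"

lemma facing_not_waiting: "facing g z pc \<Longrightarrow> window_index pc = None"
  by (cases pc) auto

lemma facing_mono:
  assumes "\<And>s. slot g s = enc z \<Longrightarrow> slot g' s = enc z" "facing g z pc"
  shows "facing g' z pc"
  using assms(2) by (cases "(g, z, pc)" rule: facing.cases) (use assms(1) in auto)

text \<open>A process that helps \<open>z\<close> cannot put \<open>z\<close> behind itself while
  \<open>z\<close> remains hot: by \<open>st_ok\<close>, \<open>Inspect\<close> finds 2 and not 1
  and so leads to the thunk, and \<open>Close\<close> would make the status 4. In all other states
  \<open>z\<close> is still ahead in the list.\<close>

lemma after_facing: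
  assumes f: "facing g z pc" and st: "st_ok g d pc"
    and h: "hot (stat g (fst z))" "hot (stat (pc_step e v q k d pc g) (fst z))"
    and ne: "z \<noteq> d" and sl: "\<exists>s\<in>set (slots d). slot g s = enc z"
    and a: "after e v k d pc g = Act k' d' pc'"
  shows "facing g z pc'"
proof -
  have 1: "\<not> (stat g (fst z) \<noteq> 1 \<and> stat g (fst z) \<noteq> 2)" using h(1) by (auto simp: hot_def)
  show ?thesis
  proof (cases pc rule: pc_cases)
    case (14 x b)
    show ?thesis
    proof (cases b)
      case (Some rest)
      have "x \<noteq> z" using h(2) st 14 1 by (auto simp: stat_pc_step won_def split: if_splits)
      then show ?thesis using f a 14 Some by auto
    qed (use f 14 in auto)
  next
    case (10 x b)
    then show ?thesis using f a st 1 by (cases b) (auto split: if_splits)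
  next
    case (6 x b)
    then show ?thesis using f a by (cases b) auto
  next
    case (7 x b)
    then show ?thesis using f a by (cases b) (auto split: if_splits)
  next
    case (8 x b)
    then show ?thesis using f a by (cases b) (auto split: if_splits)
  next
    case (9 x b)
    then show ?thesis using f a by (cases b) (auto split: if_splits)
  next
    case (11 x b)
    then show ?thesis using f a by (cases b) (auto split: if_splits)
  next
    case (12 x b)
    then show ?thesis using f a by (cases b) (auto split: if_splits)
  next
    case (13 x b)
    then show ?thesis using f a by (cases b) (auto split: if_splits)
  qed (use f a sl ne h(1) in \<open>auto split: if_splits\<close>)
qed

text \<open>Two reads per slot, for the rest of the current round and for one complete further
  round, plus the wrap-around step and one pending \<open>WaitAt\<close>.\<close>

definition scan_cost :: nat where "scan_cost = 4 * (\<kappa> * L) + 2"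

text \<open>The number of steady steps before a waiting process with descriptor \<open>d\<close> has read the status
  of the contender \<open>z\<close>.\<close>
fun dist_to :: "state \<Rightarrow> desc \<Rightarrow> desc \<Rightarrow> pc \<Rightarrow> nat" where
  "dist_to g z d (Wait i rest) =
     (if \<exists>s\<in>set rest. slot g s = enc z then 2 * length rest else 2 * length rest + 1 + 2 * length (slots d))"
| "dist_to g z d (WaitAt i y rest) =
     (if y = z \<or> (\<exists>s\<in>set rest. slot g s = enc z) then 2 * length rest + 1
      else 2 * length rest + 2 + 2 * length (slots d))"
| "dist_to g z d (Stuck i y rest) =
     (if \<exists>s\<in>set rest. slot g s = enc z then 2 * length rest else 2 * length rest + 1 + 2 * length (slots d))"
| "dist_to g z d _ = scan_cost"

lemma dist_to_le:
  assumes "pc_ok K d pc"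
  shows "dist_to g z d pc \<le> scan_cost"
  using assms length_slots[of d] by (cases pc) (auto simp: scan_cost_def)

lemma dist_to_mono:
  assumes "\<And>s. slot g s = enc z \<Longrightarrow> slot g' s = enc z" "pc_ok K d pc"
  shows "dist_to g' z d pc \<le> dist_to g z d pc"
  using assms length_slots[of d] by (cases pc) (auto simp: scan_cost_def)

definition stuck_on :: "desc \<Rightarrow> pc \<Rightarrow> bool" where
  "stuck_on z pc \<longleftrightarrow> (\<exists>i rest. pc = Stuck i z rest)"

lemma stuck_on_simps [simp]:
  "stuck_on z (Stuck i y rest) \<longleftrightarrow> y = z" "\<not> stuck_on z (Wait i rest)" "\<not> stuck_on z (WaitAt i y rest)"
  "\<not> stuck_on z (Look rest)" "\<not> stuck_on z (Pad n)"
  by (auto simp: stuck_on_def)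

text \<open>A steady step brings the scan one read closer to the status of \<open>z\<close>, and the
  wrap-around reloads a list that contains a slot of \<open>z\<close>. Pausing on another attempt
  leaves the distance as it is. Only ending the wait or pausing on \<open>z\<close> itself breaks
  the count.\<close>

lemma after_dist:
  assumes h: "hot (stat g (fst z))" and ne: "z \<noteq> d" and sl: "\<exists>s\<in>set (slots d). slot g s = enc z"
    and ok: "pc_ok K d pc"
    and a: "after e v k d pc g = Act k' d' pc'"
    and np: "\<not> post pc'" and ns: "\<not> stuck_on z pc'" and nst: "\<not> stuck_on z pc"
    and w: "window_index pc \<noteq> None"
  shows "dist_to g z d pc' + (if steady pc then 1 else 0) \<le> dist_to g z d pc"
  using w a ok np ns nst sl ne h
  by (cases pc rule: pc_cases) (auto simp: tick_def split: if_splits)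

lemma after_stuck:
  assumes h: "hot (stat g (fst z))" and a: "after e v k d pc g = Act k' d' pc'"
    and s: "stuck_on z pc" and np: "\<not> post pc'"
  shows "stuck_on z pc'"
  using s a np h by (auto simp: stuck_on_def tick_def split: if_splits)

lemma after_nonwaiting:
  assumes "window_index pc = None" "after e v k d pc g = Act k' d' pc'" "\<not> post pc'"
  shows "dist_to g z d pc' \<le> scan_cost \<and> \<not> steady pc"
proof -
  have "dist_to g z d (resume b) \<le> scan_cost" for b by (cases b) (auto simp: scan_cost_def)
  then show ?thesis
    using assms length_slots[of d] by (cases pc rule: pc_cases) (auto simp: scan_cost_def steady_def split: if_splits)
qed

end

context algo_env
begin

definition faced :: "nat \<Rightarrow> proc \<Rightarrow> desc \<Rightarrow> bool" where
  "faced t q z \<longleftrightarrow> (\<forall>k d pc. loc (G t) q = Act k d pc \<longrightarrow> share d z \<longrightarrow> facing (G t) z pc)"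

lemma hot_slots:
  assumes "hot (stat (G t) (fst z))" "z \<in> known (G t)" "share d z" "d \<in> known (G t')"
  shows "\<exists>s\<in>set (slots d). slot (G t) s = enc z"
proof -
  obtain l where l: "l \<in> set (snd d)" "l \<in> set (snd z)" using assms(3) by (auto simp: share_def)
  obtain j where "slot (G t) (l, j) = enc z" "j < \<kappa>" using hot_slot[OF assms(1,2) l(2)] .
  then show ?thesis using known_slots[OF assms(4)] l(1) by blast
qed

text \<open>Idle processes are faced vacuously, and a new attempt begins in \<open>Enter\<close>,
  which faces every contender. So attempts that start during the contention of \<open>z\<close> are
  covered as well.\<close>

lemma faced_run:
  assumes z: "z \<in> known (G X)" "hot (stat (G X) (fst z))" "faced X q z"
    and t: "X \<le> t" "hot (stat (G t) (fst z))"
  shows "faced t q z"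
  using t
proof (induction t rule: dec_induct)
  case base
  show ?case by (rule z)
next
  case (step t)
  have hz: "hot (stat (G t) (fst z))"
    using hot_between[OF step(1) _ z(2) step.prems] by simp
  have kz: "z \<in> known (G t)" using z(1) known_mono[OF step(1)] by blast
  have IH: "loc (G t) q = Act k d pc \<Longrightarrow> share d z \<Longrightarrow> facing (G t) z pc" for k d pc
    using step.IH[OF hz] unfolding faced_def by blast
  have mono: "facing (G t) z pc \<Longrightarrow> facing (G (Suc t)) z pc" for pc
    using facing_mono slot_keep_hot[OF hz kz] by blast
  show ?case unfolding faced_def
  proof (intro allI impI)
    fix k d pc assume l: "loc (G (Suc t)) q = Act k d pc" and sh: "share d z"
    show "facing (G (Suc t)) z pc"
    proof (cases "q = sch t")
      case False
      then show ?thesis using l loc_other[of q t] IH sh mono by auto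
    next
      case True
      show ?thesis
      proof (cases t rule: step_cases)
        case skip
        then show ?thesis using l IH sh by auto
      next
        case (invoke ls th)
        then show ?thesis using l True by auto
      next
        case (act k0 d0 pc0)
        have a: "after e (u (sch t, k0)) k0 d0 pc0 (G t) = Act k d pc" using l act True by simp
        then have "d = d0" using after_Act by blast
        then have sh0: "share d0 z" using sh by simp
        have "facing (G t) z pc"
          using after_facing[OF IH st_okD[OF act(1)] hz _ _ hot_slots[OF hz kz sh0 Act_known[OF act(1)]] a]
            act step.prems sh0 True by (auto simp: share_def)
        then show ?thesis by (rule mono)
      qed
    qed
  qed
qed

text \<open>By \<open>faced_run\<close> the process was never idle or still facing \<open>z\<close>
  in between, so it has been on the same attempt since \<open>X\<close>. Newcomers therefore do not
  compete with \<open>z\<close>, and its competitors can be counted at time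
  \<open>X\<close>.\<close>

lemma waiting_after_contender:
  assumes z: "z \<in> known (G X)" "hot (stat (G X) (fst z))"
    and t: "X \<le> t" "hot (stat (G t) (fst z))"
    and l: "loc (G t) q = Act k d pc" "window_index pc \<noteq> None" and sh: "share d z"
  shows "\<exists>pc'. loc (G X) q = Act k d pc' \<and> \<not> facing (G X) z pc'"
proof -
  have nf: "\<not> faced t q z"
    using l sh facing_not_waiting unfolding faced_def by fastforce
  have nfr: "\<not> faced r q z" if "X \<le> r" "r \<le> t" for r
  proof
    assume f: "faced r q z"
    have "hot (stat (G r) (fst z))" using hot_between[OF that z(2) t(2)] .
    moreover have "z \<in> known (G r)" using z(1) known_mono[OF that(1)] by blast
    ultimately show False using faced_run[OF _ _ f that(2) t(2)] nf by blast
  qed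
  have "\<exists>pc'. loc (G r) q = Act k d pc'" if "X \<le> r" "r \<le> t" for r
    using that(2,1)
  proof (induction r rule: inc_induct)
    case base
    then show ?case using l by blast
  next
    case (step r)
    then obtain pc' where pc': "loc (G (Suc r)) q = Act k d pc'" by auto
    from nfr[of r] step obtain k0 d0 pc0 where 0: "loc (G r) q = Act k0 d0 pc0"
      unfolding faced_def by auto
    show ?case
    proof (cases "q = sch r")
      case False
      then show ?thesis using loc_other[of q r] pc' by metis
    next
      case True
      then show ?thesis using after_eq[of r k0 d0 pc0] 0 pc' after_Act by metis
    qed
  qed
  then obtain pc' where "loc (G X) q = Act k d pc'" using t(1) by blast
  moreover have "\<not> facing (G X) z pc'"
    using nfr[of X] t(1) calculation unfolding faced_def by auto
  ultimately show ?thesis by blast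
qed

definition steady_at :: "proc \<Rightarrow> nat \<Rightarrow> bool" where
  "steady_at q r \<longleftrightarrow> sch r = q \<and> (\<exists>k d pc. loc (G r) q = Act k d pc \<and> steady pc)"

text \<open>Steady steps are counted instead of all steps, because at \<open>X\<close> the process
  may still be busy helping others for a long time; steps of that kind cannot start a
  contention.\<close>

lemma steady_steps:
  assumes z: "z \<in> known (G X)" "hot (stat (G X) (fst z))"
    and t: "X \<le> t" "hot (stat (G t) (fst z))"
    and l: "loc (G X) q = Act k d pc0" "loc (G t) q = Act k d pc" and sh: "share d z"
  shows "post pc \<or> stuck_on z pc \<or> nsteps (steady_at q) X t + dist_to (G t) z d pc \<le> scan_cost"
  using t l(2)
proof (induction t arbitrary: pc rule: dec_induct)
  case base
  then show ?case using l(1) dist_to_le[OF pc_okD[OF l(1)]] by simp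
next
  case (step t)
  have hz: "hot (stat (G t) (fst z))"
    using hot_between[OF step(1) _ z(2) step.prems(1)] by simp
  have kz: "z \<in> known (G t)" using z(1) known_mono[OF step(1)] by blast
  have keep: "slot (G t) s = enc z \<Longrightarrow> slot (G (Suc t)) s = enc z" for s
    by (rule slot_keep_hot[OF hz kz])
  have nd: "z \<noteq> d" using sh by (auto simp: share_def)
  show ?case
  proof (cases "q = sch t")
    case False
    then have l0: "loc (G t) q = Act k d pc" using loc_other[of q t] step.prems by simp
    have "dist_to (G (Suc t)) z d pc \<le> dist_to (G t) z d pc"
      using dist_to_mono[OF keep pc_okD[OF l0]] by blast
    moreover have "\<not> steady_at q t" using False by (auto simp: steady_at_def)
    ultimately show ?thesis using step.IH[OF hz l0] step(1) by (auto simp: nsteps_Suc)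
  next
    case True
    obtain pc1 where l1: "loc (G t) q = Act k d pc1"
      using run_rank[OF l(1) step(1)] run_rank[OF l(1), of "Suc t"] outcomes_prefix[of t "Suc t" q]
        hist_Act(1)[OF step.prems(2)] step(1) by fastforce
    have a: "after e (u (q, k)) k d pc1 (G t) = Act k d pc"
      using after_eq[of t k d pc1] l1 step.prems(2) True by simp
    note IH = step.IH[OF hz l1]
    show ?thesis
    proof (cases "post pc \<or> stuck_on z pc")
      case False
      then have np: "\<not> post pc" and ns: "\<not> stuck_on z pc" by auto
      have "\<not> post pc1" using after_post[OF _ a] np by blast
      moreover have "\<not> stuck_on z pc1" using after_stuck[OF hz a _ np] ns by blast
      ultimately have c: "nsteps (steady_at q) X t + dist_to (G t) z d pc1 \<le> scan_cost" using IH by blast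
      have m: "dist_to (G (Suc t)) z d pc \<le> dist_to (G t) z d pc"
        using dist_to_mono[OF keep pc_okD[OF step.prems(2)]] by blast
      have sa: "steady_at q t \<longleftrightarrow> steady pc1" using l1 True by (auto simp: steady_at_def)
      show ?thesis
      proof (cases "window_index pc1 = None")
        case False
        from after_dist[OF hz nd hot_slots[OF hz kz sh Act_known[OF l1]] pc_okD[OF l1] a np ns \<open>\<not> stuck_on z pc1\<close> False]
        show ?thesis using c m sa step(1) by (auto simp: nsteps_Suc split: if_splits)
      next
        case nw: True
        \<comment> \<open>Outside the window \<open>dist_to\<close> equals the whole budget
          \<open>scan_cost\<close>, so no steady step can have been counted yet.\<close>
        have "nsteps (steady_at q) X t = 0"
          using c nw \<open>\<not> post pc1\<close> by (cases pc1) auto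
        then show ?thesis using after_nonwaiting[OF nw a np, of z] m sa step(1)
          by (auto simp: nsteps_Suc)
      qed
    qed auto
  qed
qed

section \<open>The step bound\<close>

lemma open_last:
  assumes "open_at q d (tr (G t)) i" "attempt (tr (G t)) i' q ls th"
    "\<And>j. i' < j \<Longrightarrow> j < length (tr (G t)) \<Longrightarrow> fst (tr (G t) ! j) = q \<Longrightarrow> \<not> is_Invoke (snd (tr (G t) ! j))"
  shows "i' = i"
proof (rule ccontr)
  obtain ls where at: "attempt (tr (G t)) i q ls (fst d)" using assms(1) unfolding open_at_def by blast
  assume "i' \<noteq> i"
  then consider "i < i'" | "i' < i" by linarith
  then show False
  proof cases
    case 1
    then show ?thesis using assms(1,2) unfolding open_at_def attempt_def by fastforce
  next
    case 2
    then show ?thesis using assms(3)[of i] at by (auto simp: attempt_def)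
  qed
qed

text \<open>The second conjunct is the potential argument for a pending attempt; the first one
  preserves its result after the response.\<close>

lemma own_steps_bound:
  "(\<forall>i q ls th. attempt (tr (G t)) i q ls th \<longrightarrow> card (own_steps (tr (G t)) i) \<le> bound) \<and>
   (\<forall>q k d pc i. loc (G t) q = Act k d pc \<longrightarrow> open_at q d (tr (G t)) i \<longrightarrow>
      card (own_steps (tr (G t)) i) + rank pc \<le> bound)"
proof (induction t)
  case 0
  show ?case by (simp add: attempt_def)
next
  case (Suc t)
  have IH1: "attempt (tr (G t)) i q ls th \<Longrightarrow> card (own_steps (tr (G t)) i) \<le> bound"
    and IH2: "loc (G t) q = Act k d pc \<Longrightarrow> open_at q d (tr (G t)) i \<Longrightarrow>
      card (own_steps (tr (G t)) i) + rank pc \<le> bound" for i q ls th k d pc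
    using Suc by blast+
  have len: "attempt (tr (G t)) i q ls th \<Longrightarrow> i < length (tr (G t))" for i q ls th
    by (simp add: attempt_def)
  show ?case
  proof (cases t rule: step_cases)
    case skip
    then show ?thesis using Suc by simp
  next
    case (invoke ls th)
    let ?h = "tr (G t)"
    have tr': "tr (G (Suc t)) = ?h @ [(sch t, Invoke ls th)]" using invoke by simp
    have old: "own_steps (tr (G (Suc t))) i = own_steps ?h i" if "i < length ?h" for i
      unfolding tr' own_steps_snoc[OF that] by simp
    have new: "own_steps (tr (G (Suc t))) (length ?h) = {length ?h}"
      unfolding tr' by (rule own_steps_last)
    have 1: "card (own_steps (tr (G (Suc t))) i) \<le> bound" if "attempt (tr (G (Suc t))) i q ls th" for i q ls th
    proof (cases "i = length ?h")
      case True
      then show ?thesis using new by (simp add: bound_def)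
    next
      case False
      then have "attempt ?h i q ls th" using that unfolding tr' attempt_append by blast
      then show ?thesis using IH1 old len by metis
    qed
    have 2: "card (own_steps (tr (G (Suc t))) i) + rank pc \<le> bound"
      if l: "loc (G (Suc t)) q = Act k d pc" and op: "open_at q d (tr (G (Suc t))) i" for q k d pc i
    proof (cases "q = sch t")
      case True
      obtain ls' where at: "attempt (tr (G (Suc t))) i q ls' (fst d)" using op unfolding open_at_def by blast
      have "i = length ?h"
      proof (rule ccontr)
        assume "i \<noteq> length ?h"
        then have "i < length ?h" using at by (auto simp: tr' attempt_def)
        then show False using op True unfolding open_at_def tr' by (auto dest!: spec[of _ "length ?h"])
      qed
      then show ?thesis using new l invoke True rank_start[of "sorted_list_of_fset ls"] by auto
    next
      case False
      then have op': "open_at q d ?h i"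
        using op unfolding open_at_def tr' attempt_append by (auto simp: nth_append attempt_def split: if_splits)
      then have "i < length ?h" using len unfolding open_at_def by blast
      then show ?thesis using IH2[OF _ op', of k pc] l invoke False old by auto
    qed
    show ?thesis using 1 2 by blast
  next
    case (act k d pc)
    let ?h = "tr (G t)" and ?s = "label e (u (sch t, k)) d pc (G t)"
    have tr': "tr (G (Suc t)) = ?h @ [(sch t, ?s)]" using act by simp
    have at_old: "attempt (tr (G (Suc t))) i q ls th \<longleftrightarrow> attempt ?h i q ls th" for i q ls th
      unfolding tr' attempt_append using label_not_Invoke(2) by auto
    obtain i0 where op0: "open_at (sch t) d ?h i0" using hist_Act(3)[OF act(1)] by blast
    then obtain ls0 where at0: "attempt ?h i0 (sch t) ls0 (fst d)" unfolding open_at_def by blast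
    have other: "own_steps (tr (G (Suc t))) i = own_steps ?h i" if "attempt ?h i q ls th" "i \<noteq> i0" for i q ls th
    proof -
      have "\<not> (sch t = fst (?h ! i) \<and>
        (\<forall>j. i < j \<and> j < length ?h \<and> fst (?h ! j) = sch t \<longrightarrow> \<not> is_Invoke (snd (?h ! j))))"
        using open_last[OF op0, of i ls th] that by (auto simp: attempt_def)
      then show ?thesis unfolding tr' own_steps_snoc[OF len[OF that(1)]] by auto
    qed
    have grow: "card (own_steps (tr (G (Suc t))) i0) \<le> Suc (card (own_steps ?h i0))"
      unfolding tr' own_steps_snoc[OF len[OF at0]] using finite_own_steps[of ?h i0]
      by (auto simp: card_insert_if)
    have r0: "card (own_steps ?h i0) + rank pc \<le> bound" by (rule IH2[OF act(1) op0])
    have rp: "0 < rank pc"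
    proof (cases "after e (u (sch t, k)) k d pc (G t)")
      case Idl
      then show ?thesis by (auto simp: after_Idl)
    next
      case (Act k' d' pc')
      from after_rank[OF pc_okD[OF act(1)] Act thunk_code_bound] show ?thesis by linarith
    qed
    have 1: "card (own_steps (tr (G (Suc t))) i) \<le> bound" if "attempt (tr (G (Suc t))) i q ls th" for i q ls th
    proof (cases "i = i0")
      case True
      then show ?thesis using grow r0 rp by simp
    next
      case False
      then show ?thesis using that other IH1 at_old by metis
    qed
    have 2: "card (own_steps (tr (G (Suc t))) i) + rank pc' \<le> bound"
      if l: "loc (G (Suc t)) q = Act k' d' pc'" and op: "open_at q d' (tr (G (Suc t))) i" for q k' d' pc' i
    proof (cases "q = sch t")
      case True
      then have a: "after e (u (sch t, k)) k d pc (G t) = Act k' d' pc'" using l act by simp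
      then have "d' = d" using after_Act by blast
      then obtain ls' where "attempt ?h i (sch t) ls' (fst d)"
        using op True at_old unfolding open_at_def by blast
      then have "i = i0" using attempt_unique at0 by blast
      then show ?thesis using grow r0 after_rank[OF pc_okD[OF act(1)] a thunk_code_bound] by simp
    next
      case False
      then have l0: "loc (G t) q = Act k' d' pc'" using l act by simp
      have op': "open_at q d' ?h i"
        using op False unfolding open_at_def at_old by (auto simp: tr' nth_append split: if_splits)
      then obtain ls' where at: "attempt ?h i q ls' (fst d')" unfolding open_at_def by blast
      have "i \<noteq> i0" using at at0 False by (auto simp: attempt_def)
      then show ?thesis using other[OF at] IH2[OF l0 op'] by simp
    qed
    show ?thesis using 1 2 by blast
  qed
qed

theorem step_bound_tr: "step_bound bound (tr (G t))"
  using own_steps_bound[of t] unfolding step_bound_def by blast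

end

section \<open>Losing requires two random events\<close>

context algo_env
begin

text \<open>At time \<open>t\<close> the status of \<open>y\<close> may already be final. What is
  certain is that it was hot when the process last read it, at its previous step.\<close>

lemma stuck_prev:
  "loc (G t) q = Act k d (Stuck i y rest) \<Longrightarrow>
     \<exists>r<t. sch r = q \<and> nsteps (\<lambda>r. sch r = q) (Suc r) t = 0 \<and> hot (stat (G r) (fst y)) \<and>
       y \<in> known (G r) \<and> share d y \<and> (\<exists>pc. loc (G r) q = Act k d pc \<and> window_index pc \<noteq> None)"
proof (induction t arbitrary: i y rest)
  case (Suc t)
  show ?case
  proof (cases "q = sch t")
    case False
    then have "loc (G t) q = Act k d (Stuck i y rest)" using Suc.prems loc_other[of q t] by simp
    from Suc.IH[OF this] obtain r where r: "r < t" "nsteps (\<lambda>r. sch r = q) (Suc r) t = 0"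
      and r': "sch r = q" "hot (stat (G r) (fst y))" "y \<in> known (G r)" "share d y"
        "\<exists>pc. loc (G r) q = Act k d pc \<and> window_index pc \<noteq> None" by blast
    have "nsteps (\<lambda>r. sch r = q) (Suc r) (Suc t) = 0" using r False by (simp add: nsteps_Suc)
    with r' less_SucI[OF r(1)] show ?thesis by blast
  next
    case True
    show ?thesis
    proof (cases t rule: step_cases)
      case (act k0 d0 pc0)
      then have a: "after e (u (q, k0)) k0 d0 pc0 (G t) = Act k d (Stuck i y rest)"
        using Suc.prems True by simp
      then have eq: "k0 = k" "d0 = d" using after_Act by blast+
      have nr: "resume b \<noteq> Stuck i y rest" for b by (cases b) auto
      have "window_index pc0 \<noteq> None \<and> (\<exists>i rest. pc0 = WaitAt i y rest \<or> pc0 = Stuck i y rest) \<and> hot (stat (G t) (fst y))"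
        using a nr by (cases pc0 rule: pc_cases) (auto simp: tick_def split: if_splits)
      then show ?thesis using act(1) pc_okD[OF act(1)] eq True by (intro exI[of _ t]) auto
    qed (use Suc.prems True in auto)
  qed
qed simp

text \<open>A helper of \<open>x\<close> votes for losing only after having seen this configuration.\<close>
definition collide :: "nat \<Rightarrow> desc \<Rightarrow> bool" where
  "collide v x \<longleftrightarrow> stat (G v) (fst x) = 1 \<and> (\<exists>y\<in>known (G v). share x y \<and> hot (stat (G v) (fst y)))"

lemma stat_1_back: "stat (G (Suc t)) th = 1 \<Longrightarrow> stat (G t) th \<noteq> 0 \<Longrightarrow> stat (G t) th = 1"
  by (cases rule: stat_step[of t th]) auto

lemma decide_collide:
  "loc (G t) q = Act k d (Decide x b 3) \<Longrightarrow> stat (G t) (fst x) = 1 \<Longrightarrow> \<exists>v<t. collide v x"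
proof (induction t)
  case (Suc t)
  show ?case
  proof (cases "loc (G (Suc t)) q = loc (G t) q")
    case True
    then have l: "loc (G t) q = Act k d (Decide x b 3)" using Suc.prems by simp
    have "stat (G t) (fst x) = 1"
      using stat_1_back[OF Suc.prems(2)] st_okD[OF l] by (simp add: helping_def)
    then show ?thesis using Suc.IH[OF l] less_SucI by blast
  next
    case False
    then have q: "q = sch t" using loc_other by blast
    show ?thesis
    proof (cases t rule: step_cases)
      case (act k0 d0 pc0)
      then have a: "after e (u (q, k0)) k0 d0 pc0 (G t) = Act k d (Decide x b 3)"
        using Suc.prems q by simp
      have nr: "resume c \<noteq> Decide x b 3" for c by (cases c) auto
      obtain y rest where pc0: "pc0 = CheckAt x b y rest" "hot (stat (G t) (fst y))"
        using a nr by (cases pc0 rule: pc_cases) (auto simp: tick_def split: if_splits)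
      then have "stat (G t) (fst x) = 1"
        using stat_1_back[OF Suc.prems(2)] st_okD[OF act(1)] by (simp add: helping_def)
      then have "collide t x" using pc0 pc_okD[OF act(1)] unfolding collide_def by auto
      then show ?thesis by blast
    qed (use Suc.prems q False in auto)
  qed
qed simp

lemma lost_collide:
  assumes "x \<in> known (G t')"
  shows "stat (G t) (fst x) = 3 \<Longrightarrow> \<exists>v<t. collide v x"
proof (induction t)
  case (Suc t)
  show ?case
  proof (cases rule: stat_step[of t "fst x"])
    case same
    then show ?thesis using Suc less_SucI by metis
  next
    case (decide k d x' b w)
    have "x' \<in> known (G t)" using pc_okD[OF decide(1)] by (simp add: help_ok_def)
    then have "x' = x" using known_unique2[OF _ assms] decide(2) by blast
    moreover have "w = 3" using decide(5) Suc.prems by simp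
    ultimately show ?thesis using decide_collide decide(1,4) less_SucI by blast
  qed (use Suc.prems in auto)
qed simp

text \<open>A function of the fixed schedule alone. So the second case of \<open>lose_pair\<close>
  refers to a time that is known as soon as \<open>t\<close> is, and a sum over \<open>t\<close>
  suffices to cover it.\<close>

definition previous_step :: "proc \<Rightarrow> nat \<Rightarrow> nat" where
  "previous_step q t = Max {r. r < t \<and> sch r = q}"

lemma previous_step_eq:
  assumes "r < t" "sch r = q" "nsteps (\<lambda>r. sch r = q) (Suc r) t = 0"
  shows "previous_step q t = r"
  unfolding previous_step_def
proof (rule Max_eqI)
  have "{r'. Suc r \<le> r' \<and> r' < t \<and> sch r' = q} = {}"
    using assms(3) finite_nsteps[of "Suc r" t "\<lambda>r. sch r = q"] unfolding nsteps_def by simp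
  then show "y \<le> r" if "y \<in> {r. r < t \<and> sch r = q}" for y
    using that not_less_eq_eq by fastforce
qed (use assms in auto)

definition triggers :: "nat \<Rightarrow> proc \<Rightarrow> nat \<Rightarrow> bool" where
  "triggers s q k \<longleftrightarrow> sch s = q \<and> (\<exists>d pc. loc (G s) q = Act k d pc \<and> trig (u (q, k)) pc)"

definition trigger_step :: "nat \<Rightarrow> bool" where
  "trigger_step s \<longleftrightarrow> (\<exists>k. triggers s (sch s) k)"

text \<open>The two ways in which a competitor can be near the contention of \<open>d0\<close>. The conditions depend on the
  past of \<open>s\<close> only, and not on whether the competitor contends at \<open>s\<close>; counting the steps that satisfy
  them therefore bounds the number of random events involved.\<close>
definition before :: "desc \<Rightarrow> nat \<Rightarrow> nat \<Rightarrow> bool" where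
  "before d0 R s \<longleftrightarrow> s < R \<and> nsteps (\<lambda>r. sch r = sch s) s R \<le> help_cost \<and>
     (\<exists>k d pc. loc (G s) (sch s) = Act k d pc \<and> window_index pc \<noteq> None \<and>
       (\<exists>s'\<in>set (slots d0). slot (G s) s' = enc d))"

definition behind :: "desc \<Rightarrow> nat \<Rightarrow> nat \<Rightarrow> bool" where
  "behind d0 X s \<longleftrightarrow> X < s \<and> nsteps (steady_at (sch s)) (Suc X) s \<le> scan_cost \<and>
     (\<exists>k d pc. loc (G s) (sch s) = Act k d pc \<and> steady pc \<and>
       (\<exists>s'\<in>set (slots d0). slot (G (Suc X)) s' = enc d))"

text \<open>At its start the process is idle and so faces every contender; one that stayed hot would
  not let it begin to wait. Hence a contender met during the wait began after the attempt
  did.\<close>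

lemma not_faced_start:
  assumes "loc (G t0) p = Idl" "t0 \<le> R" "loc (G R) p = Act m d0 pc" "window_index pc \<noteq> None"
    and y: "y \<in> known (G R)" "share d0 y" "hot (stat (G R) (fst y))"
  shows "\<not> hot (stat (G t0) (fst y))"
proof
  assume h: "hot (stat (G t0) (fst y))"
  then obtain q k d pc' where "loc (G t0) q = Act k d pc'" "fst d = fst y" using hot_contending by blast
  then have "y \<in> known (G t0)" using Act_known known_unique2[OF _ y(1)] by metis
  from waiting_after_contender[OF this h assms(2) y(3) assms(3,4) y(2)] assms(1) show False by simp
qed

lemma trig_window_index:
  assumes "loc (G s) (sch s) = Act k d pc" "trig (u (sch s, k)) pc"
  shows "window_index pc = Some (u (sch s, k))" "steady pc" "trigger_step s"
proof -
  show "window_index pc = Some (u (sch s, k))" "steady pc" using assms(2) by (auto simp: trig_def)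
  show "trigger_step s" using assms unfolding trigger_step_def triggers_def by blast
qed

text \<open>\<open>not_faced_start\<close> puts the beginning of the contention of \<open>y\<close>
  after \<open>t0\<close>, and \<open>contender_duration\<close> puts it at most
  \<open>help_cost\<close> steps of that process before \<open>R\<close>.\<close>

lemma before_intro:
  assumes p: "loc (G t0) p = Idl" "t0 < R" "loc (G R) p = Act m d0 pc" "window_index pc \<noteq> None" "sch t0 = p"
    and y: "y \<in> known (G R)" "share d0 y" "hot (stat (G R) (fst y))"
  shows "\<exists>s. t0 < s \<and> s < R \<and> sch s \<noteq> p \<and> trigger_step s \<and> before d0 R s"
proof -
  obtain s k d pc' where s: "s < R" "loc (G s) (sch s) = Act k d pc'" "trig (u (sch s, k)) pc'" "fst d = fst y"
    "stat (G (Suc s)) (fst y) = 1" using first_hot[OF y(3)] by metis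
  have dy: "d = y" using known_unique2[OF Act_known[OF s(2)] y(1) s(4)] .
  have "\<not> hot (stat (G t0) (fst y))" using not_faced_start[OF p(1) _ p(3,4) y] p(2) by simp
  have "t0 < s"
  proof (rule ccontr)
    assume "\<not> t0 < s"
    then consider "Suc s \<le> t0" | "s = t0" by linarith
    then show False
    proof cases
      case 1
      then have "hot (stat (G t0) (fst y))"
        using hot_between[of "Suc s" t0 R "fst y"] p(2) y(3) s(5) by simp
      with \<open>\<not> hot (stat (G t0) (fst y))\<close> show False ..
    qed (use s p in auto)
  qed
  moreover have "sch s \<noteq> p"
  proof
    assume "sch s = p"
    obtain q' k' pc2 where o: "loc (G R) q' = Act k' y pc2" using hot_owner[OF y(3,1)] by metis
    then have "q' = p" using Act_unique2[OF o s(2)] dy \<open>sch s = p\<close> by simp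
    then show False using o p(3) y(2) by (simp add: share_def)
  qed
  moreover have "before d0 R s" unfolding before_def
  proof (intro conjI)
    show "nsteps (\<lambda>r. sch r = sch s) s R \<le> help_cost"
      using contender_duration[OF s(2,3,1)] y(3) s(4) by simp
    obtain l where l: "l \<in> set (snd d0)" "l \<in> set (snd y)" using y(2) by (auto simp: share_def)
    have "\<not> leaving pc'" "entering pc' = {}" using s(3) by (auto simp: trig_def leaving_def entering_def)
    then obtain j where "slot (G s) (l, j) = enc d" "j < \<kappa>" using holds[OF s(2)] l(2) dy by blast
    then have "\<exists>s'\<in>set (slots d0). slot (G s) s' = enc d"
      using known_slots[OF Act_known[OF p(3)]] l(1) by blast
    then show "\<exists>k d pc. loc (G s) (sch s) = Act k d pc \<and> window_index pc \<noteq> None \<and>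
       (\<exists>s'\<in>set (slots d0). slot (G s) s' = enc d)"
      using s(2) trig_window_index(1)[OF s(2,3)] by blast
  qed (rule s)
  ultimately show ?thesis using s(1) trig_window_index(3)[OF s(2,3)] by blast
qed

text \<open>As \<open>y\<close> starts while \<open>d0\<close> contends, its process was already on
  this attempt at \<open>Suc X\<close> (\<open>waiting_after_contender\<close>). So it occupied a
  slot at that time, and \<open>steady_steps\<close> bounds its steady steps until
  \<open>s\<close>.\<close>

lemma behind_intro:
  assumes p: "loc (G X) p = Act m d0 pc" "stat (G (Suc X)) (fst d0) = 1"
    and v: "X < v" "stat (G v) (fst d0) = 1" "y \<in> known (G v)" "share d0 y" "hot (stat (G v) (fst y))"
    and ny: "\<not> hot (stat (G X) (fst y))" and pX: "sch X = p"
  shows "\<exists>s. X < s \<and> s < v \<and> sch s \<noteq> p \<and> trigger_step s \<and> behind d0 X s"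
proof -
  obtain s k d pc' where s: "s < v" "loc (G s) (sch s) = Act k d pc'" "trig (u (sch s, k)) pc'" "fst d = fst y"
    "stat (G (Suc s)) (fst y) = 1" using first_hot[OF v(5)] by metis
  have dy: "d = y" using known_unique2[OF Act_known[OF s(2)] v(3) s(4)] .
  note w = trig_window_index[OF s(2,3)]
  have "X \<noteq> s"
  proof
    assume "X = s"
    then have "d = d0" using p(1) s(2) pX by simp
    then show False using dy v(4) by (simp add: share_def)
  qed
  moreover have "\<not> s < X"
  proof
    assume "s < X"
    then have "hot (stat (G X) (fst y))"
      using hot_between[of "Suc s" X v "fst y"] v(1,5) s(5) by simp
    with ny show False ..
  qed
  ultimately have Xs: "X < s" by simp
  have k0: "d0 \<in> known (G (Suc X))" using Act_known[OF p(1)] known_Suc by blast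
  have h0: "hot (stat (G (Suc X)) (fst d0))" using p(2) by simp
  have hs': "hot (stat (G s) (fst d0))"
    using hot_between[of "Suc X" s v "fst d0"] Xs s(1) p(2) v(2) by simp
  have sh: "share d d0" using v(4) dy share_sym by blast
  have sX: "Suc X \<le> s" using Xs by simp
  obtain pcX where X: "loc (G (Suc X)) (sch s) = Act k d pcX" "\<not> facing (G (Suc X)) d0 pcX"
    using waiting_after_contender[OF k0 h0 sX hs' s(2) _ sh] w(1) by auto
  have np: "\<not> post pc'" using w(2) by (auto simp: steady_def)
  have ns: "\<not> stuck_on d0 pc'" using w(2) by (auto simp: steady_def)
  from steady_steps[OF k0 h0 sX hs' X(1) s(2) sh] np ns
  have "nsteps (steady_at (sch s)) (Suc X) s \<le> scan_cost" by simp
  moreover have "\<exists>s'\<in>set (slots d0). slot (G (Suc X)) s' = enc d"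
  proof -
    obtain l where l: "l \<in> set (snd d0)" "l \<in> set (snd y)" using v(4) by (auto simp: share_def)
    have ne: "entering pcX = {}" using X(2) by (cases pcX) (auto simp: entering_def)
    \<comment> \<open>A releasing process is past its wait for good, whereas this one is still
      waiting at \<open>s\<close>.\<close>
    have "\<not> leaving pcX"
    proof
      assume "leaving pcX"
      then have "post pcX" by (auto simp: leaving_def)
      have "post pc''" if "loc (G r) (sch s) = Act k d pc''" "Suc X \<le> r" "r \<le> s" for r pc''
        using that(2,1,3)
      proof (induction r arbitrary: pc'' rule: dec_induct)
        case base
        then show ?case using X(1) \<open>post pcX\<close> by simp
      next
        case (step r)
        obtain pc3 where l3: "loc (G r) (sch s) = Act k d pc3"
          using run_rank[OF X(1), of r] outcomes_prefix[of r "Suc r" "sch s"] hist_Act(1)[OF step.prems(1)] step(1)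
          by fastforce
        have "post pc3" using step.IH[OF l3] step.prems by simp
        then show ?case
        proof (cases "sch s = sch r")
          case True
          then have "after e (u (sch r, k)) k d pc3 (G r) = Act k d pc''"
            using after_eq[of r k d pc3] l3 step.prems(1) by simp
          from after_post[OF \<open>post pc3\<close> this] show ?thesis .
        next
          case False
          then show ?thesis using l3 step.prems(1) loc_other[of "sch s" r] \<open>post pc3\<close> by simp
        qed
      qed
      from this[OF s(2) sX] np show False by blast
    qed
    then obtain j where "slot (G (Suc X)) (l, j) = enc d" "j < \<kappa>" using holds[OF X(1)] l(2) dy ne by blast
    then show ?thesis using known_slots[OF k0] l(1) by blast
  qed
  ultimately have "behind d0 X s" using Xs s(2) w(2) unfolding behind_def by blast
  moreover have "sch s \<noteq> p"
  proof
    assume "sch s = p"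
    have "d0 \<in> known (G s)" using known_mono[OF sX] k0 by blast
    then obtain q' k' pc2 where o: "loc (G s) q' = Act k' d0 pc2" using hot_owner[OF hs'] by metis
    then have "q' = p" using Act_unique2[OF o p(1)] by simp
    then show False using o s(2) \<open>sch s = p\<close> sh by (simp add: share_def)
  qed
  ultimately show ?thesis using Xs s(1) w(3) by blast
qed

end

context algo_env
begin

lemma num_attempts_mono: "a \<le> b \<Longrightarrow> num_attempts q (tr (G a)) \<le> num_attempts q (tr (G b))"
  using tr_prefix[of a b] by (auto simp: num_attempts_def)

lemma attempt_after_start:
  assumes "loc (G t0) p = Idl" "loc (G (Suc t0)) p = Act m d0 pc0" "loc (G s) p = Act m d pc"
  shows "t0 < s"
proof (rule ccontr)
  assume "\<not> t0 < s"
  then have "num_attempts p (tr (G s)) \<le> num_attempts p (tr (G t0))" by (intro num_attempts_mono) simp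
  then have "Suc m \<le> length (outcomes p (tr (G t0)))" using hist_Act(2)[OF assms(3)] hist_Idl[OF assms(1)] by simp
  moreover have "m = length (outcomes p (tr (G (Suc t0))))" by (rule hist_Act(1)[OF assms(2)])
  ultimately show False using outcomes_prefix[of t0 "Suc t0" p] by auto
qed

lemma two_active:
  assumes "loc (G r) p = Act m d0 pc" "loc (G r) q = Act k y pc'" "share d0 y"
  shows "2 \<le> \<kappa>"
proof -
  obtain l where l: "l \<in> set (snd d0)" "l \<in> set (snd y)" using assms(3) by (auto simp: share_def)
  have "p \<noteq> q" using assms by (auto simp: share_def)
  then have "card {p, q} = 2" by simp
  moreover have "{p, q} \<subseteq> {q. \<exists>k d pc. loc (G r) q = Act k d pc \<and> l \<in> set (snd d)}"
    using assms l by blast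
  ultimately show ?thesis using card_mono[OF card_active(1)[of r l], of "{p, q}"] card_active(2)[of r l]
    by linarith
qed

lemma attempt_finish:
  assumes p: "loc (G (Suc t0)) p = Act m d0 pc0"
    and o: "m < length (outcomes p (tr (G t1)))"
  obtains f where "t0 < f" "f < t1" "loc (G f) p = Act m d0 (Leave (outcomes p (tr (G t1)) ! m) [])"
    "length (outcomes p (tr (G f))) = m"
proof -
  define b where "b = (LEAST b. m < length (outcomes p (tr (G b))))"
  have b1: "m < length (outcomes p (tr (G b)))" unfolding b_def using o by (rule LeastI)
  have "b \<le> t1" unfolding b_def using o by (rule Least_le)
  have nb: "\<not> m < length (outcomes p (tr (G c)))" if "c < b" for c using not_less_Least that b_def by blast
  have "b > Suc t0"
  proof (rule ccontr)
    assume "\<not> b > Suc t0"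
    then have "length (outcomes p (tr (G b))) \<le> length (outcomes p (tr (G (Suc t0))))"
      using outcomes_prefix[of b "Suc t0" p] by auto
    then show False using b1 hist_Act(1)[OF p] by simp
  qed
  then obtain f where f: "b = Suc f" "t0 < f" by (cases b) auto
  from run_rank[OF p, of f] nb[of f] f obtain pc where l: "loc (G f) p = Act m d0 pc" by auto
  have m: "length (outcomes p (tr (G f))) = m" using hist_Act(1)[OF l] by simp
  have "\<exists>c. pc = Leave c [] \<and> outcomes p (tr (G b)) ! m = c"
  proof (cases f rule: step_cases)
    case skip
    then show ?thesis using b1 m f by simp
  next
    case (invoke ls th)
    then show ?thesis using b1 m f by (simp add: outcomes_snoc)
  next
    case (act k d pc1)
    then have "(case label e (u (sch f, k)) d pc1 (G f) of Respond b \<Rightarrow> if sch f = p then [b] else [] | _ \<Rightarrow> []) \<noteq> []"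
      using b1 m f by (auto simp: outcomes_snoc)
    then obtain c where c: "label e (u (sch f, k)) d pc1 (G f) = Respond c" "sch f = p"
      by (auto split: step.splits if_splits)
    then have "pc1 = Leave c []" by (simp add: label_Respond)
    then show ?thesis using act c l f m by (simp add: outcomes_snoc nth_append)
  qed
  then obtain c where c: "pc = Leave c []" "outcomes p (tr (G b)) ! m = c" by blast
  have "outcomes p (tr (G t1)) ! m = c"
    using outcomes_prefix[OF \<open>b \<le> t1\<close>, of p] c(2) b1 by (auto simp: nth_append)
  then show thesis using that[of f] l c f \<open>b \<le> t1\<close> m by simp
qed

text \<open>If the random index is reached while pausing, the contender responsible was seen in the previous
  step of \<open>p\<close>; this is the second case.\<close>
lemma lose_pair:
  assumes p: "sch t0 = p" "loc (G t0) p = Idl" "loc (G (Suc t0)) p = Act m d0 pc0"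
    and uD: "u (p, m) < window"
    and o: "m < length (outcomes p (tr (G t1)))" "\<not> outcomes p (tr (G t1)) ! m"
  shows "2 \<le> \<kappa> \<and> (\<exists>t s. t0 < t \<and> t < t1 \<and> hit t p m \<and> t0 < s \<and> s < t1 \<and> sch s \<noteq> p \<and> trigger_step s \<and>
    (before d0 t s \<or> before d0 (previous_step p t) s \<and> previous_step p t < t \<or> triggers t p m \<and> behind d0 t s))"
proof -
  obtain f where f: "t0 < f" "f < t1" "loc (G f) p = Act m d0 (Leave False [])" "length (outcomes p (tr (G f))) = m"
    using attempt_finish[OF p(3) o(1)] o(2) by auto
  obtain t where t: "t < f" "hit t p m" using post_hit[OF f(3) _ uD] by auto
  then obtain d pc where l0: "loc (G t) p = Act m d pc" "window_index pc = Some (u (p, m))" "sch t = p"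
    unfolding hit_def by blast
  have t0: "t0 < t" by (rule attempt_after_start[OF p(2,3) l0(1)])
  have "\<not> m < length (outcomes p (tr (G t)))"
    using outcomes_prefix[of t f p] t(1) f(4) by auto
  with run_rank[OF p(3), of t] t0 l0(1) have "d = d0" by auto
  note l = l0[unfolded this]
  have key: "2 \<le> \<kappa> \<and> (\<exists>s. t0 < s \<and> s < f \<and> sch s \<noteq> p \<and> trigger_step s \<and>
    (before d0 t s \<or> before d0 (previous_step p t) s \<and> previous_step p t < t \<or> triggers t p m \<and> behind d0 t s))"
  proof (cases "steady pc")
    case False
    then obtain i y rest where pc: "pc = Stuck i y rest" using l(2) by (cases pc) (auto simp: steady_def)
    from stuck_prev[OF l(1)[unfolded pc]] obtain r pcr where
      r: "r < t" "sch r = p" "nsteps (\<lambda>r. sch r = p) (Suc r) t = 0" "hot (stat (G r) (fst y))"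
        "y \<in> known (G r)" "share d0 y" "loc (G r) p = Act m d0 pcr" "window_index pcr \<noteq> None" by metis
    have "t0 < r" by (rule attempt_after_start[OF p(2,3) r(7)])
    from before_intro[OF p(2) this r(7,8) p(1) r(5,6,4)] obtain s where
      s: "t0 < s" "s < r" "sch s \<noteq> p" "trigger_step s" "before d0 r s" by blast
    have "previous_step p t = r" by (rule previous_step_eq[OF r(1-3)])
    moreover have "2 \<le> \<kappa>" using hot_owner[OF r(4,5)] two_active[OF r(7) _ r(6)] by metis
    ultimately show ?thesis using s r(1) t(1) by (metis less_trans)
  next
    case True
    then have triggers: "trig (u (p, m)) pc" using l(2) by (auto simp: steady_def)
    have z: "stat (G t) (fst d0) = 0" using st_okD[OF l(1)] True by (auto simp: steady_def)
    have tt: "triggers t p m" using l triggers unfolding triggers_def by blast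
    have one: "stat (G (Suc t)) (fst d0) = 1"
    proof (cases t rule: step_cases)
      case (act k1 d1 pc1)
      then show ?thesis using l triggers z by (simp add: stat_pc_step)
    qed (use l in auto)
    have "stat (G f) (fst d0) \<noteq> 0"
      using level_mono[of "Suc t" f "fst d0"] t(1) one by (auto simp: level_def)
    then have "stat (G f) (fst d0) = 3"
      using st_okD[OF f(3)] legal_cases[OF stat_legal[of f "fst d0"]] by auto
    from lost_collide[OF Act_known[OF p(3)] this] obtain v y where
      v: "v < f" "stat (G v) (fst d0) = 1" "y \<in> known (G v)" "share d0 y" "hot (stat (G v) (fst y))"
      unfolding collide_def by blast
    have tv: "t < v"
    proof (rule ccontr)
      assume "\<not> t < v"
      then show False using level_mono[of v t "fst d0"] v(2) z by (auto simp: level_def)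
    qed
    have k2: "2 \<le> \<kappa>"
    proof -
      have "d0 \<in> known (G v)" using Act_known[OF l(1)] known_mono[of t v] tv by auto
      moreover have "hot (stat (G v) (fst d0))" using v(2) by simp
      ultimately obtain q k pc' where "loc (G v) q = Act k d0 pc'" using hot_owner by metis
      then show ?thesis using hot_owner[OF v(5,3)] two_active[OF _ _ v(4)] by metis
    qed
    \<comment> \<open>Either \<open>y\<close> contends already at \<open>t\<close>, and then its
      start lies before \<open>t\<close>, or it starts only later.\<close>
    show ?thesis
    proof (cases "hot (stat (G t) (fst y))")
      case True
      then obtain q k d pc' where "loc (G t) q = Act k d pc'" "fst d = fst y" using hot_contending by blast
      then have "y \<in> known (G t)" using Act_known known_unique2[OF _ v(3)] by metis
      from before_intro[OF p(2) t0 l(1) _ p(1) this v(4) True] l(2) obtain s where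
        "t0 < s" "s < t" "sch s \<noteq> p" "trigger_step s" "before d0 t s" by auto
      then show ?thesis using k2 t(1) by (meson less_trans)
    next
      case False
      from behind_intro[OF l(1) one tv v(2-5) False l(3)] obtain s where
        "t < s" "s < v" "sch s \<noteq> p" "trigger_step s" "behind d0 t s" by blast
      then show ?thesis using k2 t0 v(1) tt by (meson less_trans)
    qed
  qed
  then show ?thesis using t t0 f(2) by (meson less_trans)
qed

lemma card_slots_UN:
  assumes "\<And>s'. finite (B s') \<and> card (B s') \<le> n"
  shows "finite (\<Union>s'\<in>set (slots d). B s') \<and> card (\<Union>s'\<in>set (slots d). B s') \<le> \<kappa> * L * n"
proof -
  have "card (\<Union>s'\<in>set (slots d). B s') \<le> (\<Sum>s'\<in>set (slots d). card (B s'))"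
    by (rule card_UN_le) simp
  also have "\<dots> \<le> card (set (slots d)) * n"
    using assms sum_bounded_above[of "set (slots d)" "\<lambda>s'. card (B s')" n] by simp
  also have "\<dots> \<le> \<kappa> * L * n"
    using card_length[of "slots d"] length_slots[of d] by (intro mult_le_mono1) simp
  finally show ?thesis using assms by simp
qed

text \<open>Fix a slot. By \<open>run_low\<close>, whoever held it at a counted step still holds it
  at \<open>R\<close>. So its content at \<open>R\<close> determines one process for all these
  steps, of which only the last \<open>help_cost\<close> before \<open>R\<close> count. This is what
  the padding is for.\<close>

lemma card_before: "finite {s. before d0 R s} \<and> card {s. before d0 R s} \<le> \<kappa> * L * help_cost"
proof -
  define B where "B s' = {s. s < R \<and> nsteps (\<lambda>r. sch r = sch s) s R \<le> help_cost \<and>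
     (\<exists>k d pc. loc (G s) (sch s) = Act k d pc \<and> window_index pc \<noteq> None \<and> slot (G s) s' = enc d)}" for s'
  have "{s. before d0 R s} = (\<Union>s'\<in>set (slots d0). B s')"
    unfolding before_def B_def by blast
  moreover have "finite (B s') \<and> card (B s') \<le> help_cost" for s'
  proof (cases "B s' = {}")
    case False
    have own: "\<exists>k d pc. loc (G R) (sch s) = Act k d pc \<and> slot (G R) s' = enc d" if s: "s \<in> B s'" for s
    proof -
      obtain k d pc where *: "loc (G s) (sch s) = Act k d pc" "window_index pc \<noteq> None" "slot (G s) s' = enc d"
        "s < R" "nsteps (\<lambda>r. sch r = sch s) s R \<le> help_cost" using s unfolding B_def by blast
      have "low pc = pad_length" using *(2) by (cases pc) auto
      then have "nsteps (\<lambda>r. sch r = sch s) s R < low pc" using *(5) by (simp add: pad_length_def)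
      from run_low[OF *(1) _ this] *(3,4) show ?thesis by auto
    qed
    from False obtain s0 where s0: "s0 \<in> B s'" by blast
    obtain k0 dz pc0 where 0: "loc (G R) (sch s0) = Act k0 dz pc0" "slot (G R) s' = enc dz" using own[OF s0] by blast
    have "B s' \<subseteq> {s. s < R \<and> sch s = sch s0 \<and> nsteps (\<lambda>r. sch r = sch s0) s R \<le> help_cost}"
    proof
      fix s assume s: "s \<in> B s'"
      obtain k d pc where 1: "loc (G R) (sch s) = Act k d pc" "slot (G R) s' = enc d" using own[OF s] by blast
      then have "d = dz" using 0 by simp
      then have "sch s = sch s0" using Act_unique[OF 1(1) 0(1)] by simp
      then show "s \<in> {s. s < R \<and> sch s = sch s0 \<and> nsteps (\<lambda>r. sch r = sch s0) s R \<le> help_cost}"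
        using s unfolding B_def by auto
    qed
    then show ?thesis using card_last_steps[of R "\<lambda>s. sch s = sch s0" help_cost]
      by (meson card_mono finite_subset le_trans)
  qed simp
  ultimately show ?thesis using card_slots_UN[of B help_cost d0] by simp
qed

text \<open>Here the slot is inspected at the fixed time \<open>Suc X\<close>, so its content names
  the attempt directly, and the first steady steps of its process after \<open>X\<close> are
  counted.\<close>

lemma card_behind: "finite {s. behind d0 X s} \<and> card {s. behind d0 X s} \<le> \<kappa> * L * Suc scan_cost"
proof -
  define B where "B s' = {s. X < s \<and> nsteps (steady_at (sch s)) (Suc X) s \<le> scan_cost \<and>
     (\<exists>k d pc. loc (G s) (sch s) = Act k d pc \<and> steady pc \<and> slot (G (Suc X)) s' = enc d)}" for s'
  have "{s. behind d0 X s} = (\<Union>s'\<in>set (slots d0). B s')"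
    unfolding behind_def B_def by blast
  moreover have "finite (B s') \<and> card (B s') \<le> Suc scan_cost" for s'
  proof (cases "B s' = {}")
    case False
    then obtain s0 k0 dz pc0 where 0: "loc (G s0) (sch s0) = Act k0 dz pc0" "slot (G (Suc X)) s' = enc dz"
      unfolding B_def by blast
    have "B s' \<subseteq> {s. Suc X \<le> s \<and> steady_at (sch s0) s \<and> nsteps (steady_at (sch s0)) (Suc X) s \<le> scan_cost}"
    proof
      fix s assume s: "s \<in> B s'"
      then obtain k d pc where 1: "loc (G s) (sch s) = Act k d pc" "steady pc" "slot (G (Suc X)) s' = enc d"
        unfolding B_def by blast
      then have "d = dz" using 0 by simp
      then have "sch s = sch s0" using Act_unique2(1)[OF 1(1) 0(1)] by simp
      moreover have "steady_at (sch s) s" using 1 unfolding steady_at_def by blast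
      ultimately show "s \<in> {s. Suc X \<le> s \<and> steady_at (sch s0) s \<and> nsteps (steady_at (sch s0)) (Suc X) s \<le> scan_cost}"
        using s unfolding B_def by auto
    qed
    then show ?thesis using card_first_steps[of "Suc X" "steady_at (sch s0)" scan_cost]
      by (meson card_mono finite_subset le_trans)
  qed simp
  ultimately show ?thesis using card_slots_UN[of B "Suc scan_cost" d0] by simp
qed

end

section \<open>Resampling one seed\<close>

definition unit :: "real measure" where
  "unit = uniform_measure lborel {0..1}"

lemma prob_space_unit: "prob_space unit"
  unfolding unit_def by (rule prob_space_uniform_measure) auto

lemma sets_unit [simp, measurable_cong]: "sets unit = sets borel"
  and space_unit [simp]: "space unit = UNIV"
  by (simp_all add: unit_def)

lemma seed_space_unit: "seed_space = (\<Pi>\<^sub>M i\<in>UNIV. unit)"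
  by (simp add: seed_space_def unit_def)

lemma space_seed_space [simp]: "space seed_space = UNIV"
  by (simp add: seed_space_unit space_PiM)

interpretation seed_space: prob_space seed_space
  unfolding seed_space_unit by (intro prob_space_PiM prob_space_unit)

lemma measure_unit:
  assumes "B \<in> sets borel" "B \<inter> {0..1} = {a..<b} \<or> B \<inter> {0..1} = {a..b}" "a \<le> b"
  shows "emeasure unit B = ennreal (b - a)"
proof -
  have "emeasure unit B = emeasure lborel ({0..1} \<inter> B) / emeasure lborel {0..1::real}"
    unfolding unit_def using assms(1) by (intro emeasure_uniform_measure) auto
  then show ?thesis using assms(2,3) by (auto simp: Int_commute divide_ennreal_def)
qed

text \<open>Fubini: replacing one seed by an independent fresh one preserves the product measure. So
  it suffices to compare two events along each line in direction \<open>c\<close>, with all other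
  seeds frozen.\<close>

lemma resample:
  assumes A: "A \<in> sets seed_space"
  shows "emeasure seed_space A = (\<integral>\<^sup>+X. emeasure unit {x. X(c := x) \<in> A} \<partial>seed_space)"
    "(\<lambda>X. emeasure unit {x. X(c := x) \<in> A}) \<in> borel_measurable seed_space"
    "\<And>X. {x. X(c := x) \<in> A} \<in> sets unit"
proof -
  interpret U: prob_space unit by (rule prob_space_unit)
  interpret P: pair_sigma_finite unit seed_space ..
  let ?f = "\<lambda>(x, X). X(c := x) :: seeds"
  have m: "?f \<in> measurable (unit \<Otimes>\<^sub>M seed_space) seed_space"
    unfolding seed_space_unit split_beta
    by (rule measurable_fun_upd[where J = UNIV]) (simp_all add: measurable_snd measurable_fst)
  have d: "distr (unit \<Otimes>\<^sub>M seed_space) seed_space ?f = seed_space"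
    using distr_pair_PiM_eq_PiM[of UNIV "\<lambda>_. unit" c] prob_space_unit unfolding seed_space_unit by simp
  let ?Q = "?f -` A \<inter> space (unit \<Otimes>\<^sub>M seed_space)"
  have Q: "?Q \<in> sets (unit \<Otimes>\<^sub>M seed_space)" using m A by (rule measurable_sets)
  have e: "(\<lambda>x. (x, X)) -` ?Q = {x. X(c := x) \<in> A}" for X
    by (auto simp: space_pair_measure)
  show "emeasure seed_space A = (\<integral>\<^sup>+X. emeasure unit {x. X(c := x) \<in> A} \<partial>seed_space)"
    using emeasure_distr[OF m A] P.emeasure_pair_measure_alt2[OF Q] unfolding d e by simp
  show "(\<lambda>X. emeasure unit {x. X(c := x) \<in> A}) \<in> borel_measurable seed_space"
    using P.measurable_emeasure_Pair2[OF Q] unfolding e .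
  show "{x. X(c := x) \<in> A} \<in> sets unit" for X
    using sets_Pair2[OF Q, of X] unfolding e .
qed

lemma resample_le:
  assumes A: "A \<in> sets seed_space" and B: "B \<in> sets seed_space" and h: "0 \<le> h"
    and le: "\<And>X. emeasure unit {x. X(c := x) \<in> B} \<le> ennreal h * emeasure unit {x. X(c := x) \<in> A}"
  shows "measure seed_space B \<le> h * measure seed_space A"
proof -
  have "emeasure seed_space B \<le> (\<integral>\<^sup>+X. ennreal h * emeasure unit {x. X(c := x) \<in> A} \<partial>seed_space)"
    unfolding resample(1)[OF B, of c] by (intro nn_integral_mono le)
  also have "\<dots> = ennreal h * emeasure seed_space A"
    unfolding resample(1)[OF A, of c] by (rule nn_integral_cmult[OF resample(2)[OF A]])
  finally show ?thesis
    using h by (simp add: seed_space.emeasure_eq_measure ennreal_mult'[symmetric])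
qed

definition grid :: "nat \<Rightarrow> real \<Rightarrow> nat" where
  "grid N x = nat \<lfloor>real N * x\<rfloor>"

lemma grid_measurable [measurable]: "grid N \<in> measurable borel (count_space UNIV)"
  unfolding grid_def by measurable

lemma grid_eq:
  assumes "0 < N" "i < N"
  shows "emeasure unit {x. grid N x = i} = ennreal (1 / real N)"
proof -
  have "{x. grid N x = i} \<inter> {0..1} = {real i / real N..<(real i + 1) / real N}"
  proof (intro set_eqI iffI)
    fix x assume "x \<in> {x. grid N x = i} \<inter> {0..1}"
    then have "0 \<le> x" "nat \<lfloor>real N * x\<rfloor> = i" by (auto simp: grid_def)
    then have "real i \<le> real N * x" "real N * x < real i + 1" using assms
      by (smt (verit) floor_less_one le_nat_floor less_nat_zero_code mult_nonneg_nonneg of_int_floor_le of_nat_0_le_iff of_nat_nat real_of_int_floor_add_one_gt zero_le_floor)+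
    then show "x \<in> {real i / real N..<(real i + 1) / real N}" using assms by (auto simp: field_simps)
  next
    fix x assume "x \<in> {real i / real N..<(real i + 1) / real N}"
    then have *: "real i \<le> real N * x" "real N * x < real i + 1" using assms by (auto simp: field_simps)
    then have "\<lfloor>real N * x\<rfloor> = int i" by (intro floor_unique) auto
    moreover have "real i + 1 \<le> real N" using assms by linarith
    then have "real N * x \<le> real N * 1" "0 \<le> real N * x" using * by linarith+
    then have "x \<le> 1" "0 \<le> x" using assms by (auto simp: zero_le_mult_iff)
    ultimately show "x \<in> {x. grid N x = i} \<inter> {0..1}" by (simp add: grid_def)
  qed
  moreover have "{x. grid N x = i} \<in> sets borel"
    using measurable_sets[OF grid_measurable, of "{i}" N] by (simp add: vimage_def)
  ultimately have "emeasure unit {x. grid N x = i} = ennreal ((real i + 1) / real N - real i / real N)"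
    using assms by (intro measure_unit) (auto simp: field_simps)
  then show ?thesis by (simp add: diff_divide_distrib[symmetric])
qed

lemma grid_ge:
  assumes "0 < N" "i \<le> N"
  shows "emeasure unit {x. i \<le> grid N x} = ennreal (1 - real i / real N)"
proof -
  have "{x. i \<le> grid N x} \<inter> {0..1} = {real i / real N..1}"
  proof (intro set_eqI iffI)
    fix x assume "x \<in> {x. i \<le> grid N x} \<inter> {0..1}"
    then have x: "0 \<le> x" "x \<le> 1" "i \<le> nat \<lfloor>real N * x\<rfloor>" by (auto simp: grid_def)
    have "0 \<le> \<lfloor>real N * x\<rfloor>" using x(1) by simp
    then have "int i \<le> \<lfloor>real N * x\<rfloor>" using x(3) by linarith
    then have "real i \<le> real N * x" by (simp add: le_floor_iff)
    then show "x \<in> {real i / real N..1}" using x assms by (auto simp: field_simps)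
  next
    fix x assume "x \<in> {real i / real N..1}"
    then have x: "real i \<le> real N * x" "x \<le> 1" using assms by (auto simp: field_simps)
    then have "int i \<le> \<lfloor>real N * x\<rfloor>" by (simp add: le_floor_iff)
    moreover have "0 \<le> x" using x(1) assms by (metis of_nat_0_le_iff of_nat_0_less_iff order_trans zero_le_mult_iff not_less)
    ultimately show "x \<in> {x. i \<le> grid N x} \<inter> {0..1}" using x by (auto simp: grid_def)
  qed
  moreover have "{x. i \<le> grid N x} \<in> sets borel"
    using measurable_sets[OF grid_measurable, of "{i..}" N] by (simp add: vimage_def)
  ultimately show ?thesis
    using assms by (intro measure_unit) (auto simp: field_simps)
qed

text \<open>Integrates the number of events that occur: a bound that holds on every run becomes a
  bound on the sum of probabilities. For \<open>n = 1\<close> this is additivity over mutually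
  exclusive events.\<close>

lemma sum_measure_le_count:
  assumes I: "finite I" and S: "S \<in> sets seed_space"
    and B: "\<And>i. i \<in> I \<Longrightarrow> B i \<in> sets seed_space" "\<And>i. i \<in> I \<Longrightarrow> B i \<subseteq> S"
    and n: "\<And>x. x \<in> S \<Longrightarrow> card {i \<in> I. x \<in> B i} \<le> n"
  shows "(\<Sum>i\<in>I. measure seed_space (B i)) \<le> real n * measure seed_space S"
proof -
  have "(\<Sum>i\<in>I. measure seed_space (B i)) = (\<Sum>i\<in>I. integral\<^sup>L seed_space (indicator (B i)))"
    using B(1) by simp
  also have "\<dots> = integral\<^sup>L seed_space (\<lambda>x. \<Sum>i\<in>I. indicator (B i) x)"
    using B(1) by (intro Bochner_Integration.integral_sum[symmetric]) (simp add: integrable_indicator_iff seed_space.emeasure_eq_measure)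
  also have "\<dots> \<le> integral\<^sup>L seed_space (\<lambda>x. real n * indicator S x)"
  proof (rule integral_mono)
    show "integrable seed_space (\<lambda>x. \<Sum>i\<in>I. indicator (B i) x :: real)"
      using B(1) by (intro Bochner_Integration.integrable_sum) (simp add: integrable_indicator_iff seed_space.emeasure_eq_measure)
    show "integrable seed_space (\<lambda>x. real n * indicator S x)"
      using S by (intro integrable_mult_right) (simp add: integrable_indicator_iff seed_space.emeasure_eq_measure)
    fix x
    have "(\<Sum>i\<in>I. indicator (B i) x :: real) = real (card {i \<in> I. x \<in> B i})"
      using I by (simp add: indicator_def sum.If_cases Int_def conj_commute)
    moreover have "card {i \<in> I. x \<in> B i} \<le> n \<and> x \<in> S \<or> card {i \<in> I. x \<in> B i} = 0"
    proof (cases "x \<in> S")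
      case False
      then have e: "{i \<in> I. x \<in> B i} = {}" using B(2) by blast
      show ?thesis unfolding e by simp
    qed (use n in blast)
    ultimately show "(\<Sum>i\<in>I. indicator (B i) x) \<le> real n * indicator S x"
      by (auto simp: indicator_def)
  qed
  also have "\<dots> = real n * measure seed_space S" using S by simp
  finally show ?thesis .
qed

section \<open>How a run depends on a single random index\<close>

context algo
begin

lemma pc_step_cong:
  assumes "\<And>j. window_index pc = Some j \<Longrightarrow> (j = v) = (j = v')"
  shows "pc_step e v q k d pc g = pc_step e v' q k d pc g"
  using assms by (cases pc rule: pc_cases) (simp_all add: pc_step.simps)

lemma window_index_window: "pc_ok K d pc \<Longrightarrow> window_index pc = Some i \<Longrightarrow> i < window"
  by (cases pc) auto

lemma after_window_index:
  assumes "window_index pc = Some j" "after e v k d pc g = Act k' d' pc'"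
  shows "post pc' \<or> window_index pc' = Some (Suc j)"
  using assms by (cases pc rule: pc_cases) (auto simp: tick_def split: if_splits)

lemma trig_iff_after:
  assumes "after e v k d pc g = Act k d pc'" "window_index pc \<noteq> None"
  shows "trig v pc \<longleftrightarrow> (\<exists>x b ls. pc' = Check x b ls)"
  using assms by (cases pc rule: pc_cases) (auto simp: tick_def split: if_splits)

end

context algo_env
begin

text \<open>An index enters the run only through the test whether the current window position equals
  it.\<close>

lemma run_cong:
  assumes "\<And>r k d pc j. r < t \<Longrightarrow> loc (G r) (sch r) = Act k d pc \<Longrightarrow> window_index pc = Some j \<Longrightarrow>
    (j = u (sch r, k)) = (j = u' (sch r, k))"
  shows "run e u' t = G t"
  using assms
proof (induction t)
  case 0
  show ?case by (simp add: run.simps(1))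
next
  case (Suc t)
  then have IH: "run e u' t = G t" by simp
  show ?case
  proof (cases "loc (G t) (sch t)")
    case Idl
    then show ?thesis by (simp add: run.simps(2) IH gstep_def)
  next
    case (Act k d pc)
    have "pc_step e (u (sch t, k)) (sch t) k d pc (G t) = pc_step e (u' (sch t, k)) (sch t) k d pc (G t)"
      using Suc.prems[of t k d pc] Act by (intro pc_step_cong) auto
    then show ?thesis using Act by (simp add: run.simps(2) IH gstep_def)
  qed
qed

lemma Act_back:
  assumes "loc (G a) q = Act k d pc" "a \<le> b" "b \<le> c" "loc (G c) q = Act k d' pc'"
  shows "\<exists>pc''. loc (G b) q = Act k d pc''"
  using run_rank[OF assms(1,2)] outcomes_prefix[OF assms(3), of q] hist_Act(1)[OF assms(4)] by fastforce

lemma window_index_less: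
  assumes r: "loc (G r) q = Act k d pc'" "window_index pc' = Some j" "sch r = q"
    and t: "r < t" "loc (G t) q = Act k d2 pc" "window_index pc = Some i"
  shows "j < i"
proof -
  have "post pc \<or> (\<exists>i. window_index pc = Some i \<and> j < i)" if "loc (G t) q = Act k d2 pc" "Suc r \<le> t" for t pc
    using that(2,1)
  proof (induction t arbitrary: pc rule: dec_induct)
    case base
    then have "after e (u (q, k)) k d pc' (G r) = Act k d2 pc"
      using after_eq[of r k d pc'] r by simp
    from after_window_index[OF r(2) this] show ?case by auto
  next
    case (step t)
    obtain pc3 where l3: "loc (G t) q = Act k d pc3"
      using Act_back[OF r(1), of t "Suc t"] step by auto
    show ?case
    proof (cases "sch t = q")
      case False
      then show ?thesis using step.IH[of pc3] l3 step.prems loc_other[of q t] Act_unique2(3)[OF l3] by auto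
    next
      case True
      then have a: "after e (u (q, k)) k d pc3 (G t) = Act k d2 pc"
        using after_eq[of t k d pc3] l3 step.prems by simp
      then have "d2 = d" using after_Act by blast
      then consider "post pc3" | i where "window_index pc3 = Some i" "j < i" using step.IH[of pc3] l3 by auto
      then show ?thesis
      proof cases
        case 1
        then show ?thesis using after_post[OF 1 a] by simp
      next
        case 2
        then show ?thesis using after_window_index[OF 2(1) a] by auto
      qed
    qed
  qed
  from this[OF t(2)] t(1,3) show ?thesis by (cases pc) auto
qed

text \<open>Every earlier test for this attempt compared the index with a position below
  \<open>i\<close>, and failed for the old index as it does for \<open>x\<close>.\<close>

lemma waiting_resample:
  assumes "loc (G t) (sch t) = Act k d pc" "window_index pc = Some i" "i \<le> x" "r \<le> t"
  shows "run e (u((sch t, k) := x)) r = G r"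
proof (rule run_cong)
  fix r' k' d' pc' j
  assume r': "r' < r" "loc (G r') (sch r') = Act k' d' pc'" "window_index pc' = Some j"
  show "(j = u (sch r', k')) = (j = (u((sch t, k) := x)) (sch r', k'))"
  proof (cases "(sch r', k') = (sch t, k)")
    case True
    then have "j < i" using window_index_less[OF r'(2,3) _ _ _ assms(2), of t d] assms(1,4) r'(1) by simp
    then show ?thesis using True assms(3) window_index_le[OF assms(1,2)] by auto
  qed auto
qed

lemma start_resample:
  assumes "loc (G t0) p = Idl" "loc (G (Suc t0)) p = Act m d0 pc0" "r \<le> Suc t0"
  shows "run e (u((p, m) := x)) r = G r"
proof (rule run_cong)
  fix r' k' d' pc' j
  assume r': "r' < r" "loc (G r') (sch r') = Act k' d' pc'" "window_index pc' = Some j"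
  have "(sch r', k') \<noteq> (p, m)"
    using attempt_after_start[OF assms(1,2)] r' assms(3) by fastforce
  then show "(j = u (sch r', k')) = (j = (u((p, m) := x)) (sch r', k'))" by auto
qed

lemma length_tr: "length (tr (G t)) \<le> t"
proof (induction t)
  case (Suc t)
  then show ?case using tr_Suc[of t] by auto
qed simp

lemma attempt_le: "loc (G t) q = Act k d pc \<Longrightarrow> k < t"
proof -
  assume "loc (G t) q = Act k d pc"
  then have "Suc k \<le> length (tr (G t))"
    using hist_Act(2) length_filter_le[of "\<lambda>(q', s). q' = q \<and> is_Invoke s" "tr (G t)"]
    by (metis num_attempts_def)
  then show ?thesis using length_tr[of t] by simp
qed

text \<open>Expresses the event by two consecutive states instead of the seed. So it belongs to the
  past of \<open>Suc t\<close>, and later events can be conditioned on it.\<close>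

lemma trigger_step_iff:
  "trigger_step t \<longleftrightarrow> (\<exists>k d pc pc'. loc (G t) (sch t) = Act k d pc \<and> window_index pc \<noteq> None \<and>
     loc (G (Suc t)) (sch t) = Act k d pc' \<and> (\<exists>x b ls. pc' = Check x b ls))"
proof
  assume "trigger_step t"
  then obtain k d pc where *: "loc (G t) (sch t) = Act k d pc" "trig (u (sch t, k)) pc"
    unfolding trigger_step_def triggers_def by blast
  then have w: "window_index pc \<noteq> None" by (auto simp: trig_def)
  have "\<exists>pc'. after e (u (sch t, k)) k d pc (G t) = Act k d pc'"
    using w by (cases pc rule: pc_cases) auto
  then show "\<exists>k d pc pc'. loc (G t) (sch t) = Act k d pc \<and> window_index pc \<noteq> None \<and>
     loc (G (Suc t)) (sch t) = Act k d pc' \<and> (\<exists>x b ls. pc' = Check x b ls)"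
    using * w trig_iff_after after_eq by metis
next
  assume "\<exists>k d pc pc'. loc (G t) (sch t) = Act k d pc \<and> window_index pc \<noteq> None \<and>
     loc (G (Suc t)) (sch t) = Act k d pc' \<and> (\<exists>x b ls. pc' = Check x b ls)"
  then show "trigger_step t" using trig_iff_after after_eq unfolding trigger_step_def triggers_def by metis
qed

lemma triggers_iff: "triggers t q m \<longleftrightarrow> sch t = q \<and> trigger_step t \<and> (\<exists>d pc. loc (G t) q = Act m d pc)"
  unfolding trigger_step_def triggers_def by auto

lemma triggers_hit: "triggers t q k \<Longrightarrow> hit t q k"
  unfolding triggers_def hit_def by (auto simp: trig_def)

end

section \<open>Conditional probability of striking at a given step\<close>

locale lock_env = algo +
  fixes e :: environment
  assumes adm: "admissible \<kappa> L T e"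
begin

text \<open>Without competitors, contending at index 0 makes success certain rather than merely likely.\<close>
definition pick :: "real \<Rightarrow> nat" where
  "pick x = (if \<kappa> = 1 then 0 else grid (4 * E) x)"

sublocale A: algo_env \<kappa> L T E e "\<lambda>c. pick (s c)" for s :: seeds
  by unfold_locales (rule adm)

lemma pick_measurable [measurable]: "pick \<in> measurable borel (count_space UNIV)"
  unfolding pick_def by (cases "\<kappa> = 1") auto

lemma run_upd: "run e ((\<lambda>c. pick (s c))(c := pick x)) r = A.G (s(c := x)) r"
  by (rule arg_cong[where f = "\<lambda>u. run e u r"]) (auto simp: fun_eq_iff)

text \<open>\<open>P\<close> is an event of the past of time \<open>t\<close>.\<close>
definition determined :: "nat \<Rightarrow> (seeds \<Rightarrow> bool) \<Rightarrow> bool" where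
  "determined t P \<longleftrightarrow> (\<forall>s s'. (\<forall>r\<le>t. A.G s r = A.G s' r) \<longrightarrow> P s \<longrightarrow> P s')"

lemma detD: "determined t P \<Longrightarrow> \<forall>r\<le>t. A.G s r = A.G s' r \<Longrightarrow> P s \<Longrightarrow> P s'"
  unfolding determined_def by blast

lemma determined_mono: "determined t P \<Longrightarrow> t \<le> t' \<Longrightarrow> determined t' P"
  unfolding determined_def by (meson order_trans)

lemma determined_conj: "determined t P \<Longrightarrow> determined t Q \<Longrightarrow> determined t (\<lambda>s. P s \<and> Q s)"
  unfolding determined_def by blast

text \<open>Up to time \<open>t\<close> only the finitely many seeds in \<open>C\<close> can have
  been consulted, and these only through \<open>pick\<close>, which has countably many values. So
  the event is a countable union of cylinder sets.\<close>

lemma determined_sets: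
  assumes "determined t P"
  shows "{s. P s} \<in> sets seed_space"
proof -
  \<comment> \<open>An attempt that is active before time \<open>t\<close> has a number below
    \<open>t\<close>, by \<open>attempt_le\<close>.\<close>
  define C where "C = scheduler e ` {..<t} \<times> {..t}"
  have fin: "finite C" by (simp add: C_def)
  have eq: "A.G s r = A.G s' r" if "\<And>c. c \<in> C \<Longrightarrow> pick (s c) = pick (s' c)" "r \<le> t" for s s' r
  proof -
    have "run e (\<lambda>c. pick (s' c)) r = A.G s r"
    proof (rule A.run_cong)
      fix r' k d pc j
      assume "r' < r" "loc (A.G s r') (scheduler e r') = Act k d pc"
      then have "(scheduler e r', k) \<in> C" using A.attempt_le[of s r'] that(2) by (fastforce simp: C_def)
      from that(1)[OF this] show "(j = pick (s (scheduler e r', k))) = (j = pick (s' (scheduler e r', k)))" by simp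
    qed
    then show ?thesis by simp
  qed
  define V where "V = {v \<in> PiE C (\<lambda>_. UNIV :: nat set). \<exists>s. P s \<and> (\<forall>c\<in>C. pick (s c) = v c)}"
  have cV: "countable V"
    unfolding V_def by (rule countable_subset[OF _ countable_PiE[OF fin]]) auto
  have "{s. P s} = (\<Union>v\<in>V. {s \<in> space seed_space. \<forall>c\<in>C. pick (s c) = v c})"
  proof (intro set_eqI iffI)
    fix s assume "s \<in> {s. P s}"
    then have "restrict (\<lambda>c. pick (s c)) C \<in> V" unfolding V_def by (auto intro!: exI[of _ s])
    then show "s \<in> (\<Union>v\<in>V. {s \<in> space seed_space. \<forall>c\<in>C. pick (s c) = v c})"
      by (intro UN_I[of "restrict (\<lambda>c. pick (s c)) C"]) auto
  next
    fix s assume "s \<in> (\<Union>v\<in>V. {s \<in> space seed_space. \<forall>c\<in>C. pick (s c) = v c})"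
    then obtain v s' where v: "\<forall>c\<in>C. pick (s c) = v c" "P s'" "\<forall>c\<in>C. pick (s' c) = v c"
      unfolding V_def by auto
    then have "\<forall>r\<le>t. A.G s' r = A.G s r" using eq[of s' s] by auto
    then show "s \<in> {s. P s}" using assms v(2) unfolding determined_def by blast
  qed
  also have "\<dots> \<in> sets seed_space"
  proof -
    have "{s \<in> space seed_space. pick (s c) = n} \<in> sets seed_space" for c n
      unfolding seed_space_unit by measurable
    then have "{s \<in> space seed_space. \<forall>c\<in>C. pick (s c) = v c} \<in> sets seed_space" for v
      by (intro sets.sets_Collect_finite_All fin) auto
    then show ?thesis by (intro sets.countable_UN'[OF cV]) auto
  qed
  finally show ?thesis .
qed

definition hazard :: real where "hazard = 1 / real E"

lemma hazard_nonneg: "0 \<le> hazard"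
  by (simp add: hazard_def)

text \<open>The run up to index \<open>i\<close> does not depend on the seed except through the fact that the grid point is
  at least \<open>i\<close>, an event of probability at least 1/4. So the grid point is \<open>i\<close> with conditional
  probability at most \<open>(1 / (4 * E)) / (1 / 4)\<close>.\<close>
lemma hazard_index:
  assumes k2: "\<kappa> \<noteq> 1" and P: "determined t P" and i: "i < window"
  shows "measure seed_space {s. P s \<and> (\<exists>d pc. loc (A.G s t) (scheduler e t) = Act k d pc \<and> window_index pc = Some i) \<and>
      pick (s (scheduler e t, k)) = i}
    \<le> hazard * measure seed_space {s. P s \<and> (\<exists>d pc. loc (A.G s t) (scheduler e t) = Act k d pc \<and> window_index pc = Some i)}"
    (is "measure _ ?B \<le> _ * measure _ ?A")
    and "{s. P s \<and> (\<exists>d pc. loc (A.G s t) (scheduler e t) = Act k d pc \<and> window_index pc = Some i) \<and>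
      pick (s (scheduler e t, k)) = i} \<in> sets seed_space"
proof -
  let ?c = "(scheduler e t, k)"
  have dA: "determined t (\<lambda>s. P s \<and> (\<exists>d pc. loc (A.G s t) (scheduler e t) = Act k d pc \<and> window_index pc = Some i))"
    by (rule determined_conj[OF P]) (auto simp: determined_def)
  have A: "?A \<in> sets seed_space" by (rule determined_sets[OF dA])
  have p: "{s \<in> space seed_space. pick (s ?c) = i} \<in> sets seed_space"
    unfolding seed_space_unit by measurable
  have "?B = ?A \<inter> {s \<in> space seed_space. pick (s ?c) = i}" by auto
  then show B: "?B \<in> sets seed_space" using A p by auto
  have E0: "0 < E" using pos by simp
  have pk: "pick x = grid (4 * E) x" for x using k2 by (simp add: pick_def)
  show "measure seed_space ?B \<le> hazard * measure seed_space ?A"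
  proof (rule resample_le[OF A B hazard_nonneg, where c = ?c])
    fix X :: seeds
    show "emeasure unit {x. X(?c := x) \<in> ?B} \<le> ennreal hazard * emeasure unit {x. X(?c := x) \<in> ?A}"
    proof (cases "\<exists>x0. X(?c := x0) \<in> ?A")
      case False
      then have e0: "{x. X(?c := x) \<in> ?B} = {}" by auto
      show ?thesis unfolding e0 by simp
    next
      case True
      then obtain x0 where x0: "X(?c := x0) \<in> ?A" by blast
      then obtain d pc where l0: "loc (A.G (X(?c := x0)) t) (scheduler e t) = Act k d pc" "window_index pc = Some i" by blast
      have in_A: "X(?c := x) \<in> ?A \<longleftrightarrow> i \<le> pick x" for x
      proof
        assume "X(?c := x) \<in> ?A"
        then obtain d pc where l: "loc (A.G (X(?c := x)) t) (scheduler e t) = Act k d pc" "window_index pc = Some i" by blast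
        from A.window_index_le[OF l] show "i \<le> pick x" by simp
      next
        assume x: "i \<le> pick x"
        have "A.G (X(?c := x)) r = A.G (X(?c := x0)) r" if "r \<le> t" for r
          using A.waiting_resample[OF l0 x that] run_upd[of "X(?c := x0)" ?c x r] by simp
        then have *: "\<forall>r\<le>t. A.G (X(?c := x0)) r = A.G (X(?c := x)) r" by simp
        show "X(?c := x) \<in> ?A"
          using detD[OF dA *] x0 by blast
      qed
      have 1: "{x. X(?c := x) \<in> ?A} = {x. i \<le> grid (4 * E) x}" using in_A pk by auto
      have "X(?c := x) \<in> ?B \<longleftrightarrow> X(?c := x) \<in> ?A \<and> pick x = i" for x by auto
      then have 2: "{x. X(?c := x) \<in> ?B} = {x. grid (4 * E) x = i}" using in_A pk by auto
      have i4: "i < 4 * E" "i < 3 * E" using i by (auto simp: window_def)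
      have "real i \<le> 3 * real E" using i4(2) by linarith
      then have "1 / real (4 * E) \<le> hazard * (1 - real i / real (4 * E))"
        using E0 by (simp add: hazard_def field_simps)
      then have "ennreal (1 / real (4 * E)) \<le> ennreal hazard * ennreal (1 - real i / real (4 * E))"
        using hazard_nonneg by (simp add: ennreal_mult'[symmetric] ennreal_leI)
      then show ?thesis unfolding 1 2 using grid_eq[of "4 * E" i] grid_ge[of "4 * E" i] i4 E0 by simp
    qed
  qed
qed

text \<open>Different window positions exclude each other, so the sum over them costs no factor
  \<open>window\<close>: the probabilities of the events \<open>?A i\<close> add up to at most that
  of the attempt being active.\<close>

lemma hazard_hit:
  assumes k2: "\<kappa> \<noteq> 1" and P: "determined t P"
  shows "measure seed_space {s. P s \<and> A.hit s t q k}
    \<le> hazard * measure seed_space {s. P s \<and> (\<exists>d pc. loc (A.G s t) q = Act k d pc)}"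
    and "{s. P s \<and> A.hit s t q k} \<in> sets seed_space"
proof -
  let ?A = "\<lambda>i. {s. P s \<and> (\<exists>d pc. loc (A.G s t) (scheduler e t) = Act k d pc \<and> window_index pc = Some i)}"
  let ?B = "\<lambda>i. {s. P s \<and> (\<exists>d pc. loc (A.G s t) (scheduler e t) = Act k d pc \<and> window_index pc = Some i) \<and>
      pick (s (scheduler e t, k)) = i}"
  let ?S = "{s. P s \<and> (\<exists>d pc. loc (A.G s t) q = Act k d pc)}"
  have sA: "?A i \<in> sets seed_space" for i
    by (rule determined_sets[of t], rule determined_conj[OF P]) (auto simp: determined_def)
  have sS: "?S \<in> sets seed_space"
    by (rule determined_sets[of t], rule determined_conj[OF P]) (auto simp: determined_def)
  have "{s. P s \<and> A.hit s t q k} = (if scheduler e t = q then (\<Union>i<window. ?B i) else {})"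
  proof (intro set_eqI iffI)
    fix s assume "s \<in> {s. P s \<and> A.hit s t q k}"
    then obtain d pc where h: "P s" "scheduler e t = q" "loc (A.G s t) q = Act k d pc" "window_index pc = Some (pick (s (q, k)))"
      unfolding A.hit_def by blast
    then have "pick (s (q, k)) < window" using window_index_window A.pc_okD by blast
    then show "s \<in> (if scheduler e t = q then (\<Union>i<window. ?B i) else {})" using h by auto
  next
    fix s assume "s \<in> (if scheduler e t = q then (\<Union>i<window. ?B i) else {})"
    then show "s \<in> {s. P s \<and> A.hit s t q k}" unfolding A.hit_def by (auto split: if_splits)
  qed
  note eq = this
  show "{s. P s \<and> A.hit s t q k} \<in> sets seed_space"
    unfolding eq using hazard_index(2)[OF k2 P] by auto
  show "measure seed_space {s. P s \<and> A.hit s t q k} \<le> hazard * measure seed_space ?S"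
  proof (cases "scheduler e t = q")
    case True
    have "measure seed_space (\<Union>i<window. ?B i) \<le> (\<Sum>i<window. measure seed_space (?B i))"
      using hazard_index(2)[OF k2 P] by (intro seed_space.finite_measure_subadditive_finite) auto
    also have "\<dots> \<le> (\<Sum>i<window. hazard * measure seed_space (?A i))"
      using hazard_index(1)[OF k2 P] by (intro sum_mono) auto
    also have "\<dots> = hazard * (\<Sum>i<window. measure seed_space (?A i))" by (simp add: sum_distrib_left)
    also have "(\<Sum>i<window. measure seed_space (?A i)) \<le> real 1 * measure seed_space ?S"
    proof (rule sum_measure_le_count[OF _ sS sA])
      fix s
      have "{i \<in> {..<window}. s \<in> ?A i} \<subseteq> {the (case loc (A.G s t) (scheduler e t) of Act k d pc \<Rightarrow> window_index pc)}"
        by auto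
      then show "card {i \<in> {..<window}. s \<in> ?A i} \<le> 1" by (metis (lifting) card_mono finite.emptyI finite_insert is_singletonI is_singleton_altdef)
    qed (use True in auto)
    finally show ?thesis using True hazard_nonneg unfolding eq by (simp add: mult_left_mono)
  qed (simp add: eq hazard_nonneg)
qed

lemma determined_trigger_step: "determined (Suc t) (\<lambda>s. A.trigger_step s t)"
  unfolding determined_def
proof (intro allI impI)
  fix s s' assume "\<forall>r\<le>Suc t. A.G s r = A.G s' r" "A.trigger_step s t"
  then show "A.trigger_step s' t" unfolding A.trigger_step_iff by simp
qed

text \<open>The number of the attempt that the process is on is random too. At most one number is
  active at time \<open>t\<close>, so summing over it again costs no factor.\<close>

lemma hazard_trigger_step:
  assumes k2: "\<kappa> \<noteq> 1" and P: "determined t P"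
  shows "measure seed_space {s. P s \<and> A.trigger_step s t} \<le> hazard * measure seed_space {s. P s}"
proof -
  let ?q = "scheduler e t"
  let ?A = "\<lambda>k. {s. P s \<and> (\<exists>d pc. loc (A.G s t) ?q = Act k d pc)}"
  have sA: "?A i \<in> sets seed_space" for i
    by (rule determined_sets[of t], rule determined_conj[OF P]) (auto simp: determined_def)
  have sub: "{s. P s \<and> A.trigger_step s t} \<subseteq> (\<Union>k<t. {s. P s \<and> A.hit s t ?q k})"
  proof
    fix s assume s: "s \<in> {s. P s \<and> A.trigger_step s t}"
    then obtain k where k: "A.triggers s t ?q k" unfolding A.trigger_step_def by blast
    then obtain d pc where "loc (A.G s t) ?q = Act k d pc" unfolding A.triggers_def by blast
    then have "k < t" by (rule A.attempt_le)
    then show "s \<in> (\<Union>k<t. {s. P s \<and> A.hit s t ?q k})" using s A.triggers_hit[OF k] by blast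
  qed
  have "measure seed_space {s. P s \<and> A.trigger_step s t} \<le> measure seed_space (\<Union>k<t. {s. P s \<and> A.hit s t ?q k})"
    using hazard_hit(2)[OF k2 P] by (intro seed_space.finite_measure_mono[OF sub]) auto
  also have "\<dots> \<le> (\<Sum>k<t. measure seed_space {s. P s \<and> A.hit s t ?q k})"
    using hazard_hit(2)[OF k2 P] by (intro seed_space.finite_measure_subadditive_finite) auto
  also have "\<dots> \<le> (\<Sum>k<t. hazard * measure seed_space (?A k))"
    using hazard_hit(1)[OF k2 P] by (intro sum_mono) auto
  also have "\<dots> = hazard * (\<Sum>k<t. measure seed_space (?A k))" by (simp add: sum_distrib_left)
  also have "(\<Sum>k<t. measure seed_space (?A k)) \<le> real 1 * measure seed_space {s. P s}"
  proof (rule sum_measure_le_count[OF _ determined_sets[OF P] sA])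
    fix s
    have "{k \<in> {..<t}. s \<in> ?A k} \<subseteq> {case loc (A.G s t) ?q of Act k d pc \<Rightarrow> k}"
      by auto
    then show "card {k \<in> {..<t}. s \<in> ?A k} \<le> 1" by (metis (lifting) card_mono finite.emptyI finite_insert is_singletonI is_singleton_altdef)
  qed auto
  finally show ?thesis using hazard_nonneg by (simp add: mult_left_mono)
qed

end

section \<open>Fairness\<close>

lemma nsteps_exists:
  assumes "infinite {t. P t}"
  shows "\<exists>b\<ge>a. nsteps P a b = n"
proof (induction n)
  case 0
  show ?case by (intro exI[of _ a]) simp
next
  case (Suc n)
  then obtain b where b: "a \<le> b" "nsteps P a b = n" by blast
  have "\<exists>r\<ge>b. P r" using assms by (metis infinite_nat_iff_unbounded_le mem_Collect_eq)
  define r where "r = (LEAST r. b \<le> r \<and> P r)"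
  have r: "b \<le> r \<and> P r" unfolding r_def by (rule LeastI_ex) fact
  have "nsteps P a r = n"
  proof -
    have "\<not> P r'" if "b \<le> r'" "r' < r" for r'
      using not_less_Least[of r' "\<lambda>r. b \<le> r \<and> P r"] that r_def by auto
    then have "{r'. a \<le> r' \<and> r' < r \<and> P r'} = {r'. a \<le> r' \<and> r' < b \<and> P r'}"
      using r b(1) by (auto intro: leI)
    then show ?thesis using b(2) by (simp add: nsteps_def)
  qed
  then show ?case using r b(1) by (intro exI[of _ "Suc r"]) (simp add: nsteps_Suc)
qed

context algo_env
begin

lemma start_pc:
  assumes "sch t0 = p" "loc (G t0) p = Idl" "loc (G (Suc t0)) p = Act m d pc"
  shows "rank pc < bound" "m = length (outcomes p (tr (G t0)))"
proof -
  show "rank pc < bound" "m = length (outcomes p (tr (G t0)))"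
    by (cases t0 rule: step_cases; use assms rank_start hist_Idl[OF assms(2)] in auto)+
qed

lemma start_finished:
  assumes "sch t0 = p" "loc (G t0) p = Idl" "loc (G (Suc t0)) p = Act m d pc"
    and "Suc t0 \<le> t1" "nsteps (\<lambda>r. sch r = p) (Suc t0) t1 = bound"
  shows "m < length (outcomes p (tr (G t1)))"
  using run_rank[OF assms(3,4)] start_pc(1)[OF assms(1-3)] assms(5) by auto

lemma attempt_start:
  assumes "m < num_attempts q (tr (G t))"
  obtains t0 d pc where "t0 < t" "sch t0 = q" "loc (G t0) q = Idl" "loc (G (Suc t0)) q = Act m d pc"
proof -
  have "m < num_attempts q (tr (G t)) \<Longrightarrow>
    \<exists>t0 d pc. t0 < t \<and> sch t0 = q \<and> loc (G t0) q = Idl \<and> loc (G (Suc t0)) q = Act m d pc"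
  proof (induction t)
    case (Suc t)
    show ?case
    proof (cases "m < num_attempts q (tr (G t))")
      case True
      then show ?thesis using Suc.IH less_SucI by blast
    next
      case False
      show ?thesis
      proof (cases t rule: step_cases)
        case (invoke ls th)
        then have "sch t = q" "m = num_attempts q (tr (G t))"
          using Suc.prems False by (auto simp: num_attempts_append split: if_splits)
        then show ?thesis using invoke by (intro exI[of _ t]) auto
      qed (use Suc.prems False in \<open>auto simp: num_attempts_append\<close>)
    qed
  qed simp
  then show thesis using that assms by blast
qed

end

context algo
begin

text \<open>One summand for each case of \<open>lose_pair\<close>: contentions shortly before
  \<open>t\<close>, shortly before the previous step, and behind \<open>t\<close>.\<close>

definition pairs :: nat where
  "pairs = \<kappa> * L * help_cost + \<kappa> * L * help_cost + \<kappa> * L * Suc scan_cost"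

end

section \<open>The probability of losing one attempt\<close>

context lock_env
begin

definition start :: "proc \<Rightarrow> nat \<Rightarrow> bool list \<Rightarrow> nat \<Rightarrow> seeds \<Rightarrow> bool" where
  "start p m bs t0 s \<longleftrightarrow> scheduler e t0 = p \<and> loc (A.G s t0) p = Idl \<and>
     (\<exists>d pc. loc (A.G s (Suc t0)) p = Act m d pc) \<and> outcomes p (tr (A.G s t0)) = bs"

definition own :: "proc \<Rightarrow> nat \<Rightarrow> seeds \<Rightarrow> desc" where
  "own p t0 s = (case loc (A.G s (Suc t0)) p of Act k d pc \<Rightarrow> d | Idl \<Rightarrow> undefined)"

lemma determined_start: "determined (Suc t0) (start p m bs t0)"
  unfolding determined_def start_def by simp

lemma own_cong: "A.G s (Suc t0) = A.G s' (Suc t0) \<Longrightarrow> own p t0 s = own p t0 s'"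
  by (simp add: own_def)

text \<open>\<open>R\<close> may lie far beyond \<open>s'\<close>. Apart from the state at
  \<open>s'\<close> and the descriptor fixed at \<open>Suc t0\<close>, \<open>before\<close> looks
  only at the schedule, which is not random.\<close>

lemma determined_before:
  assumes "Suc t0 \<le> s'"
  shows "determined s' (\<lambda>s. start p m bs t0 s \<and> A.before s (own p t0 s) R s')"
proof (rule determined_conj[OF determined_mono[OF determined_start assms]])
  show "determined s' (\<lambda>s. A.before s (own p t0 s) R s')"
    unfolding determined_def
  proof (intro allI impI)
    fix s1 s2 assume *: "\<forall>r\<le>s'. A.G s1 r = A.G s2 r" "A.before s1 (own p t0 s1) R s'"
    have "own p t0 s1 = own p t0 s2" using *(1) assms by (intro own_cong) simp
    then show "A.before s2 (own p t0 s2) R s'" using * unfolding A.before_def by simp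
  qed
qed

lemma determined_behind:
  assumes "Suc t0 \<le> X" "X < s'"
  shows "determined s' (\<lambda>s. A.behind s (own p t0 s) X s')"
  unfolding determined_def
proof (intro allI impI)
  fix s1 s2 assume *: "\<forall>r\<le>s'. A.G s1 r = A.G s2 r" "A.behind s1 (own p t0 s1) X s'"
  have o: "own p t0 s1 = own p t0 s2" using *(1) assms by (intro own_cong) simp
  have st: "A.steady_at s1 q r = A.steady_at s2 q r" if "r \<le> s'" for q r
    using *(1) that unfolding A.steady_at_def by simp
  have "nsteps (A.steady_at s1 q) (Suc X) s' = nsteps (A.steady_at s2 q) (Suc X) s'" for q
    unfolding nsteps_def using st by (intro arg_cong[where f = card]) auto
  then show "A.behind s2 (own p t0 s2) X s'" using * o assms(2) unfolding A.behind_def by simp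
qed

text \<open>The later event is peeled off first. Given the past of \<open>t\<close>, which contains
  the trigger at \<open>s'\<close>, the attempt strikes with probability at most
  \<open>hazard\<close>; then the trigger is bounded given the past of \<open>s'\<close>. What
  remains is the expected number of candidate steps, bounded by \<open>card_before\<close>.\<close>

lemma before_prob:
  assumes k2: "\<kappa> \<noteq> 1"
  shows "(\<Sum>s'\<in>{t0<..<t}. measure seed_space
      {s. ((start p m bs t0 s \<and> A.before s (own p t0 s) R s') \<and> A.trigger_step s s') \<and> A.hit s t p m})
    \<le> hazard * (hazard * (real (\<kappa> * L * help_cost) * measure seed_space {s. start p m bs t0 s}))"
proof -
  let ?P = "\<lambda>s' s. start p m bs t0 s \<and> A.before s (own p t0 s) R s'"
  have S: "{s. start p m bs t0 s} \<in> sets seed_space" by (rule determined_sets[OF determined_start])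
  have "measure seed_space {s. (?P s' s \<and> A.trigger_step s s') \<and> A.hit s t p m}
      \<le> hazard * (hazard * measure seed_space {s. ?P s' s})" if s': "s' \<in> {t0<..<t}" for s'
  proof -
    have dP: "determined s' (?P s')" using s' by (intro determined_before) simp
    have dT: "determined t (\<lambda>s. ?P s' s \<and> A.trigger_step s s')"
      using s' by (intro determined_conj determined_mono[OF dP] determined_mono[OF determined_trigger_step]) auto
    have sT: "{s. ?P s' s \<and> A.trigger_step s s'} \<in> sets seed_space" by (rule determined_sets[OF dT])
    have "measure seed_space {s. (?P s' s \<and> A.trigger_step s s') \<and> A.hit s t p m}
       \<le> hazard * measure seed_space {s. (?P s' s \<and> A.trigger_step s s') \<and> (\<exists>d pc. loc (A.G s t) p = Act m d pc)}"
      by (rule hazard_hit(1)[OF k2 dT])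
    also have "\<dots> \<le> hazard * measure seed_space {s. ?P s' s \<and> A.trigger_step s s'}"
      using hazard_nonneg sT by (intro mult_left_mono seed_space.finite_measure_mono) auto
    also have "\<dots> \<le> hazard * (hazard * measure seed_space {s. ?P s' s})"
      using hazard_nonneg hazard_trigger_step[OF k2 dP] by (intro mult_left_mono) auto
    finally show ?thesis .
  qed
  then have "(\<Sum>s'\<in>{t0<..<t}. measure seed_space {s. (?P s' s \<and> A.trigger_step s s') \<and> A.hit s t p m})
      \<le> (\<Sum>s'\<in>{t0<..<t}. hazard * (hazard * measure seed_space {s. ?P s' s}))"
    by (intro sum_mono)
  also have "\<dots> = hazard * (hazard * (\<Sum>s'\<in>{t0<..<t}. measure seed_space {s. ?P s' s}))"
    by (simp add: sum_distrib_left)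
  also have "(\<Sum>s'\<in>{t0<..<t}. measure seed_space {s. ?P s' s}) \<le>
      real (\<kappa> * L * help_cost) * measure seed_space {s. start p m bs t0 s}"
  proof (rule sum_measure_le_count[OF _ S])
    fix s' assume "s' \<in> {t0<..<t}"
    then show "{s. ?P s' s} \<in> sets seed_space" by (intro determined_sets[of s'] determined_before) simp
  next
    fix x
    have "card {s'. A.before x (own p t0 x) R s'} \<le> \<kappa> * L * help_cost" "finite {s'. A.before x (own p t0 x) R s'}"
      using A.card_before[of x "own p t0 x" R] by auto
    moreover have "{i \<in> {t0<..<t}. x \<in> {s. ?P i s}} \<subseteq> {s'. A.before x (own p t0 x) R s'}" by auto
    ultimately show "card {i \<in> {t0<..<t}. x \<in> {s. ?P i s}} \<le> \<kappa> * L * help_cost"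
      by (meson card_mono le_trans)
  qed auto
  finally show ?thesis using hazard_nonneg by (simp add: mult_left_mono)
qed

text \<open>The order is reversed, as the attempt now contends first. \<open>triggers\<close> stands
  in for \<open>hit\<close> because it is determined at \<open>Suc t\<close>, as conditioning the
  later steps requires; it is relaxed to \<open>hit\<close> at the end.\<close>

lemma behind_prob:
  assumes k2: "\<kappa> \<noteq> 1" and t: "t0 < t"
  shows "(\<Sum>s'\<in>{t<..<t1}. measure seed_space
      {s. ((start p m bs t0 s \<and> A.triggers s t p m) \<and> A.behind s (own p t0 s) t s') \<and> A.trigger_step s s'})
    \<le> hazard * (real (\<kappa> * L * Suc scan_cost) * (hazard * measure seed_space {s. start p m bs t0 s}))"
proof -
  let ?S = "\<lambda>s. start p m bs t0 s \<and> A.triggers s t p m"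
  have dS0: "determined t (start p m bs t0)" using t by (intro determined_mono[OF determined_start]) simp
  have dS: "determined (Suc t) ?S"
  proof (rule determined_conj)
    show "determined (Suc t) (start p m bs t0)" using dS0 by (rule determined_mono) simp
    show "determined (Suc t) (\<lambda>s. A.triggers s t p m)"
      using determined_trigger_step[of t] unfolding determined_def A.triggers_iff by (metis le_SucI order_refl)
  qed
  have S: "{s. ?S s} \<in> sets seed_space" by (rule determined_sets[OF dS])
  have dP: "determined s' (\<lambda>s. ?S s \<and> A.behind s (own p t0 s) t s')" if "s' \<in> {t<..<t1}" for s'
    using that t by (intro determined_conj[OF determined_mono[OF dS] determined_behind]) auto
  have "(\<Sum>s'\<in>{t<..<t1}. measure seed_space {s. (?S s \<and> A.behind s (own p t0 s) t s') \<and> A.trigger_step s s'})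
    \<le> (\<Sum>s'\<in>{t<..<t1}. hazard * measure seed_space {s. ?S s \<and> A.behind s (own p t0 s) t s'})"
    by (intro sum_mono hazard_trigger_step[OF k2 dP])
  also have "\<dots> = hazard * (\<Sum>s'\<in>{t<..<t1}. measure seed_space {s. ?S s \<and> A.behind s (own p t0 s) t s'})"
    by (simp add: sum_distrib_left)
  also have "(\<Sum>s'\<in>{t<..<t1}. measure seed_space {s. ?S s \<and> A.behind s (own p t0 s) t s'})
    \<le> real (\<kappa> * L * Suc scan_cost) * measure seed_space {s. ?S s}"
  proof (rule sum_measure_le_count[OF _ S])
    fix s' assume "s' \<in> {t<..<t1}"
    then show "{s. ?S s \<and> A.behind s (own p t0 s) t s'} \<in> sets seed_space" by (rule determined_sets[OF dP])
  next
    fix x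
    have "card {s'. A.behind x (own p t0 x) t s'} \<le> \<kappa> * L * Suc scan_cost" "finite {s'. A.behind x (own p t0 x) t s'}"
      using A.card_behind[of x "own p t0 x" t] by auto
    moreover have "{i \<in> {t<..<t1}. x \<in> {s. ?S s \<and> A.behind s (own p t0 s) t i}} \<subseteq> {s'. A.behind x (own p t0 x) t s'}"
      by auto
    ultimately show "card {i \<in> {t<..<t1}. x \<in> {s. ?S s \<and> A.behind s (own p t0 s) t i}} \<le> \<kappa> * L * Suc scan_cost"
      by (meson card_mono le_trans)
  qed auto
  also have "measure seed_space {s. ?S s} \<le> hazard * measure seed_space {s. start p m bs t0 s}"
  proof -
    have "measure seed_space {s. ?S s} \<le> measure seed_space {s. start p m bs t0 s \<and> A.hit s t p m}"
      using hazard_hit(2)[OF k2 dS0] A.triggers_hit by (intro seed_space.finite_measure_mono) auto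
    also have "\<dots> \<le> hazard * measure seed_space {s. start p m bs t0 s \<and> (\<exists>d pc. loc (A.G s t) p = Act m d pc)}"
      by (rule hazard_hit(1)[OF k2 dS0])
    also have "\<dots> \<le> hazard * measure seed_space {s. start p m bs t0 s}"
      using hazard_nonneg determined_sets[OF determined_start] by (intro mult_left_mono seed_space.finite_measure_mono) auto
    finally show ?thesis .
  qed
  finally show ?thesis using hazard_nonneg by (simp add: mult_left_mono)
qed

text \<open>By \<open>start_resample\<close> the run up to the start has not consulted this seed,
  which is therefore still uniform; a quarter of its grid lies beyond the window.\<close>

lemma no_contention_prob:
  assumes k2: "\<kappa> \<noteq> 1"
  shows "measure seed_space {s. start p m bs t0 s \<and> window \<le> pick (s (p, m))} \<le>
      1 / 4 * measure seed_space {s. start p m bs t0 s}"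
    "{s. start p m bs t0 s \<and> window \<le> pick (s (p, m))} \<in> sets seed_space"
proof -
  let ?A = "{s. start p m bs t0 s}" and ?B = "{s. start p m bs t0 s \<and> window \<le> pick (s (p, m))}"
  have A: "?A \<in> sets seed_space" by (rule determined_sets[OF determined_start])
  have pS: "{s \<in> space seed_space. window \<le> pick (s (p, m))} \<in> sets seed_space"
    unfolding seed_space_unit by measurable
  have "?B = ?A \<inter> {s \<in> space seed_space. window \<le> pick (s (p, m))}" by auto
  then show B: "?B \<in> sets seed_space" using A pS by auto
  have E0: "0 < E" using pos by simp
  have pk: "pick x = grid (4 * E) x" for x using k2 by (simp add: pick_def)
  interpret U: prob_space unit by (rule prob_space_unit)
  show "measure seed_space ?B \<le> 1 / 4 * measure seed_space ?A"
  proof (rule resample_le[OF A B, where c = "(p, m)"])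
    fix X :: seeds
    show "emeasure unit {x. X((p, m) := x) \<in> ?B} \<le> ennreal (1 / 4) * emeasure unit {x. X((p, m) := x) \<in> ?A}"
    proof (cases "\<exists>x0. X((p, m) := x0) \<in> ?A")
      case False
      then have e0: "{x. X((p, m) := x) \<in> ?B} = {}" by auto
      show ?thesis unfolding e0 by simp
    next
      case True
      then obtain x0 where x0: "start p m bs t0 (X((p, m) := x0))" by blast
      then obtain d pc where l: "loc (A.G (X((p, m) := x0)) t0) p = Idl"
        "loc (A.G (X((p, m) := x0)) (Suc t0)) p = Act m d pc" unfolding start_def by blast
      have "start p m bs t0 (X((p, m) := x))" for x
      proof (rule detD[OF determined_start _ x0], intro allI impI)
        fix r assume "r \<le> Suc t0"
        from A.start_resample[OF l this, of "pick x"]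
        show "A.G (X((p, m) := x0)) r = A.G (X((p, m) := x)) r"
          using run_upd[of "X((p, m) := x0)" "(p, m)" x r] by simp
      qed
      then have 1: "{x. X((p, m) := x) \<in> ?A} = UNIV"
        and 2: "{x. X((p, m) := x) \<in> ?B} = {x. window \<le> grid (4 * E) x}" by (auto simp: pk)
      have "emeasure unit {x. window \<le> grid (4 * E) x} = ennreal (1 - real window / real (4 * E))"
        using E0 by (intro grid_ge) (auto simp: window_def)
      also have "1 - real window / real (4 * E) = 1 / 4" using E0 by (simp add: window_def field_simps)
      finally show ?thesis unfolding 1 2 using U.emeasure_space_1 by simp
    qed
  qed simp
qed

text \<open>The time \<open>t1\<close>, by which the attempt has responded, is known in advance
  because the schedule is fixed. So the union bound ranges over a set of times that is not
  random.\<close>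

lemma lose_prob:
  assumes k2: "\<kappa> \<noteq> 1" and t1: "Suc t0 \<le> t1" "nsteps (\<lambda>r. scheduler e r = p) (Suc t0) t1 = bound"
    and cond: "4 * bound * pairs \<le> E\<^sup>2"
  shows "measure seed_space {s. start p m bs t0 s \<and> \<not> outcomes p (tr (A.G s t1)) ! m} \<le>
      1 / 2 * measure seed_space {s. start p m bs t0 s}"
proof -
  let ?S = "{s. start p m bs t0 s}"
  let ?\<mu> = "measure seed_space ?S"
  \<comment> \<open>Hits occur at own steps only, and exactly \<open>bound\<close> of these lie
    before \<open>t1\<close>; the number of all times up to \<open>t1\<close> has no bound.\<close>
  let ?\<Theta> = "{t. Suc t0 \<le> t \<and> t < t1 \<and> scheduler e t = p}"
  define X0 where "X0 = {s. start p m bs t0 s \<and> window \<le> pick (s (p, m))}"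
  define B where "B R t s' = {s. ((start p m bs t0 s \<and> A.before s (own p t0 s) R s') \<and> A.trigger_step s s') \<and> A.hit s t p m}"
    for R t s'
  define C where "C t s' = {s. ((start p m bs t0 s \<and> A.triggers s t p m) \<and> A.behind s (own p t0 s) t s') \<and> A.trigger_step s s'}"
    for t s'
  have fin: "finite ?\<Theta>" using finite_nsteps[of "Suc t0" t1 "\<lambda>t. scheduler e t = p"] by simp
  have cardT: "card ?\<Theta> = bound" using t1(2) unfolding nsteps_def by simp
  have sB: "B R t s' \<in> sets seed_space" if "t0 < s'" "s' < t" for R t s'
    unfolding B_def using that
    by (intro hazard_hit(2)[OF k2] determined_conj determined_mono[OF determined_before[of t0 s']] determined_mono[OF determined_trigger_step]) auto
  have sC: "C t s' \<in> sets seed_space" if "t0 < t" "t < s'" for t s'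
  proof -
    have "determined (Suc t) (\<lambda>s. A.triggers s t p m)"
      using determined_trigger_step[of t] unfolding determined_def A.triggers_iff by (metis le_SucI order_refl)
    then show ?thesis unfolding C_def using that
      by (intro determined_sets[of "Suc s'"] determined_conj determined_mono[OF determined_start] determined_mono[OF determined_behind[of t0 t s']] determined_trigger_step)
        (auto elim: determined_mono)
  qed
  have U: "{s. start p m bs t0 s \<and> \<not> outcomes p (tr (A.G s t1)) ! m} \<subseteq>
    X0 \<union> (\<Union>t\<in>?\<Theta>. (\<Union>s'\<in>{t0<..<t}. B t t s') \<union> (\<Union>s'\<in>{t0<..<t}. B (A.previous_step p t) t s') \<union> (\<Union>s'\<in>{t<..<t1}. C t s'))"
  proof
    fix s assume s: "s \<in> {s. start p m bs t0 s \<and> \<not> outcomes p (tr (A.G s t1)) ! m}"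
    then obtain d pc where st: "start p m bs t0 s" "scheduler e t0 = p" "loc (A.G s t0) p = Idl"
      "loc (A.G s (Suc t0)) p = Act m d pc" unfolding start_def by blast
    have d: "own p t0 s = d" using st(4) by (simp add: own_def)
    show "s \<in> X0 \<union> (\<Union>t\<in>?\<Theta>. (\<Union>s'\<in>{t0<..<t}. B t t s') \<union> (\<Union>s'\<in>{t0<..<t}. B (A.previous_step p t) t s') \<union> (\<Union>s'\<in>{t<..<t1}. C t s'))"
    proof (cases "pick (s (p, m)) < window")
      case False
      then show ?thesis using st(1) by (auto simp: X0_def)
    next
      case True
      have fini: "m < length (outcomes p (tr (A.G s t1)))"
        by (rule A.start_finished[OF st(2-4) t1])
      from A.lose_pair[OF st(2-4) True fini] s obtain t s' where
        t: "t0 < t" "t < t1" "A.hit s t p m" "t0 < s'" "s' < t1" "A.trigger_step s s'"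
        and or: "A.before s d t s' \<or> A.before s d (A.previous_step p t) s' \<and> A.previous_step p t < t \<or> A.triggers s t p m \<and> A.behind s d t s'"
        by blast
      have T: "t \<in> ?\<Theta>" using t unfolding A.hit_def by auto
      from or consider "A.before s d t s'" | "A.before s d (A.previous_step p t) s'" "A.previous_step p t < t"
        | "A.triggers s t p m" "A.behind s d t s'" by blast
      then show ?thesis
      proof cases
        case 1
        then have "s' < t" by (simp add: A.before_def)
        then have "s \<in> (\<Union>s'\<in>{t0<..<t}. B t t s')" using 1 st(1) t d by (auto simp: B_def)
        then show ?thesis using T by blast
      next
        case 2
        then have "s' < t" by (simp add: A.before_def)
        then have "s \<in> (\<Union>s'\<in>{t0<..<t}. B (A.previous_step p t) t s')" using 2 st(1) t d by (auto simp: B_def)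
        then show ?thesis using T by blast
      next
        case 3
        then have "t < s'" by (simp add: A.behind_def)
        then have "s \<in> (\<Union>s'\<in>{t<..<t1}. C t s')" using 3 st(1) t d by (auto simp: C_def)
        then show ?thesis using T by blast
      qed
    qed
  qed
  let ?W = "\<lambda>t. (\<Union>s'\<in>{t0<..<t}. B t t s') \<union> (\<Union>s'\<in>{t0<..<t}. B (A.previous_step p t) t s') \<union> (\<Union>s'\<in>{t<..<t1}. C t s')"
  have sW1: "(\<Union>s'\<in>{t0<..<t}. B R t s') \<in> sets seed_space" for R t
    using sB by (intro sets.finite_UN) auto
  have sW2: "(\<Union>s'\<in>{t<..<t1}. C t s') \<in> sets seed_space" if "t \<in> ?\<Theta>" for t
    using sC that by (intro sets.finite_UN) auto
  have W: "measure seed_space (?W t) \<le> hazard * (hazard * (real pairs * ?\<mu>))" if T: "t \<in> ?\<Theta>" for t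
  proof -
    have b: "measure seed_space (\<Union>s'\<in>{t0<..<t}. B R t s') \<le> hazard * (hazard * (real (\<kappa> * L * help_cost) * ?\<mu>))" for R
    proof -
      have "measure seed_space (\<Union>s'\<in>{t0<..<t}. B R t s') \<le> (\<Sum>s'\<in>{t0<..<t}. measure seed_space (B R t s'))"
        using sB by (intro seed_space.finite_measure_subadditive_finite) auto
      also have "\<dots> \<le> hazard * (hazard * (real (\<kappa> * L * help_cost) * ?\<mu>))"
        unfolding B_def by (rule before_prob[OF k2])
      finally show ?thesis .
    qed
    have c: "measure seed_space (\<Union>s'\<in>{t<..<t1}. C t s') \<le> hazard * (real (\<kappa> * L * Suc scan_cost) * (hazard * ?\<mu>))"
    proof -
      have "measure seed_space (\<Union>s'\<in>{t<..<t1}. C t s') \<le> (\<Sum>s'\<in>{t<..<t1}. measure seed_space (C t s'))"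
        using sC T by (intro seed_space.finite_measure_subadditive_finite) auto
      also have "\<dots> \<le> hazard * (real (\<kappa> * L * Suc scan_cost) * (hazard * ?\<mu>))"
        unfolding C_def using T by (intro behind_prob[OF k2]) simp
      finally show ?thesis .
    qed
    have "measure seed_space (?W t) \<le> measure seed_space ((\<Union>s'\<in>{t0<..<t}. B t t s') \<union> (\<Union>s'\<in>{t0<..<t}. B (A.previous_step p t) t s'))
        + measure seed_space (\<Union>s'\<in>{t<..<t1}. C t s')"
      by (rule measure_Un_le) (use sW1 sW2[OF T] in auto)
    also have "measure seed_space ((\<Union>s'\<in>{t0<..<t}. B t t s') \<union> (\<Union>s'\<in>{t0<..<t}. B (A.previous_step p t) t s'))
       \<le> measure seed_space (\<Union>s'\<in>{t0<..<t}. B t t s') + measure seed_space (\<Union>s'\<in>{t0<..<t}. B (A.previous_step p t) t s')"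
      by (rule measure_Un_le) (use sW1 in auto)
    finally show ?thesis using b[of t] b[of "A.previous_step p t"] c by (simp add: pairs_def algebra_simps)
  qed
  have sW: "?W t \<in> sets seed_space" if "t \<in> ?\<Theta>" for t
    using sW1 sW2[OF that] by auto
  have sX: "X0 \<in> sets seed_space" unfolding X0_def by (rule no_contention_prob(2)[OF k2])
  have sWU: "(\<Union>t\<in>?\<Theta>. ?W t) \<in> sets seed_space" using sW fin by (intro sets.finite_UN) auto
  have "measure seed_space {s. start p m bs t0 s \<and> \<not> outcomes p (tr (A.G s t1)) ! m} \<le>
      measure seed_space (X0 \<union> (\<Union>t\<in>?\<Theta>. ?W t))"
    by (rule seed_space.finite_measure_mono[OF U]) (use sX sWU in auto)
  also have "\<dots> \<le> measure seed_space X0 + measure seed_space (\<Union>t\<in>?\<Theta>. ?W t)"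
    by (rule measure_Un_le[OF sX sWU])
  also have "measure seed_space (\<Union>t\<in>?\<Theta>. ?W t) \<le> (\<Sum>t\<in>?\<Theta>. measure seed_space (?W t))"
    using sW by (intro seed_space.finite_measure_subadditive_finite[OF fin]) auto
  also have "\<dots> \<le> (\<Sum>t\<in>?\<Theta>. hazard * (hazard * (real pairs * ?\<mu>)))"
    by (rule sum_mono[OF W])
  also have "\<dots> = (hazard * hazard * real (bound * pairs)) * ?\<mu>" by (simp add: cardT)
  also have "\<dots> \<le> 1 / 4 * ?\<mu>"
  proof (rule mult_right_mono)
    have "4 * real (bound * pairs) \<le> real E * real E"
      using cond by (metis mult.assoc of_nat_le_iff of_nat_mult of_nat_numeral power2_eq_square)
    then show "hazard * hazard * real (bound * pairs) \<le> 1 / 4"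
      using pos by (simp add: hazard_def field_simps)
  qed simp
  also have "measure seed_space X0 \<le> 1 / 4 * ?\<mu>"
    unfolding X0_def by (rule no_contention_prob(1)[OF k2])
  finally show ?thesis by simp
qed

text \<open>Index 0 lies in the window, so a loss would exhibit two active attempts on a common lock
  by \<open>lose_pair\<close>.\<close>

lemma lose_impossible:
  assumes "\<kappa> = 1" "start p m bs t0 s" "Suc t0 \<le> t1" "nsteps (\<lambda>r. scheduler e r = p) (Suc t0) t1 = bound"
  shows "outcomes p (tr (A.G s t1)) ! m"
proof (rule ccontr)
  assume n: "\<not> outcomes p (tr (A.G s t1)) ! m"
  obtain d pc where st: "scheduler e t0 = p" "loc (A.G s t0) p = Idl"
      "loc (A.G s (Suc t0)) p = Act m d pc" using assms(2) unfolding start_def by blast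
  have "pick (s (p, m)) = 0" unfolding pick_def using assms(1) by simp
  then have "pick (s (p, m)) < window" using A.window_pos by simp
  from A.lose_pair[OF st this A.start_finished[OF st assms(3,4)] n] assms(1) show False by simp
qed

end

section \<open>Wait-freedom\<close>

lemma operation_steps_snoc:
  "operation_steps p k (h @ [(q, s)]) = operation_steps p k h +
     (if q = p \<and> k < num_attempts p (h @ [(q, s)]) \<and> True \<notin> set (drop k (outcomes p h)) then 1 else 0)"
proof -
  let ?P = "\<lambda>h j. fst (h ! j) = p \<and> k < num_attempts p (take (Suc j) h) \<and>
     True \<notin> set (drop k (outcomes p (take j h)))"
  let ?h = "h @ [(q, s)]"
  have "{j. j < length ?h \<and> ?P ?h j} = {j. j < length h \<and> ?P h j} \<union> (if ?P ?h (length h) then {length h} else {})"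
    by (auto simp: nth_append less_Suc_eq split: if_splits)
  moreover have "finite {j. j < length h \<and> ?P h j}" by simp
  moreover have "?P ?h (length h) \<longleftrightarrow> q = p \<and> k < num_attempts p ?h \<and> True \<notin> set (drop k (outcomes p h))"
    by simp
  ultimately show ?thesis unfolding operation_steps_def by (auto simp: card_insert_if)
qed

lemma operation_steps_Nil [simp]: "operation_steps p k [] = 0"
  by (simp add: operation_steps_def)

lemma num_attempts_outcomes_set:
  assumes "k \<le> n" "n < length os" "True \<notin> set (drop k (take (Suc n) os))"
  shows "\<not> os ! n"
proof
  assume "os ! n"
  have "take (Suc n) os ! n \<in> set (drop k (take (Suc n) os))"
    using assms(1,2) by (auto simp: in_set_conv_nth intro!: exI[of _ "n - k"])
  with \<open>os ! n\<close> show False using assms(3) by simp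
qed

context algo_env
begin

lemma num_attempts_bounds:
  "length (outcomes q (tr (G t))) \<le> num_attempts q (tr (G t))"
  "num_attempts q (tr (G t)) \<le> Suc (length (outcomes q (tr (G t))))"
  using hist_loc[where t = t and q = q] by (auto split: proc_state.splits)

text \<open>Contains also the attempt that finally succeeds, since only the outcomes before
  \<open>n\<close> have to be failures. Its cardinality is the number of attempts that the operation
  has made so far.\<close>

definition losing :: "proc \<Rightarrow> nat \<Rightarrow> nat \<Rightarrow> nat set" where
  "losing p k t = {n. k \<le> n \<and> n < num_attempts p (tr (G t)) \<and>
     True \<notin> set (drop k (take n (outcomes p (tr (G t)))))}"

definition pending :: "proc \<Rightarrow> nat \<Rightarrow> nat \<Rightarrow> nat" where
  "pending p k t = (case loc (G t) p of Idl \<Rightarrow> 0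
     | Act k' d pc \<Rightarrow> if k \<le> k' \<and> True \<notin> set (drop k (outcomes p (tr (G t)))) then rank pc else 0)"

lemma finite_losing: "finite (losing p k t)"
  by (rule finite_subset[of _ "{..<num_attempts p (tr (G t))}"]) (auto simp: losing_def)

text \<open>Amortisation: each new attempt of the operation brings in a credit of
  \<open>bound\<close>, and \<open>pending\<close> is the part of it that the current attempt may
  still spend.\<close>

lemma operation_steps_losing:
  "operation_steps p k (tr (G t)) + pending p k t \<le> bound * card (losing p k t)"
proof (induction t)
  case 0
  show ?case by (simp add: pending_def)
next
  case (Suc t)
  let ?h = "tr (G t)"
  show ?case
  proof (cases "sch t = p")
    case False
    have l: "loc (G (Suc t)) p = loc (G t) p" using loc_other False by auto
    have o: "outcomes p (tr (G (Suc t))) = outcomes p ?h"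
      "num_attempts p (tr (G (Suc t))) = num_attempts p ?h"
      "operation_steps p k (tr (G (Suc t))) = operation_steps p k ?h"
      using tr_Suc[of t] False
      by (auto simp: outcomes_snoc num_attempts_append operation_steps_snoc split: step.splits)
    then have "losing p k (Suc t) = losing p k t" "pending p k (Suc t) = pending p k t"
      unfolding losing_def pending_def o l by simp_all
    then show ?thesis using Suc o by simp
  next
    case sp: True
    show ?thesis
    proof (cases t rule: step_cases)
      case skip
      show ?thesis using Suc unfolding losing_def pending_def skip(2) .
    next
      case (invoke ls th)
      let ?n = "num_attempts p ?h"
      have n: "?n = length (outcomes p ?h)" using hist_Idl invoke(1) sp by simp
      have o: "outcomes p (tr (G (Suc t))) = outcomes p ?h" "num_attempts p (tr (G (Suc t))) = Suc ?n"
        using invoke(3) sp by (auto simp: outcomes_snoc num_attempts_append)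
      have pen: "pending p k t = 0" using invoke(1) sp by (simp add: pending_def)
      have sub: "losing p k t \<subseteq> losing p k (Suc t)" unfolding losing_def o by auto
      show ?thesis
      proof (cases "k \<le> ?n \<and> True \<notin> set (drop k (outcomes p ?h))")
        case True
        have "?n \<in> losing p k (Suc t)" "?n \<notin> losing p k t" using True n by (auto simp: losing_def o)
        then have "insert ?n (losing p k t) \<subseteq> losing p k (Suc t)" using sub by auto
        then have "Suc (card (losing p k t)) \<le> card (losing p k (Suc t))"
          using card_mono[OF finite_losing, of "insert ?n (losing p k t)" p k "Suc t"] \<open>?n \<notin> losing p k t\<close>
          by (simp add: finite_losing)
        then have "bound * card (losing p k t) + bound \<le> bound * card (losing p k (Suc t))"
          by (metis add.commute mult_Suc_right mult_le_mono2)
        moreover have "pending p k (Suc t) < bound"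
          using invoke(3) sp rank_start[of "sorted_list_of_fset ls"] by (simp add: pending_def bound_def)
        moreover have "operation_steps p k (tr (G (Suc t))) \<le> Suc (operation_steps p k ?h)"
          using invoke(3) by (simp add: operation_steps_snoc)
        ultimately show ?thesis using Suc by linarith
      next
        case False
        have "operation_steps p k (tr (G (Suc t))) = operation_steps p k ?h"
          using invoke(3) sp False by (auto simp: operation_steps_snoc num_attempts_append)
        moreover have "pending p k (Suc t) = 0"
          using invoke(3) sp False by (auto simp: pending_def outcomes_snoc)
        ultimately show ?thesis
          using Suc mult_le_mono2[OF card_mono[OF finite_losing sub], of bound] by linarith
      qed
    next
      case (act k' d pc)
      let ?s = "label e (u (sch t, k')) d pc (G t)"
      have k': "k' = length (outcomes p ?h)" "num_attempts p ?h = Suc k'"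
        using hist_Act[OF act(1)] sp by auto
      obtain os where os: "outcomes p (tr (G (Suc t))) = outcomes p ?h @ os" using outcomes_prefix[of t "Suc t" p] by auto
      have na: "num_attempts p (tr (G (Suc t))) = Suc k'"
        using act(2) k' by (simp add: num_attempts_append)
      have los: "losing p k (Suc t) = losing p k t"
        unfolding losing_def na k'(2) os using k'(1) by auto
      have ops: "operation_steps p k (tr (G (Suc t))) = operation_steps p k ?h +
        (if k \<le> k' \<and> True \<notin> set (drop k (outcomes p ?h)) then 1 else 0)"
        using act(2) sp k'(2) by (auto simp: operation_steps_snoc num_attempts_append)
      have l': "loc (G (Suc t)) p = after e (u (sch t, k')) k' d pc (G t)" using act sp by simp
      have pt: "pending p k t = (if k \<le> k' \<and> True \<notin> set (drop k (outcomes p ?h)) then rank pc else 0)"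
        using act(1) sp by (simp add: pending_def)
      have "pending p k (Suc t) + (if k \<le> k' \<and> True \<notin> set (drop k (outcomes p ?h)) then 1 else 0) \<le> pending p k t"
      proof (cases "after e (u (sch t, k')) k' d pc (G t)")
        case Idl
        then have "0 < rank pc" by (auto simp: after_Idl)
        then show ?thesis using Idl l' pt by (simp add: pending_def)
      next
        case (Act k2 d2 pc2)
        then have "k2 = k'" using after_Act by blast
        moreover have "rank pc2 < rank pc" by (rule after_rank[OF pc_okD[OF act(1)] Act thunk_code_bound])
        moreover have "set (drop k (outcomes p ?h)) \<subseteq> set (drop k (outcomes p (tr (G (Suc t)))))"
          unfolding os by auto
        ultimately show ?thesis using Act l' pt by (auto simp: pending_def)
      qed
      then show ?thesis using Suc unfolding ops los by linarith
    qed
  qed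
qed

lemma operation_steps_le_sched:
  "operation_steps p k (tr (G t)) \<le> nsteps (\<lambda>r. sch r = p) 0 t"
proof (induction t)
  case (Suc t)
  then show ?case using tr_Suc[of t] by (auto simp: operation_steps_snoc nsteps_Suc)
qed simp

end

section \<open>Conditioning on the earlier outcomes of a process\<close>

context lock_env
begin

abbreviation hist_at :: "seeds \<Rightarrow> nat \<Rightarrow> real history" where
  "hist_at s t \<equiv> tr (A.G s t)"

lemma history_alg: "history (alg pick) e s t = hist_at s t"
  by (simp add: history_eq_tr comp_def)

lemma determined_hist: "determined t (\<lambda>s. P (hist_at s t))"
  by (simp add: determined_def)

lemma sets_ex_hist: "{s. \<exists>t. P t (hist_at s t)} \<in> sets seed_space"
proof -
  have "{s. \<exists>t. P t (hist_at s t)} = (\<Union>t. {s. P t (hist_at s t)})" by auto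
  then show ?thesis using determined_sets[OF determined_hist] by auto
qed

lemma outcomes_take:
  assumes "n \<le> length (outcomes p (hist_at s t))" "n \<le> length (outcomes p (hist_at s t'))"
  shows "take n (outcomes p (hist_at s t)) = take n (outcomes p (hist_at s t'))"
proof -
  have "take n (outcomes p (hist_at s t)) = take n (outcomes p (hist_at s t'))"
    if "t \<le> t'" "n \<le> length (outcomes p (hist_at s t))" for t t'
    using A.outcomes_prefix[OF that(1), where s = s and q = p] that(2) by auto
  then show ?thesis using assms by (metis nat_le_linear)
qed

definition made :: "proc \<Rightarrow> bool list \<Rightarrow> seeds set" where
  "made p bs = {s. \<exists>t. length bs < num_attempts p (hist_at s t) \<and> take (length bs) (outcomes p (hist_at s t)) = bs}"

definition got :: "proc \<Rightarrow> bool list \<Rightarrow> seeds set" where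
  "got p bs = {s. \<exists>t. take (Suc (length bs)) (outcomes p (hist_at s t)) = bs @ [True]}"

lemma made_sets: "made p bs \<in> sets seed_space" and got_sets: "got p bs \<in> sets seed_space"
  unfolding made_def got_def by (rule sets_ex_hist)+

lemma attempt_made_eq: "attempt_made (alg pick) e p bs = made p bs"
  and attempt_won_eq: "attempt_won (alg pick) e p bs = got p bs"
  by (simp_all add: attempt_made_def attempt_won_def made_def got_def history_alg)

text \<open>The start of the attempt is a random time. On each piece of this partition it is fixed,
  and with it the time \<open>t1\<close> by which the attempt is over.\<close>

lemma made_starts: "made p bs = (\<Union>t0. {s. start p (length bs) bs t0 s})"
proof (intro set_eqI iffI)
  fix s assume "s \<in> made p bs"
  then obtain t where t: "length bs < num_attempts p (hist_at s t)" "take (length bs) (outcomes p (hist_at s t)) = bs"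
    unfolding made_def by blast
  obtain t0 d pc where s: "t0 < t" "scheduler e t0 = p" "loc (A.G s t0) p = Idl"
    "loc (A.G s (Suc t0)) p = Act (length bs) d pc" using A.attempt_start[OF t(1)] by blast
  have "length bs = length (outcomes p (hist_at s t0))" by (rule A.start_pc(2)[OF s(2-4)])
  then have "outcomes p (hist_at s t0) = bs" using A.outcomes_prefix[where a = t0 and b = t and s = s and q = p] s(1) t(2) by auto
  then show "s \<in> (\<Union>t0. {s. start p (length bs) bs t0 s})" using s unfolding start_def by blast
next
  fix s assume "s \<in> (\<Union>t0. {s. start p (length bs) bs t0 s})"
  then obtain t0 d pc where s: "scheduler e t0 = p" "loc (A.G s t0) p = Idl"
    "loc (A.G s (Suc t0)) p = Act (length bs) d pc" "outcomes p (hist_at s t0) = bs"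
    unfolding start_def by blast
  have "num_attempts p (hist_at s (Suc t0)) = Suc (length bs)" by (rule A.hist_Act(2)[OF s(3)])
  moreover have "take (length bs) (outcomes p (hist_at s (Suc t0))) = bs"
    using A.outcomes_prefix[where a = t0 and b = "Suc t0" and s = s and q = p] s(4) by auto
  ultimately show "s \<in> made p bs" unfolding made_def by (intro CollectI exI[of _ "Suc t0"]) simp
qed

lemma starts_disjoint: "disjoint_family (\<lambda>t0. {s. start p m bs t0 s})"
proof -
  have False if *: "start p m bs a s" "start p m bs b s" "a < b" for a b s
  proof -
    obtain d pc d' pc' where "loc (A.G s b) p = Idl" "loc (A.G s (Suc b)) p = Act m d' pc'"
      "loc (A.G s (Suc a)) p = Act m d pc" using * unfolding start_def by blast
    from A.attempt_after_start[OF this] *(3) show False by simp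
  qed
  then show ?thesis unfolding disjoint_family_on_def by (metis (no_types, lifting) disjoint_iff linorder_neqE_nat mem_Collect_eq)
qed

definition loss :: real where "loss = (if \<kappa> = 1 then 0 else 1 / 2)"

lemma start_not_got:
  assumes inf: "infinite {t. scheduler e t = p}" and cond: "4 * bound * pairs \<le> E\<^sup>2"
  shows "emeasure seed_space ({s. start p (length bs) bs t0 s} - got p bs) \<le>
    ennreal loss * emeasure seed_space {s. start p (length bs) bs t0 s}"
proof -
  let ?m = "length bs"
  let ?S = "{s. start p ?m bs t0 s}"
  obtain t1 where t1: "Suc t0 \<le> t1" "nsteps (\<lambda>r. scheduler e r = p) (Suc t0) t1 = bound"
    using nsteps_exists[OF inf] by blast
  let ?B = "{s. start p ?m bs t0 s \<and> \<not> outcomes p (hist_at s t1) ! ?m}"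
  have sB: "?B \<in> sets seed_space"
    by (rule determined_sets[of t1], rule determined_conj[OF determined_mono[OF determined_start t1(1)] determined_hist])
  have sub: "?S - got p bs \<subseteq> ?B"
  proof
    fix s assume s: "s \<in> ?S - got p bs"
    then obtain d pc where st: "scheduler e t0 = p" "loc (A.G s t0) p = Idl"
      "loc (A.G s (Suc t0)) p = Act ?m d pc" "outcomes p (hist_at s t0) = bs" unfolding start_def by blast
    have fin: "?m < length (outcomes p (hist_at s t1))" by (rule A.start_finished[OF st(1-3) t1])
    have "take ?m (outcomes p (hist_at s t1)) = bs"
      using A.outcomes_prefix[where a = t0 and b = t1 and s = s and q = p] st(4) t1(1) by auto
    then have "take (Suc ?m) (outcomes p (hist_at s t1)) = bs @ [outcomes p (hist_at s t1) ! ?m]"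
      using fin by (simp add: take_Suc_conv_app_nth)
    then have "\<not> outcomes p (hist_at s t1) ! ?m" using s unfolding got_def by auto
    then show "s \<in> ?B" using s by simp
  qed
  have "measure seed_space ?B \<le> loss * measure seed_space ?S"
  proof (cases "\<kappa> = 1")
    case True
    have e: "?B = {}" using lose_impossible[OF True _ t1] by blast
    show ?thesis unfolding e loss_def using True by simp
  next
    case False
    then show ?thesis using lose_prob[OF False t1 cond, of ?m bs] by (simp add: loss_def)
  qed
  moreover have "emeasure seed_space (?S - got p bs) \<le> emeasure seed_space ?B"
    by (rule emeasure_mono[OF sub sB])
  ultimately show ?thesis
    by (simp add: seed_space.emeasure_eq_measure ennreal_mult'[symmetric] loss_def)
qed

lemma made_not_got:
  assumes inf: "infinite {t. scheduler e t = p}" and cond: "4 * bound * pairs \<le> E\<^sup>2"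
  shows "measure seed_space (made p bs - got p bs) \<le> loss * measure seed_space (made p bs)"
proof -
  let ?S = "\<lambda>t0. {s. start p (length bs) bs t0 s}"
  have S: "?S t0 \<in> sets seed_space" for t0 by (rule determined_sets[OF determined_start])
  have dj: "disjoint_family (\<lambda>t0. ?S t0 - got p bs)"
    using starts_disjoint[of p "length bs" bs] unfolding disjoint_family_on_def by blast
  have "emeasure seed_space (made p bs - got p bs) = emeasure seed_space (\<Union>t0. ?S t0 - got p bs)"
    unfolding made_starts by (rule arg_cong[where f = "emeasure seed_space"]) auto
  also have "\<dots> = (\<Sum>t0. emeasure seed_space (?S t0 - got p bs))"
    using S got_sets dj by (intro suminf_emeasure[symmetric]) auto
  also have "\<dots> \<le> (\<Sum>t0. ennreal loss * emeasure seed_space (?S t0))"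
    by (intro suminf_le start_not_got[OF inf cond]) auto
  also have "\<dots> = ennreal loss * (\<Sum>t0. emeasure seed_space (?S t0))"
    by (rule ennreal_suminf_cmult)
  also have "(\<Sum>t0. emeasure seed_space (?S t0)) = emeasure seed_space (\<Union>t0. ?S t0)"
    using S starts_disjoint by (intro suminf_emeasure) auto
  finally have "emeasure seed_space (made p bs - got p bs) \<le> ennreal loss * emeasure seed_space (made p bs)"
    unfolding made_starts .
  then show ?thesis
    by (simp add: seed_space.emeasure_eq_measure ennreal_mult'[symmetric] loss_def split: if_splits)
qed

lemma got_made: "got p bs \<subseteq> made p bs"
proof
  fix s assume "s \<in> got p bs"
  then obtain t where t: "take (Suc (length bs)) (outcomes p (hist_at s t)) = bs @ [True]"
    unfolding got_def by blast
  then have "length (take (Suc (length bs)) (outcomes p (hist_at s t))) = Suc (length bs)" by simp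
  then have l: "Suc (length bs) \<le> length (outcomes p (hist_at s t))" by simp
  have "take (length bs) (take (Suc (length bs)) (outcomes p (hist_at s t))) = bs" unfolding t by simp
  then have "take (length bs) (outcomes p (hist_at s t)) = bs" by (simp add: min_def)
  then show "s \<in> made p bs"
    unfolding made_def using l A.num_attempts_bounds(1)[where s = s and q = p and t = t] by (intro CollectI exI[of _ t]) simp
qed

theorem fair_alg:
  assumes cond: "4 * bound * pairs \<le> E\<^sup>2"
  shows "fair (1 / (real \<kappa> * real L)) (alg pick) e"
  unfolding fair_def attempt_made_eq attempt_won_eq
proof (intro allI impI conjI made_sets got_sets)
  fix p bs assume inf: "infinite {t. scheduler e t = p}"
  have "measure seed_space (made p bs - got p bs) = measure seed_space (made p bs) - measure seed_space (got p bs)"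
    by (rule seed_space.finite_measure_Diff[OF made_sets got_sets got_made])
  then have "(1 - loss) * measure seed_space (made p bs) \<le> measure seed_space (got p bs)"
    using made_not_got[OF inf cond, of bs] by (simp add: algebra_simps)
  moreover have "1 / (real \<kappa> * real L) \<le> 1 - loss"
  proof (cases "\<kappa> = 1")
    case True
    then have "loss = 0" unfolding loss_def by simp
    then show ?thesis using pos True by simp
  next
    case False
    then have "2 * 1 \<le> \<kappa> * L" using pos by (intro mult_le_mono) auto
    then have "2 \<le> real \<kappa> * real L" by (metis mult.right_neutral of_nat_le_iff of_nat_mult of_nat_numeral)
    then show ?thesis using False by (simp add: loss_def field_simps)
  qed
  ultimately show "1 / (real \<kappa> * real L) * measure seed_space (made p bs) \<le> measure seed_space (got p bs)"
    by (meson measure_nonneg mult_right_mono order_trans)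
qed

section \<open>The geometric tail of an operation\<close>

definition unlucky :: "proc \<Rightarrow> nat \<Rightarrow> nat \<Rightarrow> seeds set" where
  "unlucky p k n = {s. \<exists>t. n < num_attempts p (hist_at s t) \<and>
     True \<notin> set (drop k (take n (outcomes p (hist_at s t))))}"

lemma unlucky_sets: "unlucky p k n \<in> sets seed_space"
  unfolding unlucky_def by (rule sets_ex_hist)

definition unlucky_outcomes :: "nat \<Rightarrow> nat \<Rightarrow> bool list set" where
  "unlucky_outcomes k n = {bs. length bs = n \<and> True \<notin> set (drop k bs)}"

lemma finite_unlucky_outcomes: "finite (unlucky_outcomes k n)"
  by (rule finite_subset[OF _ finite_lists_length_eq[of "UNIV :: bool set" n]]) (auto simp: unlucky_outcomes_def)

lemma unlucky_made: "unlucky p k n = (\<Union>bs\<in>unlucky_outcomes k n. made p bs)"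
proof (intro set_eqI iffI)
  fix s assume "s \<in> unlucky p k n"
  then obtain t where t: "n < num_attempts p (hist_at s t)" "True \<notin> set (drop k (take n (outcomes p (hist_at s t))))"
    unfolding unlucky_def by blast
  have "n \<le> length (outcomes p (hist_at s t))" using t(1) A.num_attempts_bounds(2)[where s = s and q = p and t = t] by simp
  then show "s \<in> (\<Union>bs\<in>unlucky_outcomes k n. made p bs)"
    using t by (intro UN_I[of "take n (outcomes p (hist_at s t))"]) (auto simp: unlucky_outcomes_def made_def)
qed (auto simp: unlucky_outcomes_def made_def unlucky_def)

lemma made_unique:
  assumes "s \<in> made p bs" "s \<in> made p bs'" "length bs = length bs'"
  shows "bs = bs'"
proof -
  obtain t t' where t: "length bs < num_attempts p (hist_at s t)" "take (length bs) (outcomes p (hist_at s t)) = bs"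
    "length bs' < num_attempts p (hist_at s t')" "take (length bs') (outcomes p (hist_at s t')) = bs'"
    using assms(1,2) unfolding made_def by blast
  then show ?thesis
    using outcomes_take[of "length bs" p s t t'] A.num_attempts_bounds(2)[where s = s and q = p and t = t] A.num_attempts_bounds(2)[where s = s and q = p and t = t'] assms(3)
    by simp
qed

text \<open>The bound on losing holds for every list of earlier outcomes. So it can be applied
  separately to each of the finitely many lists without a success since attempt \<open>k\<close>,
  whose events partition \<open>unlucky p k n\<close>.\<close>

lemma unlucky_Suc:
  assumes inf: "infinite {t. scheduler e t = p}" and cond: "4 * bound * pairs \<le> E\<^sup>2" and kn: "k \<le> n"
  shows "measure seed_space (unlucky p k (Suc n)) \<le> loss * measure seed_space (unlucky p k n)"
proof -
  have sub: "unlucky p k (Suc n) \<subseteq> (\<Union>bs\<in>unlucky_outcomes k n. made p bs - got p bs)"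
  proof
    fix s assume "s \<in> unlucky p k (Suc n)"
    then obtain t where t: "Suc n < num_attempts p (hist_at s t)"
      "True \<notin> set (drop k (take (Suc n) (outcomes p (hist_at s t))))" unfolding unlucky_def by blast
    let ?os = "outcomes p (hist_at s t)"
    have len: "n < length ?os" using t(1) A.num_attempts_bounds(2)[where s = s and q = p and t = t] by simp
    have f: "\<not> ?os ! n" by (rule num_attempts_outcomes_set[OF kn len t(2)])
    have "set (drop k (take n ?os)) \<subseteq> set (drop k (take (Suc n) ?os))"
      using len by (simp add: take_Suc_conv_app_nth)
    then have "take n ?os \<in> unlucky_outcomes k n" using t(2) len by (auto simp: unlucky_outcomes_def)
    moreover have "s \<in> made p (take n ?os)" using t(1) len unfolding made_def by (auto intro!: exI[of _ t])
    moreover have "s \<notin> got p (take n ?os)"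
    proof
      assume "s \<in> got p (take n ?os)"
      then obtain t' where t': "take (Suc n) (outcomes p (hist_at s t')) = take n ?os @ [True]"
        using len unfolding got_def by auto
      then have "length (take (Suc n) (outcomes p (hist_at s t'))) = Suc n" using len by simp
      then have "Suc n \<le> length (outcomes p (hist_at s t'))" by simp
      then have "take (Suc n) ?os = take n ?os @ [True]" using outcomes_take[of "Suc n" p s t t'] len t' by simp
      then show False using len f by (simp add: take_Suc_conv_app_nth)
    qed
    ultimately show "s \<in> (\<Union>bs\<in>unlucky_outcomes k n. made p bs - got p bs)" by blast
  qed
  have "measure seed_space (unlucky p k (Suc n)) \<le> measure seed_space (\<Union>bs\<in>unlucky_outcomes k n. made p bs - got p bs)"
    using made_sets got_sets finite_unlucky_outcomes
    by (intro seed_space.finite_measure_mono[OF sub] sets.finite_UN) auto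
  also have "\<dots> \<le> (\<Sum>bs\<in>unlucky_outcomes k n. measure seed_space (made p bs - got p bs))"
    using made_sets got_sets by (intro seed_space.finite_measure_subadditive_finite finite_unlucky_outcomes) auto
  also have "\<dots> \<le> (\<Sum>bs\<in>unlucky_outcomes k n. loss * measure seed_space (made p bs))"
    by (intro sum_mono made_not_got[OF inf cond])
  also have "\<dots> = loss * (\<Sum>bs\<in>unlucky_outcomes k n. measure seed_space (made p bs))"
    by (simp add: sum_distrib_left)
  also have "(\<Sum>bs\<in>unlucky_outcomes k n. measure seed_space (made p bs)) = measure seed_space (unlucky p k n)"
    unfolding unlucky_made using made_sets made_unique
    by (intro seed_space.finite_measure_finite_Union[symmetric] finite_unlucky_outcomes)
      (auto simp: disjoint_family_on_def unlucky_outcomes_def)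
  finally show ?thesis .
qed

lemma unlucky_le:
  assumes "infinite {t. scheduler e t = p}" "4 * bound * pairs \<le> E\<^sup>2"
  shows "measure seed_space (unlucky p k (k + i)) \<le> (1 / 2) ^ i"
proof (induction i)
  case 0
  show ?case by simp
next
  case (Suc i)
  have "measure seed_space (unlucky p k (k + Suc i)) \<le> loss * measure seed_space (unlucky p k (k + i))"
    using unlucky_Suc[OF assms, of k "k + i"] by simp
  also have "\<dots> \<le> 1 / 2 * (1 / 2) ^ i"
    using Suc by (intro mult_mono) (auto simp: loss_def)
  finally show ?case by simp
qed

text \<open>Every attempt in \<open>losing\<close> witnesses one of the events
  \<open>unlucky\<close>, so the series bounds the number of attempts of the operation. Its
  expectation is dominated by a geometric series.\<close>

lemma operation_steps_unlucky:
  "(of_nat (operation_steps p k (hist_at s t)) :: ennreal) \<le>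
     of_nat bound * (\<Sum>i. indicator (unlucky p k (k + i)) s)"
proof -
  let ?N = "A.losing s p k t"
  have fin: "finite ?N" by (rule A.finite_losing)
  have N: "?N = (\<lambda>i. k + i) ` {i. k + i \<in> ?N}"
  proof (intro set_eqI iffI)
    fix n assume "n \<in> ?N"
    moreover from this have "n = k + (n - k)" by (simp add: A.losing_def)
    ultimately show "n \<in> (\<lambda>i. k + i) ` {i. k + i \<in> ?N}" by (metis (mono_tags) image_eqI mem_Collect_eq)
  qed auto
  have inj: "inj_on (\<lambda>i. k + i) A" for A :: "nat set" by (auto simp: inj_on_def)
  have fin': "finite {i. k + i \<in> ?N}" using fin N inj by (metis finite_imageD)
  have "operation_steps p k (hist_at s t) \<le> bound * card ?N"
    using A.operation_steps_losing[where p = p and k = k and s = s and t = t] by linarith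
  then have "(of_nat (operation_steps p k (hist_at s t)) :: ennreal) \<le> of_nat (bound * card ?N)"
    by (simp only: of_nat_le_iff)
  also have "\<dots> = of_nat bound * of_nat (card ?N)" by simp
  also have "card ?N = card {i. k + i \<in> ?N}" using N card_image[OF inj] by metis
  also have "(of_nat (card {i. k + i \<in> ?N}) :: ennreal) = (\<Sum>i\<in>{i. k + i \<in> ?N}. indicator (unlucky p k (k + i)) s)"
  proof -
    have "indicator (unlucky p k (k + i)) s = (1 :: ennreal)" if "i \<in> {i. k + i \<in> ?N}" for i
      using that unfolding A.losing_def unlucky_def by (auto simp: indicator_def)
    then have "(\<Sum>i\<in>{i. k + i \<in> ?N}. indicator (unlucky p k (k + i)) s) = (\<Sum>i\<in>{i. k + i \<in> ?N}. (1 :: ennreal))"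
      by (rule sum.cong[OF refl])
    then show ?thesis by simp
  qed
  also have "\<dots> \<le> (\<Sum>i. indicator (unlucky p k (k + i)) s)"
    by (intro sum_le_suminf fin') auto
  finally show ?thesis by (simp add: mult_left_mono)
qed

theorem wait_free_alg:
  assumes cond: "4 * bound * pairs \<le> E\<^sup>2"
  shows "wait_free (alg pick) e"
  unfolding wait_free_def history_alg
proof (intro allI conjI)
  fix p k
  have m1: "(\<lambda>s. of_nat (operation_steps p k (hist_at s t)) :: ennreal) \<in> borel_measurable seed_space" for t
  proof -
    have "(\<lambda>s. operation_steps p k (hist_at s t)) \<in> measurable seed_space (count_space UNIV)"
    proof (rule measurable_count_space_eq_countable[THEN iffD2])
      show "(\<lambda>s. operation_steps p k (hist_at s t)) \<in> space seed_space \<rightarrow> UNIV \<and>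
        (\<forall>a\<in>UNIV. (\<lambda>s. operation_steps p k (hist_at s t)) -` {a} \<inter> space seed_space \<in> sets seed_space)"
        using determined_sets[OF determined_hist, of "\<lambda>h. operation_steps p k h = _" t] by (auto simp: vimage_def)
    qed simp
    then show ?thesis by (rule measurable_compose) simp
  qed
  then show m: "(\<lambda>s. SUP t. of_nat (operation_steps p k (hist_at s t)) :: ennreal) \<in> borel_measurable seed_space"
    by (intro borel_measurable_SUP) auto
  show "(\<integral>\<^sup>+ s. (SUP t. of_nat (operation_steps p k (hist_at s t))) \<partial>seed_space) < \<infinity>"
  proof (cases "finite {t. scheduler e t = p}")
    case True
    \<comment> \<open>A process that is scheduled only finitely often may never complete an attempt,
      so fairness gives nothing here; the schedule itself bounds its steps.\<close>
    have "operation_steps p k (hist_at s t) \<le> card {t. scheduler e t = p}" for s t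
    proof -
      have "nsteps (\<lambda>r. scheduler e r = p) 0 t \<le> card {t. scheduler e t = p}"
        unfolding nsteps_def by (rule card_mono[OF True]) auto
      then show ?thesis
        using A.operation_steps_le_sched[where p = p and k = k and s = s and t = t] by linarith
    qed
    then have "(SUP t. of_nat (operation_steps p k (hist_at s t))) \<le> (of_nat (card {t. scheduler e t = p}) :: ennreal)" for s
      by (intro SUP_least) simp
    then have "(\<integral>\<^sup>+ s. (SUP t. of_nat (operation_steps p k (hist_at s t))) \<partial>seed_space) \<le>
        (\<integral>\<^sup>+ s. of_nat (card {t. scheduler e t = p}) \<partial>seed_space)"
      by (intro nn_integral_mono)
    also have "\<dots> = of_nat (card {t. scheduler e t = p})"
      by (simp add: seed_space.emeasure_space_1[simplified])
    also have "\<dots> < \<infinity>" by (simp add: of_nat_less_top)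
    finally show ?thesis .
  next
    case inf: False
    have "(\<integral>\<^sup>+ s. (SUP t. of_nat (operation_steps p k (hist_at s t))) \<partial>seed_space) \<le>
        (\<integral>\<^sup>+ s. of_nat bound * (\<Sum>i. indicator (unlucky p k (k + i)) s) \<partial>seed_space)"
      by (intro nn_integral_mono SUP_least operation_steps_unlucky)
    also have "\<dots> = of_nat bound * (\<integral>\<^sup>+ s. (\<Sum>i. indicator (unlucky p k (k + i)) s) \<partial>seed_space)"
      using unlucky_sets by (intro nn_integral_cmult) auto
    also have "(\<integral>\<^sup>+ s. (\<Sum>i. indicator (unlucky p k (k + i)) s) \<partial>seed_space) =
        (\<Sum>i. \<integral>\<^sup>+ s. indicator (unlucky p k (k + i)) s \<partial>seed_space)"
      using unlucky_sets by (intro nn_integral_suminf) auto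
    also have "\<dots> = (\<Sum>i. emeasure seed_space (unlucky p k (k + i)))"
      using unlucky_sets by simp
    also have "\<dots> \<le> (\<Sum>i. ennreal ((1 / 2) ^ i))"
      using unlucky_le[OF inf cond] by (intro suminf_le) (auto simp: seed_space.emeasure_eq_measure intro!: ennreal_leI)
    also have "\<dots> = ennreal (\<Sum>i. (1 / 2) ^ i)"
      by (intro suminf_ennreal2) (auto intro: summable_geometric)
    finally have "(\<integral>\<^sup>+ s. (SUP t. of_nat (operation_steps p k (hist_at s t))) \<partial>seed_space) \<le>
        of_nat bound * ennreal (\<Sum>i. (1 / 2) ^ i)" by (simp add: mult_left_mono)
    also have "\<dots> < \<infinity>" by (simp add: ennreal_mult_less_top of_nat_less_top)
    finally show ?thesis .
  qed
qed

end

text \<open>All terms except the window are multiples of \<open>W = m * m * T\<close> with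
  \<open>m = \<kappa> * L\<close>. As \<open>pairs\<close> is at most \<open>29 * W\<close>, the
  second claim amounts to \<open>4 * 4 * 29 = 464\<close> staying below the factor in
  \<open>E\<close>, and 500 is a round number above it. For the first claim alone 47 would
  do.\<close>

lemma bound_le:
  fixes \<kappa> L T :: nat
  assumes "1 \<le> \<kappa>" "1 \<le> L" "1 \<le> T"
  defines "E \<equiv> 500 * (\<kappa>\<^sup>2 * L\<^sup>2 * T)"
  shows "algo.bound \<kappa> L T E \<le> 4 * E" "4 * algo.bound \<kappa> L T E * algo.pairs \<kappa> L T \<le> E\<^sup>2"
proof -
  define m where "m = \<kappa> * L"
  define W where "W = m * m * T"
  have m1: "1 \<le> m" using assms(1,2) by (simp add: m_def)
  have E: "E = 500 * W" by (simp add: E_def W_def m_def power2_eq_square mult_ac)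
  have E1: "1 \<le> E" using m1 assms(3) by (simp add: E W_def)
  interpret algo \<kappa> L T E by unfold_locales (use assms E1 in auto)
  have mm: "m \<le> m * m" using m1 by simp
  have W1: "m * m \<le> W" "m * T \<le> W" "m \<le> W" "T \<le> W" "1 \<le> W" "\<kappa> \<le> W" "L \<le> W" "L * \<kappa> \<le> W"
  proof -
    show 1: "m * m \<le> W" using assms(3) by (simp add: W_def)
    show "m * T \<le> W" using mm by (simp add: W_def mult_le_mono1)
    show 2: "m \<le> W" by (rule le_trans[OF mm 1])
    show "T \<le> W" using m1 by (simp add: W_def)
    show "1 \<le> W" using m1 2 by simp
    have "\<kappa> \<le> m" "L \<le> m" using assms(1,2) by (simp_all add: m_def)
    then show "\<kappa> \<le> W" "L \<le> W" using 2 by simp_all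
    show "L * \<kappa> \<le> W" using 2 by (simp add: m_def mult.commute)
  qed
  have help_cost: "help_cost = 2 * m + T + 8" by (simp add: help_cost_def m_def)
  have "bound = m * (2 * m + T + 10) + (3 * E + (2 * m + T + 8) + (2 * m + T + 9 + m + 3)) + 4 + L * (\<kappa> + 1) + \<kappa>"
    by (simp add: bound_def wait_rank_def pad_rank_def pad_length_def window_def help_cost m_def[symmetric])
  also have "\<dots> = 3 * E + (2 * (m * m) + m * T + 15 * m + 2 * T + 24 + L * \<kappa> + L + \<kappa>)"
    by (simp add: algebra_simps)
  also have "\<dots> \<le> 3 * E + 500 * W" using W1 by linarith
  finally show b: "bound \<le> 4 * E" by (simp add: E)
  have "pairs = 2 * (m * (2 * m + T + 8)) + m * (4 * m + 3)"
    unfolding pairs_def help_cost scan_cost_def m_def[symmetric] by (simp add: algebra_simps)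
  also have "\<dots> = 8 * (m * m) + 2 * (m * T) + 19 * m" by (simp add: algebra_simps)
  also have "\<dots> \<le> 29 * W" using W1 by linarith
  finally have p: "pairs \<le> 29 * W" .
  have "4 * bound * pairs \<le> 4 * (4 * E) * (29 * W)" using b p by (intro mult_le_mono) auto
  also have "\<dots> = 464 * W * E" by simp
  also have "\<dots> \<le> E * E" by (intro mult_le_mono1) (simp add: E)
  finally show "4 * bound * pairs \<le> E\<^sup>2" by (simp add: power2_eq_square)
qed

theorem theorem1p1:
  shows "\<exists>C::nat. \<forall>\<kappa> L T :: nat. 1 \<le> \<kappa> \<and> 1 \<le> L \<and> 1 \<le> T \<longrightarrow>
    (\<exists>A::algorithm. \<forall>e::environment. admissible \<kappa> L T e \<longrightarrow>
       (\<forall>seed \<in> conflict_free. \<forall>t.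
          mutual_exclusion (history A e seed t) \<and>
          step_bound (C * (\<kappa>^2 * L^2 * T)) (history A e seed t)) \<and>
       (measurable_player e \<longrightarrow>
          fair (1 / (real \<kappa> * real L)) A e \<and>
          wait_free A e))"
proof (intro exI[of _ 2000] allI impI)
  fix \<kappa> L T :: nat
  assume pos: "1 \<le> \<kappa> \<and> 1 \<le> L \<and> 1 \<le> T"
  \<comment> \<open>With \<open>bound\<close> at most \<open>4 * E\<close>, the factor 500 gives the
    absolute constant 2000.\<close>
  define E where "E = 500 * (\<kappa>\<^sup>2 * L\<^sup>2 * T)"
  have E1: "1 \<le> E" using pos by (simp add: E_def)
  \<comment> \<open>Outside its locale \<open>pick\<close> takes only \<open>\<kappa>\<close> and
    \<open>E\<close> as parameters, so the algorithm is chosen before the environment.\<close>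
  let ?A = "algo.alg \<kappa> L T E (lock_env.pick \<kappa> E)"
  have "\<forall>e. admissible \<kappa> L T e \<longrightarrow>
       (\<forall>seed \<in> conflict_free. \<forall>t.
          mutual_exclusion (history ?A e seed t) \<and>
          step_bound (2000 * (\<kappa>^2 * L^2 * T)) (history ?A e seed t)) \<and>
       (measurable_player e \<longrightarrow>
          fair (1 / (real \<kappa> * real L)) ?A e \<and>
          wait_free ?A e)"
  proof (intro allI impI)
    fix e assume adm: "admissible \<kappa> L T e"
    interpret lock_env \<kappa> L T E e by unfold_locales (use pos E1 adm in auto)
    have b: "bound \<le> 4 * E" and cond: "4 * bound * pairs \<le> E\<^sup>2"
      using bound_le[of \<kappa> L T] pos unfolding E_def by auto
    have "mutual_exclusion (history (alg pick) e seed t)" for seed t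
      unfolding history_alg by (rule A.mutual_exclusion_tr)
    moreover have "step_bound (2000 * (\<kappa>\<^sup>2 * L\<^sup>2 * T)) (history (alg pick) e seed t)" for seed t
    proof -
      have "bound \<le> 2000 * (\<kappa>\<^sup>2 * L\<^sup>2 * T)" using b by (simp add: E_def)
      then show ?thesis
        using A.step_bound_tr[where s = seed and t = t] unfolding history_alg step_bound_def by (meson le_trans)
    qed
    ultimately show "(\<forall>seed \<in> conflict_free. \<forall>t.
          mutual_exclusion (history (alg pick) e seed t) \<and>
          step_bound (2000 * (\<kappa>^2 * L^2 * T)) (history (alg pick) e seed t)) \<and>
       (measurable_player e \<longrightarrow>
          fair (1 / (real \<kappa> * real L)) (alg pick) e \<and>
          wait_free (alg pick) e)"
      using fair_alg[OF cond] wait_free_alg[OF cond] by blast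
  qed
  then show "\<exists>A::algorithm. \<forall>e::environment. admissible \<kappa> L T e \<longrightarrow>
       (\<forall>seed \<in> conflict_free. \<forall>t.
          mutual_exclusion (history A e seed t) \<and>
          step_bound (2000 * (\<kappa>^2 * L^2 * T)) (history A e seed t)) \<and>
       (measurable_player e \<longrightarrow>
          fair (1 / (real \<kappa> * real L)) A e \<and>
          wait_free A e)" by blast
qed

end
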